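(* Let $K : \mathrm{Per}(\mathbb{R}) \to C^1(\mathbb{R})\cap \mathrm{Per}(\mathbb{R})$ be a mapping which is continuous as a map $\mathrm{Per}(\mathbb{R})\to\mathrm{Per}(\mathbb{R})$ and for which there exists a constant $v_{\max}>0$ such that $0 \le (K(\rho))(x) \le v_{\max}$ for all $x\in\mathbb{R}$, $\rho\in\mathrm{Per}(\mathbb{R})$. Suppose there exists a non-decreasing function $a:\mathbb{R}_+\to\mathbb{R}_+$ such that for all $\rho,\bar\rho\in\mathrm{Per}(\mathbb{R})$: $$\int_0^1 |\rho(x)-\bar\rho(x)|\,|(K(\rho))(x)-(K(\bar\rho))(x)|\,dx \le a(\|\rho\|_\infty+\|\bar\rho\|_\infty)\int_0^1|\rho(x)-\bar\rho(x)|^2dx,$$ $$\int_0^1 |\rho(x)-\bar\rho(x)|\,\Big|\tfrac{\partial}{\partial x}\big((K(\rho))(x)-(K(\bar\rho))(x)\big)\Big|\,dx \le a(\|\rho\|_\infty+\|\bar\rho\|_\infty)\int_0^1|\rho(x)-\bar\rho(x)|^2dx.$$ Finally suppose there exists a parameterized family $K_N$ that smoothly approximates $K$ (in the sense defined in the context). Then for every $\rho_0 \in W^{2,\infty}(\mathbb{R})\cap\mathrm{Per}(\mathbb{R})$ the initial-value problem $$\frac{\partial\rho}{\partial t}(t,x) + \frac{\partial}{\partial x}\big(\rho(t,x)v(t,x)\big) = 0,\quad v(t,x) = (K(\rho[t]))(x),\quad \rho(t,x+1)=\rho(t,x)\quad (t\ge0,\ x\in\mathbb{R}),\qquad \rho[0]=\rho_0,$$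 has a unique solution $\rho\in C^1(\mathbb{R}_+\times\mathbb{R})$ with $\rho[t]\in W^{2,\infty}(\mathbb{R})\cap\mathrm{Per}(\mathbb{R})$ for all $t\ge0$. Moreover, for all $t\ge0$, $x\in\mathbb{R}$: $$\min_{x\in[0,1]}\rho_0(x) \le \rho(t,x) \le \max_{x\in[0,1]}\rho_0(x).$$
   Context: $\mathbb{R}_+ = [0,+\infty)$. $\mathrm{Per}(\mathbb{R})$ denotes the set of continuous, positive functions $\rho:\mathbb{R}\to(0,+\infty)$ that are periodic with period $1$; continuity of maps on $\mathrm{Per}(\mathbb{R})$ is with respect to the uniform (sup) metric. $W^{2,\infty}(\mathbb{R})$ denotes the $C^1$ functions with Lipschitz derivative. For $\rho:\mathbb{R}_+\times\mathbb{R}\to\mathbb{R}$, $\rho[t]$ denotes the profile $x\mapsto\rho(t,x)$. For $y \in \mathbb{R}^N$, $|y|_\infty = \max_i |y_i|$; for $x,y\in\mathbb{R}^N$, $x \le y$ means componentwise; $1_N = (1,\dots,1)^\top$. For $\rho = (\rho_0,\dots,\rho_{N-1})^\top \in \mathbb{R}^N$ and $i=1,\dots,N-1$, $\rho^{(i)} = (\rho_i,\dots,\rho_{N-1},\rho_0,\dots,\rho_{i-1})^\top$, $\rho^{(0)}=\rho$, and in general $\rho^{(k)}$ is obtained by applying the cyclic left shift $k$ times. For $h=1/N$ and $\rho\in\mathbb{R}^N$, $P_N\rho$ is the $1$-periodic function with $(P_N\rho)(x) = h^{-1}\rho_i((i+1)h - x) + h^{-1}\rho_{i+1}(x - ih)$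 for $x \in [ih,(i+1)h]$, $i=0,\dots,N-2$, and $(P_N\rho)(x) = h^{-1}\rho_{N-1}(1-x) + h^{-1}\rho_0(x+h-1)$ for $x\in[(N-1)h,1]$. Definition (smooth approximation). Let $K:\mathrm{Per}(\mathbb{R})\to\mathrm{Per}(\mathbb{R})$ be continuous with $0 \le (K(\rho))(x) \le v_{\max}$ for all $x,\rho$. A family of mappings $K_N:\mathbb{R}^N\to\mathbb{R}_+$, indexed by integers $N>2$, smoothly approximates $K$ if there exist constants $L,c,C,S\ge 0$ and non-decreasing functions $\gamma,\Gamma,W:\mathbb{R}_+\to\mathbb{R}_+$ such that $K_N(\rho)\le v_{\max}$ for all $\rho\in\mathbb{R}_+^N$, and for all $N>2$, $0<\rho_{\min}\le\rho_{\max}$, $i=0,\dots,N-1$ and all $\rho=(\rho_0,\dots,\rho_{N-1})^\top,\tilde\rho \in\mathbb{R}_+^N$ with $\rho_{\min}1_N\le\rho\le\rho_{\max}1_N$, $\rho_{\min}1_N\le\tilde\rho\le\rho_{\max}1_N$, writing $h=1/N$, $y = h^{-1}(\rho^{(1)}-\rho)$, $\varphi = h^{-2}(\rho^{(2)}-2\rho^{(1)}+\rho)$: (i) $|K_N(\rho)-K_N(\tilde\rho)| \le L|\rho-\tilde\rho|_\infty$; (ii) $|K_N(\rho)-K_N(\rho^{(1)})-K_N(\tilde\rho)+K_N(\tilde\rho^{(1)})| \le (h|\rho-\tilde\rho|_\infty + h^2)\Gamma(\rho_{\max})$; (iii) $-ch(\rho_{\max}-\rho_0) \le K_N(\rho^{(1)})-K_N(\rho)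 \le ch(\rho_0-\rho_{\min})$; (iv) $|2K_N(\rho^{(1)})-K_N(\rho)-K_N(\rho^{(2)})| \le h^2(\gamma(\rho_{\max}) + C|y|_\infty)$; (v) $|3K_N(\rho^{(1)})+K_N(\rho^{(3)})-K_N(\rho)-3K_N(\rho^{(2)})| \le h^3(W(\rho_{\max}+|y|_\infty) + C|\varphi|_\infty)$; (vi) $|(K(P_N\rho))(ih) - K_N(\rho^{(i)})| \le hS\rho_{\max}$. *)

theory Defs
  imports "HOL-Analysis.Analysis"
begin

definition Per :: "(real \<Rightarrow> real) set" where
  "Per = {f. continuous_on UNIV f \<and> (\<forall>x. f x > 0) \<and> (\<forall>x. f (x + 1) = f x)}"

definition C1 :: "(real \<Rightarrow> real) \<Rightarrow> bool" where
  "C1 f \<longleftrightarrow> (\<forall>x. f differentiable (at x)) \<and> continuous_on UNIV (deriv f)"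

definition W2inf :: "(real \<Rightarrow> real) \<Rightarrow> bool" where
  "W2inf f \<longleftrightarrow> C1 f \<and> (\<exists>M. \<forall>x y. \<bar>deriv f x - deriv f y\<bar> \<le> M * \<bar>x - y\<bar>)"

definition supn :: "(real \<Rightarrow> real) \<Rightarrow> real" where
  "supn f = (SUP x. \<bar>f x\<bar>)"

text \<open>Vectors in R^N are represented as functions nat => real; only indices < N matter.\<close>
definition vnorm :: "nat \<Rightarrow> (nat \<Rightarrow> real) \<Rightarrow> real" where
  "vnorm N y = Max {\<bar>y i\<bar> | i. i < N}"

definition cshift :: "nat \<Rightarrow> nat \<Rightarrow> (nat \<Rightarrow> real) \<Rightarrow> (nat \<Rightarrow> real)" where
  "cshift N k \<rho> = (\<lambda>i. \<rho> ((i + k) mod N))"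

text \<open>Piecewise linear periodic interpolation P_N rho (defined on [0,1), extended 1-periodically).\<close>
definition PN :: "nat \<Rightarrow> (nat \<Rightarrow> real) \<Rightarrow> real \<Rightarrow> real" where
  "PN N \<rho> x = (let h = 1 / real N; z = x - of_int \<lfloor>x\<rfloor>; i = nat \<lfloor>z * real N\<rfloor> in
     if i + 2 \<le> N
     then \<rho> i * ((real i + 1) * h - z) / h + \<rho> (i + 1) * (z - real i * h) / h
     else \<rho> (N - 1) * (1 - z) / h + \<rho> 0 * (z + h - 1) / h)"

definition inbox :: "nat \<Rightarrow> real \<Rightarrow> real \<Rightarrow> (nat \<Rightarrow> real) \<Rightarrow> bool" where
  "inbox N lo hi \<rho> \<longleftrightarrow> (\<forall>i<N. lo \<le> \<rho> i \<and> \<rho> i \<le> hi)"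

definition nondec_nonneg :: "(real \<Rightarrow> real) \<Rightarrow> bool" where
  "nondec_nonneg f \<longleftrightarrow> mono_on {0..} f \<and> (\<forall>x\<ge>0. f x \<ge> 0)"

definition smoothly_approximates ::
  "(nat \<Rightarrow> (nat \<Rightarrow> real) \<Rightarrow> real) \<Rightarrow> ((real \<Rightarrow> real) \<Rightarrow> (real \<Rightarrow> real)) \<Rightarrow> real \<Rightarrow> bool" where
  "smoothly_approximates KN K vmax \<longleftrightarrow>
    (\<forall>N \<rho>. N > 2 \<longrightarrow> KN N \<rho> \<ge> 0) \<and>
    (\<exists>L c C S \<gamma> \<Gamma> W. L \<ge> 0 \<and> c \<ge> 0 \<and> C \<ge> 0 \<and> S \<ge> 0 \<and>
       nondec_nonneg \<gamma> \<and> nondec_nonneg \<Gamma> \<and> nondec_nonneg W \<and>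
       (\<forall>N \<rho>. N > 2 \<longrightarrow> (\<forall>i<N. \<rho> i \<ge> 0) \<longrightarrow> KN N \<rho> \<le> vmax) \<and>
       (\<forall>N \<rho>min \<rho>max \<rho> \<rho>'. N > 2 \<longrightarrow> 0 < \<rho>min \<longrightarrow> \<rho>min \<le> \<rho>max \<longrightarrow>
          inbox N \<rho>min \<rho>max \<rho> \<longrightarrow> inbox N \<rho>min \<rho>max \<rho>' \<longrightarrow>
          (let h = 1 / real N;
               y = (\<lambda>i. (cshift N 1 \<rho> i - \<rho> i) / h);
               \<phi> = (\<lambda>i. (cshift N 2 \<rho> i - 2 * cshift N 1 \<rho> i + \<rho> i) / h\<^sup>2) in
           \<bar>KN N \<rho> - KN N \<rho>'\<bar> \<le> L * vnorm N (\<lambda>i. \<rho> i - \<rho>' i) \<and>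
           \<bar>KN N \<rho> - KN N (cshift N 1 \<rho>) - KN N \<rho>' + KN N (cshift N 1 \<rho>')\<bar>
              \<le> (h * vnorm N (\<lambda>i. \<rho> i - \<rho>' i) + h\<^sup>2) * \<Gamma> \<rho>max \<and>
           - c * h * (\<rho>max - \<rho> 0) \<le> KN N (cshift N 1 \<rho>) - KN N \<rho> \<and>
           KN N (cshift N 1 \<rho>) - KN N \<rho> \<le> c * h * (\<rho> 0 - \<rho>min) \<and>
           \<bar>2 * KN N (cshift N 1 \<rho>) - KN N \<rho> - KN N (cshift N 2 \<rho>)\<bar>
              \<le> h\<^sup>2 * (\<gamma> \<rho>max + C * vnorm N y) \<and>
           \<bar>3 * KN N (cshift N 1 \<rho>) + KN N (cshift N 3 \<rho>) - KN N \<rho> - 3 * KN N (cshift N 2 \<rho>)\<bar>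
              \<le> h ^ 3 * (W (\<rho>max + vnorm N y) + C * vnorm N \<phi>) \<and>
           (\<forall>i<N. \<bar>K (PN N \<rho>) (real i * h) - KN N (cshift N i \<rho>)\<bar> \<le> h * S * \<rho>max))))"

definition C1_half :: "(real \<Rightarrow> real \<Rightarrow> real) \<Rightarrow> bool" where
  "C1_half \<rho> \<longleftrightarrow> (\<exists>\<rho>t \<rho>x.
     (\<forall>t\<ge>0. \<forall>x. ((\<lambda>s. \<rho> s x) has_real_derivative \<rho>t t x) (at t within {0..}) \<and>
                 ((\<lambda>y. \<rho> t y) has_real_derivative \<rho>x t x) (at x)) \<and>
     continuous_on ({0..} \<times> UNIV) (\<lambda>(t, x). \<rho> t x) \<and>
     continuous_on ({0..} \<times> UNIV) (\<lambda>(t, x). \<rho>t t x) \<and>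
     continuous_on ({0..} \<times> UNIV) (\<lambda>(t, x). \<rho>x t x))"

definition is_solution ::
  "((real \<Rightarrow> real) \<Rightarrow> (real \<Rightarrow> real)) \<Rightarrow> (real \<Rightarrow> real) \<Rightarrow> (real \<Rightarrow> real \<Rightarrow> real) \<Rightarrow> bool" where
  "is_solution K \<rho>0 \<rho> \<longleftrightarrow>
     C1_half \<rho> \<and>
     (\<forall>t\<ge>0. W2inf (\<rho> t) \<and> \<rho> t \<in> Per) \<and>
     (\<forall>t\<ge>0. \<forall>x. ((\<lambda>s. \<rho> s x) has_real_derivative
                    - deriv (\<lambda>y. \<rho> t y * K (\<rho> t) y) x) (at t within {0..})) \<and>
     \<rho> 0 = \<rho>0"

end

theory Submission
  imports Defs
begin

text \<open>
  Letting the sampling become infinitely fine turns the conditions on \<open>K\<^sub>N\<close> into estimates for \<open>K\<close>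
  itself: \<open>\<rho> \<mapsto> K \<rho>\<close> and \<open>\<rho> \<mapsto> (K \<rho>)'\<close> are Lipschitz in the sup norm,
  \<open>- c (max \<rho> - \<rho>) \<le> (K \<rho>)' \<le> c (\<rho> - min \<rho>)\<close>, and first and second differences of \<open>(K \<rho>)'\<close> are
  controlled by those of \<open>\<rho>\<close>, linearly in the highest order.  Consider then, on functions of
  a real variable, the explicit upwind step
  \<open>u \<mapsto> u - \<tau> (K u \<cdot> (u - u(\<cdot> - h)) / h + u (K u)')\<close> with \<open>\<tau>\<close> proportional to \<open>h\<close>.  It obeys the
  maximum principle exactly, it propagates bounds on first and second differences by a discrete
  Gronwall argument, and it is stable in the sup norm.  Halving \<open>h\<close> changes one step by \<open>O(\<tau>\<^sup>2)\<close>, so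
  the iterates form a Cauchy sequence, locally uniformly in time; the limit has bounded second
  differences and solves the equation.  Any solution is consistent with the
  scheme, so by stability it is the limit of the iterates; this gives uniqueness.
\<close>

section \<open>Sampling and interpolation\<close>

text \<open>Functions on the line, rather than grid vectors, allow iterates with different
  \<open>h\<close> to be compared pointwise and \<open>K\<close> to be applied to them directly. The
  price is that the conditions must first be carried from \<open>KN\<close> to \<open>K\<close>.
  Sup-norm continuity of \<open>K\<close> suffices for this, because a bound on a k-th difference of
  \<open>KN\<close> carries the factor \<open>(1 / N) ^ k\<close>: summed over about
  \<open>a * N\<close> indices in each of k directions, it no longer depends on \<open>N\<close>.
  The iterates are shown to converge in the sup norm only. Their slopes are recovered by
  interpolating between that norm and the second-difference bound, at a scale of the order of the
  square root of the sup-norm error. Linearity in the highest order keeps the growth rates linear,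
  so the bounds are finite at every time; a quadratic rate could blow up. Second differences may
  enter with any dependence on the Lipschitz constant, since that is bounded beforehand. No
  second-difference bound uniform in time comes with an arbitrary solution. Stability is therefore
  arranged so that its constant involves the Lipschitz constant of one of the two functions only,
  the iterate, and no second differences.\<close>

lemma periodic_int:
  fixes u :: "real \<Rightarrow> 'a"
  assumes per: "\<And>x. u (x + 1) = u x"
  shows "u (x + of_int n) = u x"
proof -
  have nat: "u (y + of_nat k) = u y" for y k
  proof (induction k)
    case (Suc k)
    then show ?case using per[of "y + of_nat k"] by (simp add: ac_simps)
  qed simp
  show ?thesis
  proof (cases "n \<ge> 0")
    case True
    then show ?thesis using nat[of x "nat n"] by simp
  next
    case False
    then show ?thesis using nat[of "x + of_int n" "nat (- n)"] by simp
  qed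
qed

text \<open>Periodicity hides the wrap-around branch of \<open>PN\<close>: the last cell
  interpolates towards \<open>u 0\<close>, which equals \<open>u 1\<close>. Hence the reduction of
  \<open>x\<close> modulo 1 can be undone, and one formula holds on the whole line.\<close>

lemma PN_sample:
  assumes per: "\<And>x. u (x + 1) = u x" and N: "N > 0"
  shows "PN N (\<lambda>i. u (real i / real N)) x =
    u (of_int \<lfloor>x * real N\<rfloor> / real N) * (of_int \<lfloor>x * real N\<rfloor> + 1 - x * real N) +
    u ((of_int \<lfloor>x * real N\<rfloor> + 1) / real N) * (x * real N - of_int \<lfloor>x * real N\<rfloor>)"
proof -
  define z where "z = x - of_int \<lfloor>x\<rfloor>"
  define i where "i = nat \<lfloor>z * real N\<rfloor>"
  define j where "j = \<lfloor>x * real N\<rfloor>"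
  have z: "0 \<le> z" "z < 1" unfolding z_def by linarith+
  have zN: "z * real N = x * real N - of_int (int N * \<lfloor>x\<rfloor>)"
    by (simp add: z_def algebra_simps)
  have fl: "\<lfloor>z * real N\<rfloor> = j - int N * \<lfloor>x\<rfloor>"
    unfolding zN j_def by (metis floor_diff_of_int)
  have "0 \<le> \<lfloor>z * real N\<rfloor>" using z by simp
  then have i: "real i = of_int j - real N * of_int \<lfloor>x\<rfloor>"
    unfolding i_def fl by simp
  have "z * real N < real N" using z N by simp
  then have iN: "i < N" unfolding i_def using N by linarith
  have ui: "u (real i / real N) = u (of_int j / real N)"
    using periodic_int[of u "of_int j / real N" "- \<lfloor>x\<rfloor>"] per N i
    by (simp add: diff_divide_distrib)
  have ui1: "u ((real i + 1) / real N) = u ((of_int j + 1) / real N)"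
  proof -
    have "(real i + 1) / real N = (of_int j + 1) / real N + of_int (- \<lfloor>x\<rfloor>)"
      using N i by (simp add: field_simps)
    then show ?thesis using periodic_int[of u "(of_int j + 1) / real N" "- \<lfloor>x\<rfloor>"] per
      by metis
  qed
  have w1: "of_int j + 1 - x * real N = real i + 1 - z * real N"
    and w2: "x * real N - of_int j = z * real N - real i"
    unfolding i zN by simp_all
  have "PN N (\<lambda>i. u (real i / real N)) x =
      u (real i / real N) * (real i + 1 - z * real N) + u ((real i + 1) / real N) * (z * real N - real i)"
  proof (cases "i + 2 \<le> N")
    case True
    then show ?thesis unfolding PN_def Let_def z_def[symmetric] i_def[symmetric]
      using N by (simp add: field_simps)
  next
    case False
    then have Ni: "real N = real i + 1" "N - 1 = i" using iN by simp_all
    have "u ((real i + 1) / real N) = u 0" using Ni per[of 0] by simp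
    then show ?thesis unfolding PN_def Let_def z_def[symmetric] i_def[symmetric]
      using N False Ni(2) unfolding Ni(1) by (simp add: field_simps)
  qed
  then show ?thesis unfolding ui ui1 w1[symmetric] w2[symmetric] j_def .
qed

lemma isCont_if_continuous_on_unit_intervals:
  fixes f :: "real \<Rightarrow> real"
  assumes "\<And>j::int. continuous_on {of_int j..of_int j + 1} f"
  shows "isCont f s"
proof -
  define j where "j = \<lfloor>s\<rfloor>"
  have "continuous_on ({of_int (j-1)..of_int (j-1) + 1} \<union> {of_int j..of_int j + 1}) f"
    using assms[of "j-1"] assms[of j] by (intro continuous_on_closed_Un) auto
  moreover have "{of_int (j-1)..of_int (j-1) + 1} \<union> {of_int j..of_int j + 1} = {of_int j - 1..of_int j + (1::real)}"
    by auto
  ultimately have "continuous_on {of_int j - 1..of_int j + 1} f" by simp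
  moreover have "s \<in> {of_int j - 1<..<of_int j + 1}" unfolding j_def by auto linarith+
  ultimately show ?thesis
    by (metis continuous_on_interior interior_atLeastAtMost_real)
qed

lemma PN_sample_on_interval:
  assumes per: "\<And>x. u (x + 1) = u x" and N: "N > 0"
    and s: "of_int j \<le> s" "s \<le> of_int j + 1"
  shows "PN N (\<lambda>i. u (real i / real N)) (s / real N) =
    u (of_int j / real N) * (of_int j + 1 - s) + u ((of_int j + 1) / real N) * (s - of_int j)"
proof -
  have sN: "s / real N * real N = s" using N by simp
  show ?thesis
  proof (cases "s = of_int j + 1")
    \<comment> \<open>At the right end of the cell the floor has already jumped to
      \<open>j + 1\<close>. Both affine formulas give the node value there, which is what makes the
      pieces fit together.\<close>
    case True
    then have "\<lfloor>s\<rfloor> = j + 1" by simp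
    then show ?thesis using PN_sample[of u N "s / real N", OF per N] True unfolding sN by simp
  next
    case False
    then have "\<lfloor>s\<rfloor> = j" using s by linarith
    then show ?thesis using PN_sample[of u N "s / real N", OF per N] unfolding sN by simp
  qed
qed

text \<open>In the variable \<open>s = x * real N\<close> the cells become the unit intervals
  between integers, and continuity is glued from the affine pieces on these closed
  intervals.\<close>

lemma PN_sample_continuous:
  assumes per: "\<And>x. u (x + 1) = u x" and N: "N > 0"
  shows "continuous_on UNIV (PN N (\<lambda>i. u (real i / real N)))"
proof -
  let ?f = "\<lambda>s. PN N (\<lambda>i. u (real i / real N)) (s / real N)"
  have "continuous_on {of_int j..of_int j + 1} ?f" for j :: int
  proof (rule continuous_on_eq)
    show "continuous_on {of_int j..of_int j + 1}
      (\<lambda>s. u (of_int j / real N) * (of_int j + 1 - s) + u ((of_int j + 1) / real N) * (s - of_int j))"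
      by (intro continuous_intros)
  next
    fix s :: real assume "s \<in> {of_int j..of_int j + 1}"
    then have s: "of_int j \<le> s" "s \<le> of_int j + 1" by auto
    show "u (of_int j / real N) * (of_int j + 1 - s) + u ((of_int j + 1) / real N) * (s - of_int j) = ?f s"
      by (rule PN_sample_on_interval[of u N j s, OF per N s, symmetric])
  qed
  then have "isCont ?f s" for s by (rule isCont_if_continuous_on_unit_intervals)
  then have f: "continuous_on UNIV ?f" by (blast intro: continuous_at_imp_continuous_on)
  have "continuous_on UNIV (\<lambda>x::real. x * real N)" by (intro continuous_intros)
  from continuous_on_compose2[OF f this] show ?thesis using N by simp
qed

section \<open>Difference conditions on functions, and vectors of samples\<close>

definition lip :: "real \<Rightarrow> (real \<Rightarrow> real) \<Rightarrow> bool" where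
  "lip Y u \<longleftrightarrow> (\<forall>x a. 0 \<le> a \<longrightarrow> \<bar>u (x + a) - u x\<bar> \<le> Y * a)"

text \<open>Discrete form of "the derivative is \<open>P\<close>-Lipschitz". Mentioning no
  derivative, it can be propagated through the scheme and passes to pointwise limits;
  \<open>lip2_differentiable\<close> recovers the derivative afterwards.\<close>

definition lip2 :: "real \<Rightarrow> (real \<Rightarrow> real) \<Rightarrow> bool" where
  "lip2 P u \<longleftrightarrow> (\<forall>x a b. 0 \<le> a \<longrightarrow> 0 \<le> b \<longrightarrow>
     \<bar>u (x + a + b) - u (x + a) - u (x + b) + u x\<bar> \<le> P * a * b)"

definition between :: "real \<Rightarrow> real \<Rightarrow> (real \<Rightarrow> real) \<Rightarrow> bool" where
  "between m M u \<longleftrightarrow> (\<forall>x. m \<le> u x \<and> u x \<le> M)"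

lemma lipD: "lip Y u \<Longrightarrow> \<bar>u x - u y\<bar> \<le> Y * \<bar>x - y\<bar>"
  unfolding lip_def
  by (metis abs_ge_zero abs_if abs_minus_commute add.commute diff_add_cancel minus_diff_eq)

lemma lip_nonneg: "lip Y u \<Longrightarrow> 0 \<le> Y"
  unfolding lip_def by (drule spec[of _ 0], drule spec[of _ 1]) simp

lemma lip2_nonneg: "lip2 P u \<Longrightarrow> 0 \<le> P"
  unfolding lip2_def by (drule spec[of _ 0], drule spec[of _ 1], drule spec[of _ 1]) simp

lemma lip_continuous: "lip Y u \<Longrightarrow> continuous_on A u"
  using lipD[of Y u] lip_nonneg[of Y u]
  by (intro lipschitz_on_continuous_on[of Y]) (auto simp: lipschitz_on_def dist_real_def)

lemma PerI: "continuous_on UNIV u \<Longrightarrow> between m M u \<Longrightarrow> 0 < m \<Longrightarrow> (\<And>x. u (x + 1) = u x) \<Longrightarrow> u \<in> Per"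
  unfolding Per_def between_def by (auto intro: less_le_trans)

lemma Per_periodic: "u \<in> Per \<Longrightarrow> u (x + 1) = u x"
  unfolding Per_def by auto

lemma supn_le: "(\<And>x. \<bar>f x\<bar> \<le> B) \<Longrightarrow> supn f \<le> B"
  unfolding supn_def by (rule cSUP_least) auto

lemma le_supn: "(\<And>x. \<bar>f x\<bar> \<le> B) \<Longrightarrow> \<bar>f x\<bar> \<le> supn f"
  unfolding supn_def by (rule cSUP_upper) (auto intro!: bdd_aboveI2)

lemma vnorm_set_eq: "{\<bar>y i\<bar> | i. i < N} = (\<lambda>i. \<bar>y i\<bar>) ` {..<N}"
  by auto

lemma vnorm_le: "N > 0 \<Longrightarrow> (\<And>i. i < N \<Longrightarrow> \<bar>y i\<bar> \<le> B) \<Longrightarrow> vnorm N y \<le> B"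
  unfolding vnorm_def vnorm_set_eq by (subst Max_le_iff) auto

lemma vnorm_nonneg: "N > 0 \<Longrightarrow> 0 \<le> vnorm N y"
  unfolding vnorm_def vnorm_set_eq by (subst Max_ge_iff) auto

lemma PN_sample_close:
  assumes per: "\<And>x. u (x + 1) = u x" and N: "N > 0" and lip: "lip Y u"
  shows "\<bar>PN N (\<lambda>i. u (real i / real N)) x - u x\<bar> \<le> Y / real N"
proof -
  define j where "j = \<lfloor>x * real N\<rfloor>"
  define p where "p = of_int j + 1 - x * real N"
  define q where "q = x * real N - of_int j"
  have pq: "0 \<le> p" "0 \<le> q" "p + q = 1" unfolding p_def q_def j_def by linarith+
  have e: "PN N (\<lambda>i. u (real i / real N)) x - u x =
      p * (u (of_int j / real N) - u x) + q * (u ((of_int j + 1) / real N) - u x)"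
  proof -
    have "u x = p * u x + q * u x" using pq(3) by (metis distrib_right mult_1)
    then show ?thesis
      unfolding PN_sample[of u N x, OF per N] j_def[symmetric] p_def[symmetric] q_def[symmetric]
      by (simp add: algebra_simps)
  qed
  have d: "\<bar>of_int j / real N - x\<bar> \<le> 1 / real N" "\<bar>(of_int j + 1) / real N - x\<bar> \<le> 1 / real N"
  proof -
    have "of_int j / real N - x = - q / real N" "(of_int j + 1) / real N - x = p / real N"
      unfolding p_def q_def using N by (simp_all add: field_simps)
    then show "\<bar>of_int j / real N - x\<bar> \<le> 1 / real N" "\<bar>(of_int j + 1) / real N - x\<bar> \<le> 1 / real N"
      using pq N by (auto simp: divide_right_mono)
  qed
  have b: "\<bar>u (of_int j / real N) - u x\<bar> \<le> Y / real N" "\<bar>u ((of_int j + 1) / real N) - u x\<bar> \<le> Y / real N"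
    using lipD[OF lip, of "of_int j / real N" x] lipD[OF lip, of "(of_int j + 1) / real N" x]
      mult_left_mono[OF d(1) lip_nonneg[OF lip]] mult_left_mono[OF d(2) lip_nonneg[OF lip]] by auto
  have "\<bar>PN N (\<lambda>i. u (real i / real N)) x - u x\<bar> \<le> p * (Y / real N) + q * (Y / real N)"
    unfolding e using pq b
    by (intro order_trans[OF abs_triangle_ineq] add_mono)
      (auto simp: abs_mult simp del: times_divide_eq_right intro!: mult_left_mono)
  also have "\<dots> = Y / real N" using pq(3) by (metis distrib_right mult_1)
  finally show ?thesis .
qed

lemma PN_sample_Per:
  assumes per: "\<And>x. u (x + 1) = u x" and N: "N > 0" and box: "between m M u" and m: "0 < m"
  shows "PN N (\<lambda>i. u (real i / real N)) \<in> Per"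
    "between m M (PN N (\<lambda>i. u (real i / real N)))"
proof -
  show box': "between m M (PN N (\<lambda>i. u (real i / real N)))"
    unfolding between_def
  proof (intro allI)
    fix x
    define j where "j = \<lfloor>x * real N\<rfloor>"
    define p where "p = of_int j + 1 - x * real N"
    define q where "q = x * real N - of_int j"
    have pq: "0 \<le> p" "0 \<le> q" "p + q = 1" unfolding p_def q_def j_def by linarith+
    have "PN N (\<lambda>i. u (real i / real N)) x =
        p * u (of_int j / real N) + q * u ((of_int j + 1) / real N)"
      unfolding PN_sample[of u N x, OF per N] j_def[symmetric] p_def[symmetric] q_def[symmetric]
      by (simp add: algebra_simps)
    moreover have "p * m + q * m \<le> p * u (of_int j / real N) + q * u ((of_int j + 1) / real N)"
      using pq box by (intro add_mono mult_left_mono) (auto simp: between_def)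
    moreover have "p * u (of_int j / real N) + q * u ((of_int j + 1) / real N) \<le> p * M + q * M"
      using pq box by (intro add_mono mult_left_mono) (auto simp: between_def)
    moreover have "p * m + q * m = m" "p * M + q * M = M" using pq(3) by (metis distrib_right mult_1)+
    ultimately show "m \<le> PN N (\<lambda>i. u (real i / real N)) x \<and> PN N (\<lambda>i. u (real i / real N)) x \<le> M"
      by simp
  qed
  have "PN N (\<lambda>i. u (real i / real N)) (x + 1) = PN N (\<lambda>i. u (real i / real N)) x" for x
    unfolding PN_def Let_def by simp
  then show "PN N (\<lambda>i. u (real i / real N)) \<in> Per"
    using PerI[OF PN_sample_continuous[of u N, OF per N] box' m] by blast
qed

text \<open>The starting index \<open>j\<close> is an unbounded natural number, so that by
  periodicity a cyclic shift of the vector is just an addition to \<open>j\<close>. Conditions on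
  shifted vectors thereby become conditions on differences of a scalar sequence in
  \<open>j\<close>.\<close>

definition smp :: "nat \<Rightarrow> (real \<Rightarrow> real) \<Rightarrow> nat \<Rightarrow> nat \<Rightarrow> real" where
  "smp N u j = (\<lambda>i. u (real (i + j) / real N))"

lemma cshift_smp:
  assumes per: "\<And>x. u (x + 1) = u x" and N: "N > 0"
  shows "cshift N k (smp N u j) = smp N u (j + k)"
proof
  fix i
  have "real ((i + k) mod N) = real (i + k) - real N * real ((i + k) div N)"
    by (metis add_diff_cancel_left' mult.commute mult_div_mod_eq of_nat_add of_nat_mult)
  then have "real ((i + k) mod N + j) / real N = real (i + (j + k)) / real N + of_int (- int ((i + k) div N))"
    using N by (simp add: field_simps)
  then show "cshift N k (smp N u j) i = smp N u (j + k) i"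
    unfolding cshift_def smp_def
    using periodic_int[of u "real (i + (j + k)) / real N" "- int ((i + k) div N)"] per by metis
qed

lemma inbox_smp: "between m M u \<Longrightarrow> inbox N m M (smp N u j)"
  unfolding inbox_def smp_def between_def by auto

lemma increments_le:
  fixes f :: "nat \<Rightarrow> real"
  assumes "\<And>i. i < k \<Longrightarrow> f (j + i + 1) - f (j + i) \<le> B"
  shows "f (j + k) - f j \<le> real k * B"
  using assms
proof (induction k)
  case (Suc k)
  then have "f (j + k) - f j \<le> real k * B" "f (j + k + 1) - f (j + k) \<le> B" by auto
  then show ?case by (simp add: algebra_simps)
qed simp

lemma increments_abs_le_bounded:
  fixes f :: "nat \<Rightarrow> real"
  assumes "\<And>i. i < k \<Longrightarrow> \<bar>f (j + i + 1) - f (j + i)\<bar> \<le> B"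
  shows "\<bar>f (j + k) - f j\<bar> \<le> real k * B"
proof -
  have "f (j + k) - f j \<le> real k * B" using assms by (intro increments_le) (auto simp: abs_le_iff)
  moreover have "- f (j + k) - - f j \<le> real k * B"
    using assms by (intro increments_le[of k "\<lambda>i. - f i"]) (auto simp: abs_le_iff)
  ultimately show ?thesis by auto
qed

lemma increments_abs_le:
  fixes f :: "nat \<Rightarrow> real"
  assumes "\<And>i. \<bar>f (i + 1) - f i\<bar> \<le> B"
  shows "\<bar>f (j + k) - f j\<bar> \<le> real k * B"
  using assms by (rule increments_abs_le_bounded)

lemma floor_div_limit:
  assumes "0 \<le> a"
  shows "(\<lambda>N. real (nat \<lfloor>a * real N\<rfloor>) / real N) \<longlonglongrightarrow> a"
proof (rule real_tendsto_sandwich)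
  show "eventually (\<lambda>N. a - 1 / real N \<le> real (nat \<lfloor>a * real N\<rfloor>) / real N) sequentially"
  proof (rule eventually_mono[OF eventually_gt_at_top[of 0]])
    fix N :: nat assume "0 < N"
    have "a - 1 / real N = (a * real N - 1) / real N" using \<open>0 < N\<close> by (simp add: field_simps)
    also have "\<dots> \<le> real (nat \<lfloor>a * real N\<rfloor>) / real N" by (rule divide_right_mono) linarith+
    finally show "a - 1 / real N \<le> real (nat \<lfloor>a * real N\<rfloor>) / real N" .
  qed
  show "eventually (\<lambda>N. real (nat \<lfloor>a * real N\<rfloor>) / real N \<le> a) sequentially"
  proof (rule eventually_mono[OF eventually_gt_at_top[of 0]])
    fix N :: nat assume "0 < N"
    moreover have "real (nat \<lfloor>a * real N\<rfloor>) \<le> a * real N" using assms by (simp add: of_nat_nat)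
    ultimately show "real (nat \<lfloor>a * real N\<rfloor>) / real N \<le> a" by (simp add: field_simps)
  qed
  show "(\<lambda>N. a - 1 / real N) \<longlonglongrightarrow> a" using tendsto_diff[OF tendsto_const lim_1_over_n, of a] by simp
qed simp

text \<open>The slack \<open>Q * a\<close> disappears in the limit of the difference quotients. It
  accommodates bounds that are sharp at the base point only up to a quadratic error in the
  increment.\<close>

lemma deriv_le_from_increments:
  fixes f :: "real \<Rightarrow> real"
  assumes d: "(f has_real_derivative D) (at x)"
    and inc: "\<And>a. 0 < a \<Longrightarrow> f (x + a) - f x \<le> a * (B + Q * a)"
  shows "D \<le> B"
proof -
  have "((\<lambda>a. (f (x + a) - f x) / a) \<longlongrightarrow> D) (at 0)"
    using d unfolding DERIV_def by (simp add: add.commute)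
  then have l: "((\<lambda>a. (f (x + a) - f x) / a) \<longlongrightarrow> D) (at_right 0)"
    by (rule tendsto_mono[rotated]) (simp add: at_le)
  have r: "((\<lambda>a. B + Q * a) \<longlongrightarrow> B) (at_right 0)"
    by (auto intro!: tendsto_eq_intros)
  show ?thesis
  proof (rule tendsto_le[OF _ r l])
    show "eventually (\<lambda>a. (f (x + a) - f x) / a \<le> B + Q * a) (at_right 0)"
      using inc by (auto simp: eventually_at_filter field_simps intro!: always_eventually)
  qed simp
qed

lemma abs_deriv_le_from_increments:
  fixes f :: "real \<Rightarrow> real"
  assumes d: "(f has_real_derivative D) (at x)"
    and inc: "\<And>a. 0 < a \<Longrightarrow> \<bar>f (x + a) - f x\<bar> \<le> a * B"
  shows "\<bar>D\<bar> \<le> B"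
proof -
  have "D \<le> B" using inc by (intro deriv_le_from_increments[OF d, of B 0]) (auto simp: abs_le_iff)
  moreover have "- D \<le> B"
    using inc by (intro deriv_le_from_increments[OF DERIV_minus[OF d], of B 0]) (auto simp: abs_le_iff)
  ultimately show ?thesis by auto
qed


section \<open>Continuum estimates for the velocity operator\<close>

locale flux =
  fixes K :: "(real \<Rightarrow> real) \<Rightarrow> (real \<Rightarrow> real)"
    and vmax :: real
    and KN :: "nat \<Rightarrow> (nat \<Rightarrow> real) \<Rightarrow> real"
    and L c C S :: real and \<gamma> \<Gamma> W :: "real \<Rightarrow> real"
  assumes K_maps: "\<And>\<rho>. \<rho> \<in> Per \<Longrightarrow> C1 (K \<rho>) \<and> K \<rho> \<in> Per"
    and K_cont: "\<And>\<rho> \<epsilon>. \<rho> \<in> Per \<Longrightarrow> \<epsilon> > 0 \<Longrightarrow>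
                   \<exists>\<delta>>0. \<forall>\<sigma>\<in>Per. supn (\<lambda>x. \<rho> x - \<sigma> x) < \<delta> \<longrightarrow>
                          supn (\<lambda>x. K \<rho> x - K \<sigma> x) < \<epsilon>"
    and vmax_pos: "vmax > 0"
    and K_bounds: "\<And>\<rho> x. \<rho> \<in> Per \<Longrightarrow> 0 \<le> K \<rho> x \<and> K \<rho> x \<le> vmax"
    and const_nonneg: "L \<ge> 0" "c \<ge> 0" "C \<ge> 0" "S \<ge> 0"
    and nondec: "nondec_nonneg \<gamma>" "nondec_nonneg \<Gamma>" "nondec_nonneg W"
    and approx: "\<And>N \<rho>min \<rho>max \<rho> \<rho>'. N > 2 \<Longrightarrow> 0 < \<rho>min \<Longrightarrow> \<rho>min \<le> \<rho>max \<Longrightarrow>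
          inbox N \<rho>min \<rho>max \<rho> \<Longrightarrow> inbox N \<rho>min \<rho>max \<rho>' \<Longrightarrow>
          (let h = 1 / real N;
               y = (\<lambda>i. (cshift N 1 \<rho> i - \<rho> i) / h);
               \<phi> = (\<lambda>i. (cshift N 2 \<rho> i - 2 * cshift N 1 \<rho> i + \<rho> i) / h\<^sup>2) in
           \<bar>KN N \<rho> - KN N \<rho>'\<bar> \<le> L * vnorm N (\<lambda>i. \<rho> i - \<rho>' i) \<and>
           \<bar>KN N \<rho> - KN N (cshift N 1 \<rho>) - KN N \<rho>' + KN N (cshift N 1 \<rho>')\<bar>
              \<le> (h * vnorm N (\<lambda>i. \<rho> i - \<rho>' i) + h\<^sup>2) * \<Gamma> \<rho>max \<and>
           - c * h * (\<rho>max - \<rho> 0) \<le> KN N (cshift N 1 \<rho>) - KN N \<rho> \<and>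
           KN N (cshift N 1 \<rho>) - KN N \<rho> \<le> c * h * (\<rho> 0 - \<rho>min) \<and>
           \<bar>2 * KN N (cshift N 1 \<rho>) - KN N \<rho> - KN N (cshift N 2 \<rho>)\<bar>
              \<le> h\<^sup>2 * (\<gamma> \<rho>max + C * vnorm N y) \<and>
           \<bar>3 * KN N (cshift N 1 \<rho>) + KN N (cshift N 3 \<rho>) - KN N \<rho> - 3 * KN N (cshift N 2 \<rho>)\<bar>
              \<le> h ^ 3 * (W (\<rho>max + vnorm N y) + C * vnorm N \<phi>) \<and>
           (\<forall>i<N. \<bar>K (PN N \<rho>) (real i * h) - KN N (cshift N i \<rho>)\<bar> \<le> h * S * \<rho>max))"
begin

lemma \<Gamma>_nonneg: "0 \<le> M \<Longrightarrow> 0 \<le> \<Gamma> M" and \<gamma>_nonneg: "0 \<le> M \<Longrightarrow> 0 \<le> \<gamma> M"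
  and W_nonneg: "0 \<le> M \<Longrightarrow> 0 \<le> W M" and W_mono: "0 \<le> M \<Longrightarrow> M \<le> M' \<Longrightarrow> W M \<le> W M'"
  using nondec unfolding nondec_nonneg_def mono_on_def by auto

text \<open>The Lipschitz condition makes the interpolants of the samples converge uniformly.\<close>

definition adm :: "real \<Rightarrow> real \<Rightarrow> real \<Rightarrow> (real \<Rightarrow> real) \<Rightarrow> bool" where
  "adm m M Y u \<longleftrightarrow> u \<in> Per \<and> 0 < m \<and> between m M u \<and> lip Y u"

lemma admD:
  assumes "adm m M Y u"
  shows "u \<in> Per" "0 < m" "m \<le> M" "0 < M" "between m M u" "lip Y u" "0 \<le> Y" "m \<le> u x" "u x \<le> M" "0 < u x"
    "u (x + 1) = u x"
proof -
  show *: "u \<in> Per" "0 < m" "between m M u" "lip Y u" using assms unfolding adm_def by auto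
  then show "m \<le> u x" "u x \<le> M" unfolding between_def by auto
  then show "m \<le> M" by simp
  then show "0 < M" "0 < u x" using * \<open>m \<le> u x\<close> by auto
  show "0 \<le> Y" using lip_nonneg * by blast
  show "u (x + 1) = u x" using Per_periodic * by blast
qed

abbreviation q :: "nat \<Rightarrow> (real \<Rightarrow> real) \<Rightarrow> nat \<Rightarrow> real" where
  "q N u j \<equiv> KN N (smp N u j)"

text \<open>Read along \<open>j\<close>, the shift conditions on \<open>KN\<close> bound the first,
  second and third differences of the sequence \<open>q N u j\<close>. The norms of the first and
  second difference quotients of the samples are at most \<open>Y\<close> and
  \<open>P\<close>.\<close>

lemma sample_estimates:
  assumes u: "adm m M Y u" and N: "N > 2"
  shows "- (c / real N) * (M - u (real j / real N)) \<le> q N u (j + 1) - q N u j"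
    and "q N u (j + 1) - q N u j \<le> c / real N * (u (real j / real N) - m)"
    and "\<bar>q N u (j + 2) - 2 * q N u (j + 1) + q N u j\<bar> \<le> (1 / real N)\<^sup>2 * (\<gamma> M + C * Y)"
    and "lip2 P u \<Longrightarrow> \<bar>q N u (j + 3) - 3 * q N u (j + 2) + 3 * q N u (j + 1) - q N u j\<bar>
           \<le> (1 / real N) ^ 3 * (W (M + Y) + C * P)"
    and "\<bar>K (PN N (smp N u 0)) (real j / real N) - q N u j\<bar> \<le> S * M / real N"
proof -
  note uD = admD[OF u]
  have N0: "N > 0" using N by simp
  have sh: "cshift N k (smp N u j) = smp N u (j + k)" for k j
    by (rule cshift_smp[of u, OF uD(11) N0])
  define y where "y = (\<lambda>i. (smp N u (j + 1) i - smp N u j i) / (1 / real N))"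
  define \<phi> where "\<phi> = (\<lambda>i. (smp N u (j + 2) i - 2 * smp N u (j + 1) i + smp N u j i) / (1 / real N)\<^sup>2)"
  note A = approx[OF N uD(2,3) inbox_smp[OF uD(5)] inbox_smp[OF uD(5)], of j j,
      unfolded Let_def sh, folded y_def \<phi>_def]
  show "- (c / real N) * (M - u (real j / real N)) \<le> q N u (j + 1) - q N u j"
    "q N u (j + 1) - q N u j \<le> c / real N * (u (real j / real N) - m)"
    using A by (auto simp: smp_def)
  have y: "vnorm N y \<le> Y"
  proof (rule vnorm_le[OF N0])
    fix i
    have "\<bar>u (real (i + (j + 1)) / real N) - u (real (i + j) / real N)\<bar>
        \<le> Y * \<bar>real (i + (j + 1)) / real N - real (i + j) / real N\<bar>" by (rule lipD[OF uD(6)])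
    also have "real (i + (j + 1)) / real N - real (i + j) / real N = 1 / real N"
      using N0 by (simp add: field_simps)
    finally have "\<bar>u (real (i + (j + 1)) / real N) - u (real (i + j) / real N)\<bar> \<le> Y / real N" by simp
    moreover have "\<bar>y i\<bar> = \<bar>u (real (i + (j + 1)) / real N) - u (real (i + j) / real N)\<bar> * real N"
      unfolding y_def smp_def by (simp add: abs_mult)
    ultimately show "\<bar>y i\<bar> \<le> Y" using N0 by (simp add: pos_le_divide_eq)
  qed
  have "(1 / real N)\<^sup>2 * (\<gamma> M + C * vnorm N y) \<le> (1 / real N)\<^sup>2 * (\<gamma> M + C * Y)"
    using y const_nonneg by (intro mult_left_mono add_mono) auto
  moreover have "\<bar>q N u (j + 2) - 2 * q N u (j + 1) + q N u j\<bar> = \<bar>2 * q N u (j + 1) - q N u j - q N u (j + 2)\<bar>"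
    by (simp add: abs_if)
  ultimately show "\<bar>q N u (j + 2) - 2 * q N u (j + 1) + q N u j\<bar> \<le> (1 / real N)\<^sup>2 * (\<gamma> M + C * Y)"
    using A by linarith
  show "\<bar>q N u (j + 3) - 3 * q N u (j + 2) + 3 * q N u (j + 1) - q N u j\<bar>
           \<le> (1 / real N) ^ 3 * (W (M + Y) + C * P)" if P: "lip2 P u"
  proof -
    have ph: "vnorm N \<phi> \<le> P"
    proof (rule vnorm_le[OF N0])
      fix i
      let ?x = "real (i + j) / real N" and ?h = "1 / real N"
      have e: "real (i + (j + 1)) / real N = ?x + ?h" "real (i + (j + 2)) / real N = ?x + ?h + ?h"
        by (simp_all add: add_divide_distrib)
      have "\<bar>u (?x + ?h + ?h) - u (?x + ?h) - u (?x + ?h) + u ?x\<bar> \<le> P * ?h * ?h"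
        using P unfolding lip2_def
        by (drule_tac spec[of _ ?x], drule_tac spec[of _ ?h]) (simp only: zero_le_divide_1_iff of_nat_0_le_iff)
      then have "\<bar>u (?x + ?h + ?h) - 2 * u (?x + ?h) + u ?x\<bar> \<le> P * ?h\<^sup>2"
        by (simp add: power2_eq_square)
      then show "\<bar>\<phi> i\<bar> \<le> P" unfolding \<phi>_def smp_def e using N0
        by (simp add: abs_mult pos_divide_le_eq del: power_one_over)
    qed
    have "W (M + vnorm N y) \<le> W (M + Y)"
      using y vnorm_nonneg[OF N0, of y] uD(4) by (intro W_mono) auto
    then have "(1 / real N) ^ 3 * (W (M + vnorm N y) + C * vnorm N \<phi>) \<le> (1 / real N) ^ 3 * (W (M + Y) + C * P)"
      using ph const_nonneg by (intro mult_left_mono add_mono) auto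
    moreover have "\<bar>q N u (j + 3) - 3 * q N u (j + 2) + 3 * q N u (j + 1) - q N u j\<bar> =
        \<bar>3 * q N u (j + 1) + q N u (j + 3) - q N u j - 3 * q N u (j + 2)\<bar>"
      by (rule arg_cong[of _ _ abs]) simp
    ultimately show ?thesis using A by linarith
  qed
  \<comment> \<open>The consistency condition speaks of indices below \<open>N\<close> only. Any
    other \<open>j\<close> is reduced modulo \<open>N\<close>, which changes the point by whole
    periods and leaves the sample vector unchanged.\<close>
  let ?i = "j mod N"
  have jm: "real j / real N = real ?i / real N + of_int (int (j div N))"
  proof -
    have "real j = real N * real (j div N) + real ?i"
      by (metis mult_div_mod_eq of_nat_add of_nat_mult)
    then show ?thesis using N0 by (simp add: field_simps)
  qed
  have "PN N (smp N u 0) \<in> Per"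
    using PN_sample_Per(1)[of u N m M] uD N0 by (simp add: smp_def)
  then have "K (PN N (smp N u 0)) (real j / real N) = K (PN N (smp N u 0)) (real ?i / real N)"
    unfolding jm using K_maps Per_periodic by (intro periodic_int) blast
  moreover have "smp N u j = smp N u ?i"
    unfolding sh[of j 0, symmetric, simplified] sh[of ?i 0, symmetric, simplified]
    by (simp add: cshift_def mod_add_right_eq)
  moreover have "\<bar>K (PN N (smp N u 0)) (real ?i * (1 / real N)) - KN N (cshift N ?i (smp N u 0))\<bar> \<le> 1 / real N * S * M"
    using approx[OF N uD(2,3) inbox_smp[OF uD(5)] inbox_smp[OF uD(5)], of 0 0, unfolded Let_def] N0 by simp
  ultimately show "\<bar>K (PN N (smp N u 0)) (real j / real N) - q N u j\<bar> \<le> S * M / real N"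
    unfolding sh by simp
qed

lemma sample_difference_estimates:
  assumes u: "adm m M Y u" and w: "adm m M Y' w" and N: "N > 2" and E: "\<And>x. \<bar>u x - w x\<bar> \<le> E"
  shows "\<bar>q N u j - q N w j\<bar> \<le> L * E"
    and "\<bar>(q N u (j + 1) - q N w (j + 1)) - (q N u j - q N w j)\<bar> \<le> (E / real N + (1 / real N)\<^sup>2) * \<Gamma> M"
proof -
  note uD = admD[OF u] and wD = admD[OF w]
  have N0: "N > 0" using N by simp
  note A = approx[OF N uD(2,3) inbox_smp[OF uD(5)] inbox_smp[OF wD(5)], of j j,
      unfolded Let_def cshift_smp[of u, OF uD(11) N0] cshift_smp[of w, OF wD(11) N0]]
  have e: "vnorm N (\<lambda>i. smp N u j i - smp N w j i) \<le> E"
    using E by (intro vnorm_le[OF N0]) (auto simp: smp_def)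
  have "L * vnorm N (\<lambda>i. smp N u j i - smp N w j i) \<le> L * E"
    using e const_nonneg by (intro mult_left_mono) auto
  then show "\<bar>q N u j - q N w j\<bar> \<le> L * E" using A by linarith
  have "(1 / real N * vnorm N (\<lambda>i. smp N u j i - smp N w j i) + (1 / real N)\<^sup>2) * \<Gamma> M
      \<le> (1 / real N * E + (1 / real N)\<^sup>2) * \<Gamma> M"
    using e \<Gamma>_nonneg[of M] uD(4) by (intro mult_right_mono add_mono mult_left_mono) auto
  moreover have "\<bar>(q N u (j + 1) - q N w (j + 1)) - (q N u j - q N w j)\<bar> =
      \<bar>q N u j - q N u (j + 1) - q N w j + q N w (j + 1)\<bar>" by (simp add: abs_if)
  ultimately show "\<bar>(q N u (j + 1) - q N w (j + 1)) - (q N u j - q N w j)\<bar> \<le> (E / real N + (1 / real N)\<^sup>2) * \<Gamma> M"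
    using A by (simp del: power_one_over)
qed

lemma K_abs_diff_le_vmax: "u \<in> Per \<Longrightarrow> w \<in> Per \<Longrightarrow> \<bar>K u x - K w x\<bar> \<le> vmax"
  using K_bounds[of u x] K_bounds[of w x] by auto

lemma K_has_deriv: "u \<in> Per \<Longrightarrow> (K u has_real_derivative deriv (K u) x) (at x)"
  using K_maps[of u] unfolding C1_def by (simp add: DERIV_deriv_iff_real_differentiable)

lemma K_continuous: "u \<in> Per \<Longrightarrow> isCont (K u) x"
  using K_has_deriv DERIV_isCont by blast

lemma K_periodic: "u \<in> Per \<Longrightarrow> K u (x + 1) = K u x"
  using K_maps Per_periodic by blast

text \<open>The error splits into three parts: \<open>K u\<close> is continuous at the limit point;
  the interpolants converge uniformly to \<open>u\<close>, at which \<open>K\<close> is continuous;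
  and \<open>KN\<close> differs from \<open>K\<close> of the interpolant by
  \<open>S * M / N\<close>. The integer \<open>p\<close> is needed because indices are natural
  numbers, so points are reached only up to a period.\<close>

lemma sample_limit:
  assumes u: "adm m M Y u" and j: "(\<lambda>N. real (j N) / real N) \<longlonglongrightarrow> x + of_int p"
  shows "(\<lambda>N. q N u (j N)) \<longlonglongrightarrow> K u x"
proof -
  note uD = admD[OF u]
  have big: "eventually (\<lambda>N. N > 2) sequentially" by (rule eventually_gt_at_top)
  have l1: "(\<lambda>N. K u (real (j N) / real N)) \<longlonglongrightarrow> K u x"
    using isCont_tendsto_compose[OF K_continuous[OF uD(1)] j]
      periodic_int[of "K u" x p] K_periodic[OF uD(1)] by simp
  have l2: "(\<lambda>N. K u (real (j N) / real N) - K (PN N (smp N u 0)) (real (j N) / real N)) \<longlonglongrightarrow> 0"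
  proof (rule tendstoI)
    fix e :: real assume "0 < e"
    then obtain d where d: "d > 0" "\<And>\<sigma>. \<sigma> \<in> Per \<Longrightarrow> supn (\<lambda>x. u x - \<sigma> x) < d \<Longrightarrow> supn (\<lambda>x. K u x - K \<sigma> x) < e"
      using K_cont[OF uD(1)] by metis
    have "(\<lambda>N. Y / real N) \<longlonglongrightarrow> 0" by (rule lim_const_over_n)
    then have "eventually (\<lambda>N. Y / real N < d) sequentially" using d(1) order_tendstoD(2) by blast
    then show "eventually (\<lambda>N. dist (K u (real (j N) / real N) - K (PN N (smp N u 0)) (real (j N) / real N)) 0 < e) sequentially"
      using big
    proof eventually_elim
      case (elim N)
      let ?\<sigma> = "PN N (smp N u 0)"
      have per: "?\<sigma> \<in> Per" using PN_sample_Per(1)[of u N m M] uD elim by (simp add: smp_def)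
      have "\<bar>u x - ?\<sigma> x\<bar> \<le> Y / real N" for x
        using PN_sample_close[of u N Y x] uD elim by (simp add: smp_def abs_minus_commute)
      then have "supn (\<lambda>x. u x - ?\<sigma> x) \<le> Y / real N" by (rule supn_le)
      then have "supn (\<lambda>x. K u x - K ?\<sigma> x) < e" using d(2)[OF per] elim by simp
      \<comment> \<open>\<open>supn\<close> is a bare supremum, so it dominates values only of
        bounded functions; the bound \<open>vmax\<close> supplies this.\<close>
      moreover have "\<bar>K u (real (j N) / real N) - K ?\<sigma> (real (j N) / real N)\<bar> \<le> supn (\<lambda>x. K u x - K ?\<sigma> x)"
        by (rule le_supn[of "\<lambda>x. K u x - K ?\<sigma> x"], rule K_abs_diff_le_vmax[OF uD(1) per])
      ultimately show ?case by simp
    qed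
  qed
  have l3: "(\<lambda>N. K (PN N (smp N u 0)) (real (j N) / real N) - q N u (j N)) \<longlonglongrightarrow> 0"
  proof (rule Lim_null_comparison)
    show "eventually (\<lambda>N. norm (K (PN N (smp N u 0)) (real (j N) / real N) - q N u (j N)) \<le> S * M / real N) sequentially"
      using big by eventually_elim (use sample_estimates(5)[OF u] in simp)
    show "(\<lambda>N. S * M / real N) \<longlonglongrightarrow> 0" by (rule lim_const_over_n)
  qed
  have "(\<lambda>N. K u (real (j N) / real N) - (K u (real (j N) / real N) - K (PN N (smp N u 0)) (real (j N) / real N))
      - (K (PN N (smp N u 0)) (real (j N) / real N) - q N u (j N))) \<longlonglongrightarrow> K u x - 0 - 0"
    by (intro tendsto_diff l1 l2 l3)
  then show ?thesis by simp
qed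

text \<open>Indices of the sampling points approximating \<open>x\<close> (up to a period) and \<open>a\<close>.\<close>

definition ix :: "real \<Rightarrow> nat \<Rightarrow> nat" where "ix x N = nat \<lfloor>(x + of_int \<lceil>\<bar>x\<bar>\<rceil>) * real N\<rfloor>"
definition ofs :: "real \<Rightarrow> nat \<Rightarrow> nat" where "ofs a N = nat \<lfloor>a * real N\<rfloor>"

lemma ix_limit: "(\<lambda>N. real (ix x N) / real N) \<longlonglongrightarrow> x + of_int \<lceil>\<bar>x\<bar>\<rceil>"
proof -
  have "\<bar>x\<bar> \<le> of_int \<lceil>\<bar>x\<bar>\<rceil>" by (rule le_of_int_ceiling)
  then show ?thesis unfolding ix_def by (intro floor_div_limit) linarith
qed

lemma ofs_limit: "0 \<le> a \<Longrightarrow> (\<lambda>N. real (ofs a N) / real N) \<longlonglongrightarrow> a"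
  unfolding ofs_def by (rule floor_div_limit)

lemma q_limits:
  assumes u: "adm m M Y u"
  shows "(\<lambda>N. q N u (ix x N)) \<longlonglongrightarrow> K u x"
    and "0 \<le> a \<Longrightarrow> (\<lambda>N. q N u (ix x N + ofs a N)) \<longlonglongrightarrow> K u (x + a)"
    and "0 \<le> a \<Longrightarrow> 0 \<le> b \<Longrightarrow> (\<lambda>N. q N u (ix x N + ofs a N + ofs b N)) \<longlonglongrightarrow> K u (x + a + b)"
    and "0 \<le> a \<Longrightarrow> 0 \<le> b \<Longrightarrow> 0 \<le> d \<Longrightarrow>
      (\<lambda>N. q N u (ix x N + ofs a N + ofs b N + ofs d N)) \<longlonglongrightarrow> K u (x + a + b + d)"
proof -
  let ?p = "\<lceil>\<bar>x\<bar>\<rceil>"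
  show "(\<lambda>N. q N u (ix x N)) \<longlonglongrightarrow> K u x"
    by (rule sample_limit[OF u ix_limit[of x]])
  show "(\<lambda>N. q N u (ix x N + ofs a N)) \<longlonglongrightarrow> K u (x + a)" if "0 \<le> a"
    using tendsto_add[OF ix_limit[of x] ofs_limit[OF that]]
    by (intro sample_limit[OF u, of _ _ ?p]) (simp add: add_divide_distrib algebra_simps)
  show "(\<lambda>N. q N u (ix x N + ofs a N + ofs b N)) \<longlonglongrightarrow> K u (x + a + b)" if "0 \<le> a" "0 \<le> b"
    using tendsto_add[OF tendsto_add[OF ix_limit[of x] ofs_limit[OF that(1)]] ofs_limit[OF that(2)]]
    by (intro sample_limit[OF u, of _ _ ?p]) (simp add: add_divide_distrib algebra_simps)
  show "(\<lambda>N. q N u (ix x N + ofs a N + ofs b N + ofs d N)) \<longlonglongrightarrow> K u (x + a + b + d)"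
    if "0 \<le> a" "0 \<le> b" "0 \<le> d"
    using tendsto_add[OF tendsto_add[OF tendsto_add[OF ix_limit[of x] ofs_limit[OF that(1)]] ofs_limit[OF that(2)]] ofs_limit[OF that(3)]]
    by (intro sample_limit[OF u, of _ _ ?p]) (simp add: add_divide_distrib algebra_simps)
qed

lemma K_lipschitz:
  assumes u: "adm m M Y u" and w: "adm m M Y' w" and E: "\<And>x. \<bar>u x - w x\<bar> \<le> E"
  shows "\<bar>K u x - K w x\<bar> \<le> L * E"
proof (rule LIMSEQ_le_const2)
  show "(\<lambda>N. \<bar>q N u (ix x N) - q N w (ix x N)\<bar>) \<longlonglongrightarrow> \<bar>K u x - K w x\<bar>"
    by (intro tendsto_rabs tendsto_diff tendsto_add q_limits[OF u] q_limits[OF w])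
  show "\<exists>N. \<forall>n\<ge>N. \<bar>q n u (ix x n) - q n w (ix x n)\<bar> \<le> L * E"
    using sample_difference_estimates(1)[OF u w _ E] by (intro exI[of _ 3]) auto
qed

text \<open>Telescoping over \<open>ofs a N\<close> indices turns the bound
  \<open>(E / N + 1 / N\<^sup>2) * \<Gamma> M\<close> per index into about
  \<open>a * (E + 1 / N) * \<Gamma> M\<close>. The part of the bound that does not vanish with
  \<open>E\<close> is thus lost in the limit.\<close>

lemma K_diff_increment:
  assumes u: "adm m M Y u" and w: "adm m M Y' w" and E: "\<And>x. \<bar>u x - w x\<bar> \<le> E" and a: "0 \<le> a"
  shows "\<bar>(K u (x + a) - K w (x + a)) - (K u x - K w x)\<bar> \<le> a * (\<Gamma> M * E)"
proof (rule LIMSEQ_le)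
  show "(\<lambda>N. \<bar>(q N u (ix x N + ofs a N) - q N w (ix x N + ofs a N)) - (q N u (ix x N) - q N w (ix x N))\<bar>)
      \<longlonglongrightarrow> \<bar>(K u (x + a) - K w (x + a)) - (K u x - K w x)\<bar>"
    using a by (intro tendsto_rabs tendsto_diff tendsto_add q_limits[OF u] q_limits[OF w])
  have "(\<lambda>N. real (ofs a N) / real N * ((E + 1 / real N) * \<Gamma> M)) \<longlonglongrightarrow> a * ((E + 0) * \<Gamma> M)"
    by (intro tendsto_intros ofs_limit a lim_1_over_n)
  then show "(\<lambda>N. real (ofs a N) / real N * ((E + 1 / real N) * \<Gamma> M)) \<longlonglongrightarrow> a * (\<Gamma> M * E)"
    by (simp add: mult.commute)
  show "\<exists>N. \<forall>n\<ge>N. \<bar>(q n u (ix x n + ofs a n) - q n w (ix x n + ofs a n)) - (q n u (ix x n) - q n w (ix x n))\<bar>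
      \<le> real (ofs a n) / real n * ((E + 1 / real n) * \<Gamma> M)"
  proof (intro exI[of _ 3] allI impI)
    fix n :: nat assume n: "n \<ge> 3"
    have "\<bar>(q n u (ix x n + ofs a n) - q n w (ix x n + ofs a n)) - (q n u (ix x n) - q n w (ix x n))\<bar>
      \<le> real (ofs a n) * ((E / real n + (1 / real n)\<^sup>2) * \<Gamma> M)"
      using sample_difference_estimates(2)[OF u w _ E] n
      by (intro increments_abs_le[of "\<lambda>j. q n u j - q n w j"]) auto
    also have "\<dots> = real (ofs a n) / real n * ((E + 1 / real n) * \<Gamma> M)"
      using n by (simp add: field_simps power2_eq_square)
    finally show "\<bar>(q n u (ix x n + ofs a n) - q n w (ix x n + ofs a n)) - (q n u (ix x n) - q n w (ix x n))\<bar>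
      \<le> real (ofs a n) / real n * ((E + 1 / real n) * \<Gamma> M)" .
  qed
qed

text \<open>The one-sided conditions involve the value of \<open>u\<close> at the current node.
  Freezing it at the starting node costs at most \<open>Y * a\<close> per step, whence the quadratic
  term \<open>c * Y * a * a\<close>, which has no effect on the derivative.\<close>

lemma K_increment:
  assumes u: "adm m M Y u" and a: "0 \<le> a"
  shows "K u (x + a) - K u x \<le> a * (c * (u x - m) + c * Y * a)"
    and "K u x - K u (x + a) \<le> a * (c * (M - u x) + c * Y * a)"
    and "\<bar>K u (x + a) - K u x\<bar> \<le> c * M * a"
proof -
  note uD = admD[OF u]
  let ?r = "\<lambda>N. real (ofs a N) / real N" and ?z = "\<lambda>N. real (ix x N) / real N"
  have lip: "\<bar>u (real (ix x n + i) / real n) - u (?z n)\<bar> \<le> Y * ?r n" if "i < ofs a n" for i n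
  proof -
    have "\<bar>u (real (ix x n + i) / real n) - u (?z n)\<bar> \<le> Y * \<bar>real (ix x n + i) / real n - ?z n\<bar>"
      by (rule lipD[OF uD(6)])
    also have "\<bar>real (ix x n + i) / real n - ?z n\<bar> = real i / real n" by (simp add: add_divide_distrib)
    also have "Y * (real i / real n) \<le> Y * ?r n"
      using that uD(7) by (intro mult_left_mono divide_right_mono) auto
    finally show ?thesis .
  qed
  have uz: "(\<lambda>N. u (?z N)) \<longlonglongrightarrow> u x"
  proof -
    have "isCont u (x + of_int \<lceil>\<bar>x\<bar>\<rceil>)"
      using lip_continuous[OF uD(6), of UNIV] by (simp add: continuous_on_eq_continuous_at)
    from isCont_tendsto_compose[OF this ix_limit] show ?thesis
      using periodic_int[of u x] uD(11) by simp
  qed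
  show "K u (x + a) - K u x \<le> a * (c * (u x - m) + c * Y * a)"
  proof (rule LIMSEQ_le)
    show "(\<lambda>N. q N u (ix x N + ofs a N) - q N u (ix x N)) \<longlonglongrightarrow> K u (x + a) - K u x"
      using a by (intro tendsto_rabs tendsto_diff tendsto_add q_limits[OF u])
    show "(\<lambda>N. ?r N * (c * (u (?z N) - m) + c * Y * ?r N)) \<longlonglongrightarrow> a * (c * (u x - m) + c * Y * a)"
      by (intro tendsto_intros ofs_limit a uz)
    show "\<exists>N. \<forall>n\<ge>N. q n u (ix x n + ofs a n) - q n u (ix x n) \<le> ?r n * (c * (u (?z n) - m) + c * Y * ?r n)"
    proof (intro exI[of _ 3] allI impI)
      fix n :: nat assume n: "n \<ge> 3"
      have "q n u (ix x n + ofs a n) - q n u (ix x n) \<le> real (ofs a n) * (c / real n * (u (?z n) + Y * ?r n - m))"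
      proof (rule increments_le)
        fix i assume i: "i < ofs a n"
        have "q n u (ix x n + i + 1) - q n u (ix x n + i) \<le> c / real n * (u (real (ix x n + i) / real n) - m)"
          using sample_estimates(2)[OF u, of n "ix x n + i"] n by simp
        also have "\<dots> \<le> c / real n * (u (?z n) + Y * ?r n - m)"
          using lip[OF i] const_nonneg by (intro mult_left_mono) (auto simp: abs_le_iff algebra_simps)
        finally show "q n u (ix x n + i + 1) - q n u (ix x n + i) \<le> c / real n * (u (?z n) + Y * ?r n - m)" .
      qed
      then show "q n u (ix x n + ofs a n) - q n u (ix x n) \<le> ?r n * (c * (u (?z n) - m) + c * Y * ?r n)"
        by (simp add: algebra_simps)
    qed
  qed
  show "K u x - K u (x + a) \<le> a * (c * (M - u x) + c * Y * a)"
  proof (rule LIMSEQ_le)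
    show "(\<lambda>N. q N u (ix x N) - q N u (ix x N + ofs a N)) \<longlonglongrightarrow> K u x - K u (x + a)"
      using a by (intro tendsto_rabs tendsto_diff tendsto_add q_limits[OF u])
    show "(\<lambda>N. ?r N * (c * (M - u (?z N)) + c * Y * ?r N)) \<longlonglongrightarrow> a * (c * (M - u x) + c * Y * a)"
      by (intro tendsto_intros ofs_limit a uz)
    show "\<exists>N. \<forall>n\<ge>N. q n u (ix x n) - q n u (ix x n + ofs a n) \<le> ?r n * (c * (M - u (?z n)) + c * Y * ?r n)"
    proof (intro exI[of _ 3] allI impI)
      fix n :: nat assume n: "n \<ge> 3"
      have "- q n u (ix x n + ofs a n) - - q n u (ix x n) \<le> real (ofs a n) * (c / real n * (M - u (?z n) + Y * ?r n))"
      proof (rule increments_le[of _ "\<lambda>j. - q n u j"])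
        fix i assume i: "i < ofs a n"
        have "- q n u (ix x n + i + 1) - - q n u (ix x n + i) \<le> c / real n * (M - u (real (ix x n + i) / real n))"
          using sample_estimates(1)[OF u, of n "ix x n + i"] n by simp
        also have "\<dots> \<le> c / real n * (M - u (?z n) + Y * ?r n)"
          using lip[OF i] const_nonneg by (intro mult_left_mono) (auto simp: abs_le_iff algebra_simps)
        finally show "- q n u (ix x n + i + 1) - - q n u (ix x n + i) \<le> c / real n * (M - u (?z n) + Y * ?r n)" .
      qed
      then show "q n u (ix x n) - q n u (ix x n + ofs a n) \<le> ?r n * (c * (M - u (?z n)) + c * Y * ?r n)"
        by (simp add: algebra_simps)
    qed
  qed
  show "\<bar>K u (x + a) - K u x\<bar> \<le> c * M * a"
  proof (rule LIMSEQ_le)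
    show "(\<lambda>N. \<bar>q N u (ix x N + ofs a N) - q N u (ix x N)\<bar>) \<longlonglongrightarrow> \<bar>K u (x + a) - K u x\<bar>"
      using a by (intro tendsto_rabs tendsto_diff tendsto_add q_limits[OF u])
    show "(\<lambda>N. c * M * ?r N) \<longlonglongrightarrow> c * M * a" by (intro tendsto_intros ofs_limit a)
    show "\<exists>N. \<forall>n\<ge>N. \<bar>q n u (ix x n + ofs a n) - q n u (ix x n)\<bar> \<le> c * M * ?r n"
    proof (intro exI[of _ 3] allI impI)
      fix n :: nat assume n: "n \<ge> 3"
      have "\<bar>q n u (ix x n + ofs a n) - q n u (ix x n)\<bar> \<le> real (ofs a n) * (c / real n * M)"
      proof (rule increments_abs_le)
        fix i
        have "c / real n * (u (real i / real n) - m) \<le> c / real n * M"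
          "c / real n * (M - u (real i / real n)) \<le> c / real n * M"
          using uD(2,4) uD(8-10)[of "real i / real n"] const_nonneg by (auto intro!: mult_left_mono divide_right_mono)
        then show "\<bar>q n u (i + 1) - q n u i\<bar> \<le> c / real n * M"
          using sample_estimates(1,2)[OF u, of n i] n by (simp add: abs_le_iff)
      qed
      then show "\<bar>q n u (ix x n + ofs a n) - q n u (ix x n)\<bar> \<le> c * M * ?r n" by (simp add: ac_simps)
    qed
  qed
qed

lemma K_increment2:
  assumes u: "adm m M Y u" and a: "0 \<le> a" and b: "0 \<le> b"
  shows "\<bar>K u (x + a + b) - K u (x + a) - K u (x + b) + K u x\<bar> \<le> (\<gamma> M + C * Y) * a * b"
proof (rule LIMSEQ_le)
  let ?B = "\<lambda>N. (1 / real N)\<^sup>2 * (\<gamma> M + C * Y)"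
  show "(\<lambda>N. \<bar>q N u (ix x N + ofs a N + ofs b N) - q N u (ix x N + ofs a N) - q N u (ix x N + ofs b N) + q N u (ix x N)\<bar>)
     \<longlonglongrightarrow> \<bar>K u (x + a + b) - K u (x + a) - K u (x + b) + K u x\<bar>"
    using a b by (intro tendsto_rabs tendsto_diff tendsto_add q_limits[OF u])
  show "(\<lambda>N. (\<gamma> M + C * Y) * (real (ofs a N) / real N) * (real (ofs b N) / real N)) \<longlonglongrightarrow> (\<gamma> M + C * Y) * a * b"
    by (intro tendsto_intros ofs_limit a b)
  show "\<exists>N. \<forall>n\<ge>N. \<bar>q n u (ix x n + ofs a n + ofs b n) - q n u (ix x n + ofs a n) - q n u (ix x n + ofs b n) + q n u (ix x n)\<bar>
     \<le> (\<gamma> M + C * Y) * (real (ofs a n) / real n) * (real (ofs b n) / real n)"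
  proof (intro exI[of _ 3] allI impI)
    fix n :: nat assume n: "n \<ge> 3"
    have 1: "\<bar>(q n u (j + k + 1) - q n u (j + k)) - (q n u (j + 1) - q n u j)\<bar> \<le> real k * ?B n" for j k
    proof (rule increments_abs_le[of "\<lambda>j. q n u (j + 1) - q n u j"])
      show "\<bar>q n u (i + 1 + 1) - q n u (i + 1) - (q n u (i + 1) - q n u i)\<bar> \<le> ?B n" for i
        using sample_estimates(3)[OF u, of n i] n by (simp add: algebra_simps)
    qed
    have "\<bar>(q n u (j + l + k) - q n u (j + l)) - (q n u (j + k) - q n u j)\<bar> \<le> real l * (real k * ?B n)" for j k l
    proof (rule increments_abs_le[of "\<lambda>j. q n u (j + k) - q n u j"])
      show "\<bar>q n u (i + 1 + k) - q n u (i + 1) - (q n u (i + k) - q n u i)\<bar> \<le> real k * ?B n" for i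
        using 1[of i k] by (simp add: algebra_simps)
    qed
    from this[of "ix x n" "ofs a n" "ofs b n"]
    show "\<bar>q n u (ix x n + ofs a n + ofs b n) - q n u (ix x n + ofs a n) - q n u (ix x n + ofs b n) + q n u (ix x n)\<bar>
     \<le> (\<gamma> M + C * Y) * (real (ofs a n) / real n) * (real (ofs b n) / real n)"
      by (simp add: algebra_simps power2_eq_square add_divide_distrib)
  qed
qed

text \<open>Arbitrary nonnegative increments, not only equal ones, are needed for
  \<open>lip2\<close>, so the unit third difference of \<open>q\<close> is summed over a
  three-dimensional box of indices before \<open>N\<close> tends to infinity.\<close>

lemma K_increment3:
  assumes u: "adm m M Y u" and P: "lip2 P u" and a: "0 \<le> a" and b: "0 \<le> b" and d: "0 \<le> d"
  shows "\<bar>(K u (x + a + b + d) - K u (x + a + d) - K u (x + b + d) + K u (x + d))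
      - (K u (x + a + b) - K u (x + a) - K u (x + b) + K u x)\<bar> \<le> (W (M + Y) + C * P) * a * b * d"
proof (rule LIMSEQ_le)
  let ?B = "\<lambda>N. (1 / real N) ^ 3 * (W (M + Y) + C * P)"
  let ?F = "\<lambda>N. (q N u (ix x N + ofs a N + ofs b N + ofs d N) - q N u (ix x N + ofs a N + ofs d N)
        - q N u (ix x N + ofs b N + ofs d N) + q N u (ix x N + ofs d N))
      - (q N u (ix x N + ofs a N + ofs b N) - q N u (ix x N + ofs a N) - q N u (ix x N + ofs b N) + q N u (ix x N))"
  show "(\<lambda>N. \<bar>?F N\<bar>) \<longlonglongrightarrow> \<bar>(K u (x + a + b + d) - K u (x + a + d) - K u (x + b + d) + K u (x + d))
      - (K u (x + a + b) - K u (x + a) - K u (x + b) + K u x)\<bar>"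
    using a b d by (intro tendsto_rabs tendsto_diff tendsto_add q_limits[OF u])
  show "(\<lambda>N. (W (M + Y) + C * P) * (real (ofs a N) / real N) * (real (ofs b N) / real N) * (real (ofs d N) / real N))
      \<longlonglongrightarrow> (W (M + Y) + C * P) * a * b * d"
    by (intro tendsto_intros ofs_limit a b d)
  show "\<exists>N. \<forall>n\<ge>N. \<bar>?F n\<bar> \<le> (W (M + Y) + C * P) * (real (ofs a n) / real n) * (real (ofs b n) / real n) * (real (ofs d n) / real n)"
  proof (intro exI[of _ 3] allI impI)
    fix n :: nat assume n: "n \<ge> 3"
    \<comment> \<open>\<open>s\<close>, \<open>r k\<close> and \<open>t k l\<close> are mixed second
      differences with index steps (1, 1), (k, 1) and (k, l). The unit increment of
      \<open>r k\<close> is an increment of \<open>s\<close> over \<open>k\<close> indices, that of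
      \<open>t k l\<close> an increment of \<open>r k\<close> over \<open>l\<close> indices; so
      three telescopings suffice.\<close>
    define s where "s = (\<lambda>j. q n u (j + 2) - 2 * q n u (j + 1) + q n u j)"
    have s: "\<bar>s (j + k) - s j\<bar> \<le> real k * ?B n" for j k
    proof (rule increments_abs_le)
      fix i
      have "s (i + 1) - s i = q n u (i + 3) - 3 * q n u (i + 2) + 3 * q n u (i + 1) - q n u i"
        by (simp add: s_def eval_nat_numeral)
      then show "\<bar>s (i + 1) - s i\<bar> \<le> ?B n" using sample_estimates(4)[OF u _ P, of n i] n by simp
    qed
    define r where "r = (\<lambda>k j. (q n u (j + k + 1) - q n u (j + k)) - (q n u (j + 1) - q n u j))"
    have r: "\<bar>r k (j + l) - r k j\<bar> \<le> real l * (real k * ?B n)" for j k l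
    proof (rule increments_abs_le)
      fix i
      have "r k (i + 1) - r k i = s (i + k) - s i" by (simp add: s_def r_def eval_nat_numeral)
      then show "\<bar>r k (i + 1) - r k i\<bar> \<le> real k * ?B n" using s[of i k] by simp
    qed
    define t where "t = (\<lambda>k l j. q n u (j + k + l) - q n u (j + k) - q n u (j + l) + q n u j)"
    have t: "\<bar>t k l (j + p) - t k l j\<bar> \<le> real p * (real l * (real k * ?B n))" for j k l p
    proof (rule increments_abs_le)
      fix i
      have "t k l (i + 1) - t k l i = r k (i + l) - r k i" by (simp add: t_def r_def ac_simps)
      then show "\<bar>t k l (i + 1) - t k l i\<bar> \<le> real l * (real k * ?B n)" using r[of k i l] by simp
    qed
    have "?F n = t (ofs a n) (ofs b n) (ix x n + ofs d n) - t (ofs a n) (ofs b n) (ix x n)"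
      by (simp add: t_def ac_simps)
    then have "\<bar>?F n\<bar> = \<bar>t (ofs a n) (ofs b n) (ix x n + ofs d n) - t (ofs a n) (ofs b n) (ix x n)\<bar>"
      by (rule arg_cong)
    also have "\<dots> \<le> real (ofs d n) * (real (ofs b n) * (real (ofs a n) * ?B n))" by (rule t)
    also have "\<dots> = (W (M + Y) + C * P) * (real (ofs a n) / real n) * (real (ofs b n) / real n) * (real (ofs d n) / real n)"
      by (simp add: power3_eq_cube)
    finally show "\<bar>?F n\<bar> \<le> (W (M + Y) + C * P) * (real (ofs a n) / real n) * (real (ofs b n) / real n) * (real (ofs d n) / real n)" .
  qed
qed

section \<open>Estimates for the space derivative of the velocity\<close>

abbreviation dK :: "(real \<Rightarrow> real) \<Rightarrow> real \<Rightarrow> real" where "dK u \<equiv> deriv (K u)"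

lemma dK_bounds:
  assumes u: "adm m M Y u"
  shows "dK u x \<le> c * (u x - m)" and "- c * (M - u x) \<le> dK u x" and "\<bar>dK u x\<bar> \<le> c * M"
proof -
  note d = K_has_deriv[OF admD(1)[OF u], of x]
  show "dK u x \<le> c * (u x - m)"
    using K_increment(1)[OF u, of _ x] by (intro deriv_le_from_increments[OF d, of _ "c * Y"]) auto
  have "- dK u x \<le> c * (M - u x)"
    using K_increment(2)[OF u, of _ x] by (intro deriv_le_from_increments[OF DERIV_minus[OF d], of _ "c * Y"]) auto
  then show "- c * (M - u x) \<le> dK u x" by simp
  show "\<bar>dK u x\<bar> \<le> c * M"
    using K_increment(3)[OF u, of _ x] by (intro abs_deriv_le_from_increments[OF d]) (auto simp: mult.commute)
qed

lemma dK_diff: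
  assumes u: "adm m M Y u" and w: "adm m M Y' w" and E: "\<And>x. \<bar>u x - w x\<bar> \<le> E"
  shows "\<bar>dK u x - dK w x\<bar> \<le> \<Gamma> M * E"
  using K_diff_increment[OF u w E, of _ x]
  by (intro abs_deriv_le_from_increments[OF DERIV_diff[OF K_has_deriv[OF admD(1)[OF u]] K_has_deriv[OF admD(1)[OF w]]]]) auto

lemma K_shift_deriv: "u \<in> Per \<Longrightarrow> ((\<lambda>x. K u (x + b)) has_real_derivative dK u (x + b)) (at x)"
  using K_has_deriv[of u "x + b"] by (rule DERIV_shift[THEN iffD1])

text \<open>For fixed \<open>b\<close>, the mixed second difference of \<open>K u\<close> is the
  increment over \<open>a\<close> of \<open>y \<mapsto> K u (y + b) - K u y\<close>. Dividing by
  \<open>a\<close> and letting it tend to 0 leaves a first difference of \<open>dK u\<close>. One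
  order higher, the same argument gives \<open>dK_lip2\<close>.\<close>

lemma dK_lip:
  assumes u: "adm m M Y u"
  shows "lip (\<gamma> M + C * Y) (dK u)"
  unfolding lip_def
proof (intro allI impI)
  fix x b :: real assume b: "0 \<le> b"
  note per = admD(1)[OF u]
  have "\<bar>(K u (x + a + b) - K u (x + a)) - (K u (x + b) - K u x)\<bar> \<le> a * ((\<gamma> M + C * Y) * b)" if "0 < a" for a
    using K_increment2[OF u _ b, of a x] that by (simp add: algebra_simps)
  then show "\<bar>dK u (x + b) - dK u x\<bar> \<le> (\<gamma> M + C * Y) * b"
    by (intro abs_deriv_le_from_increments[OF DERIV_diff[OF K_shift_deriv[OF per] K_has_deriv[OF per]]])
qed

lemma dK_lip2:
  assumes u: "adm m M Y u" and P: "lip2 P u"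
  shows "lip2 (W (M + Y) + C * P) (dK u)"
  unfolding lip2_def
proof (intro allI impI)
  fix x b d :: real assume b: "0 \<le> b" and d: "0 \<le> d"
  note per = admD(1)[OF u]
  let ?f = "\<lambda>y. K u (y + (b + d)) - K u (y + b) - K u (y + d) + K u y"
  have "(?f has_real_derivative dK u (x + (b + d)) - dK u (x + b) - dK u (x + d) + dK u x) (at x)"
    by (intro DERIV_add DERIV_diff K_shift_deriv[OF per] K_has_deriv[OF per])
  then have "\<bar>dK u (x + (b + d)) - dK u (x + b) - dK u (x + d) + dK u x\<bar> \<le> (W (M + Y) + C * P) * b * d"
  proof (rule abs_deriv_le_from_increments)
    fix a :: real assume "0 < a"
    then show "\<bar>?f (x + a) - ?f x\<bar> \<le> a * ((W (M + Y) + C * P) * b * d)"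
      using K_increment3[OF u P b d, of a x] by (simp add: ac_simps)
  qed
  then show "\<bar>dK u (x + b + d) - dK u (x + b) - dK u (x + d) + dK u x\<bar> \<le> (W (M + Y) + C * P) * b * d"
    by (simp add: add.assoc)
qed

lemma dK_periodic: "u \<in> Per \<Longrightarrow> dK u (x + 1) = dK u x"
  using DERIV_unique[OF K_shift_deriv[of u 1 x]] K_has_deriv[of u x] K_periodic[of u] by simp

end


section \<open>First and second differences\<close>

lemma abs_mult_le: "\<bar>p\<bar> \<le> P \<Longrightarrow> \<bar>q\<bar> \<le> Q \<Longrightarrow> \<bar>p * q\<bar> \<le> P * (Q::real)"
  unfolding abs_mult by (rule mult_mono) auto

lemma lip_increment: "lip Y u \<Longrightarrow> 0 \<le> a \<Longrightarrow> \<bar>u (x + a) - u x\<bar> \<le> Y * a"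
  unfolding lip_def by blast

lemma lip2_increment:
  "lip2 P u \<Longrightarrow> 0 \<le> a \<Longrightarrow> 0 \<le> b \<Longrightarrow> \<bar>u (x + a + b) - u (x + a) - u (x + b) + u x\<bar> \<le> P * a * b"
  unfolding lip2_def by blast

lemma lip_mono: "lip Y u \<Longrightarrow> Y \<le> Y' \<Longrightarrow> lip Y' u"
  unfolding lip_def by (meson mult_right_mono order_trans)

lemma lip2_mono: "lip2 Y u \<Longrightarrow> Y \<le> Y' \<Longrightarrow> lip2 Y' u"
  unfolding lip2_def by (meson mult_right_mono order_trans)

lemma lip_diff: "lip A f \<Longrightarrow> lip B g \<Longrightarrow> lip (A + B) (\<lambda>x. f x - g x)"
  unfolding lip_def
proof (intro allI impI)
  fix x a :: real assume f: "\<forall>x a. 0 \<le> a \<longrightarrow> \<bar>f (x + a) - f x\<bar> \<le> A * a"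
    and g: "\<forall>x a. 0 \<le> a \<longrightarrow> \<bar>g (x + a) - g x\<bar> \<le> B * a" and a: "0 \<le> a"
  have "\<bar>f (x + a) - f x\<bar> \<le> A * a" "\<bar>g (x + a) - g x\<bar> \<le> B * a" using f g a by blast+
  then show "\<bar>f (x + a) - g (x + a) - (f x - g x)\<bar> \<le> (A + B) * a" unfolding distrib_right by linarith
qed

lemma lip_cmult:
  assumes "lip A f" and t: "0 \<le> t"
  shows "lip (t * A) (\<lambda>x. t * f x)"
  unfolding lip_def
proof (intro allI impI)
  fix x a :: real assume "0 \<le> a"
  then have "\<bar>t\<bar> * \<bar>f (x + a) - f x\<bar> \<le> t * (A * a)"
    using t lip_increment[OF assms(1)] by (intro mult_mono) auto
  then show "\<bar>t * f (x + a) - t * f x\<bar> \<le> t * A * a"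
    by (simp add: abs_mult[symmetric] right_diff_distrib mult.assoc)
qed

lemma lip2_diff: "lip2 A f \<Longrightarrow> lip2 B g \<Longrightarrow> lip2 (A + B) (\<lambda>x. f x - g x)"
  unfolding lip2_def[of "A + B"]
proof (intro allI impI)
  fix x a b :: real assume f: "lip2 A f" and g: "lip2 B g" and ab: "0 \<le> a" "0 \<le> b"
  show "\<bar>f (x + a + b) - g (x + a + b) - (f (x + a) - g (x + a)) - (f (x + b) - g (x + b)) + (f x - g x)\<bar>
      \<le> (A + B) * a * b"
    using lip2_increment[OF f ab, of x] lip2_increment[OF g ab, of x] unfolding distrib_right by linarith
qed

lemma lip2_cmult:
  assumes f: "lip2 A f" and t: "0 \<le> t"
  shows "lip2 (t * A) (\<lambda>x. t * f x)"
  unfolding lip2_def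
proof (intro allI impI)
  fix x a b :: real assume ab: "0 \<le> a" "0 \<le> b"
  have "\<bar>t\<bar> * \<bar>f (x + a + b) - f (x + a) - f (x + b) + f x\<bar> \<le> t * (A * a * b)"
    using t lip2_increment[OF f ab] by (intro mult_mono) auto
  then show "\<bar>t * f (x + a + b) - t * f (x + a) - t * f (x + b) + t * f x\<bar> \<le> t * A * a * b"
    by (simp add: abs_mult[symmetric] right_diff_distrib distrib_left mult.assoc)
qed

lemma lip_mult:
  assumes f: "lip A f" and g: "lip B g" and F: "\<And>x. \<bar>f x\<bar> \<le> F" and G: "\<And>x. \<bar>g x\<bar> \<le> G"
  shows "lip (F * B + A * G) (\<lambda>x. f x * g x)"
  unfolding lip_def
proof (intro allI impI)
  fix x a :: real assume a: "0 \<le> a"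
  have "f (x + a) * g (x + a) - f x * g x = f (x + a) * (g (x + a) - g x) + (f (x + a) - f x) * g x"
    by (simp add: algebra_simps)
  moreover have "\<bar>f (x + a) * (g (x + a) - g x)\<bar> \<le> F * (B * a)"
    by (intro abs_mult_le F lip_increment[OF g a])
  moreover have "\<bar>(f (x + a) - f x) * g x\<bar> \<le> A * a * G"
    by (intro abs_mult_le G lip_increment[OF f a])
  ultimately have "\<bar>f (x + a) * g (x + a) - f x * g x\<bar> \<le> F * (B * a) + A * a * G" by linarith
  then show "\<bar>f (x + a) * g (x + a) - f x * g x\<bar> \<le> (F * B + A * G) * a" by (simp add: algebra_simps)
qed

text \<open>An exact discrete Leibniz rule: the points at which the factors are evaluated are
  shifted so that no remainder occurs. The two mixed terms account for the factor 2.\<close>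

lemma lip2_mult:
  assumes f: "lip A f" and g: "lip B g" and F: "\<And>x. \<bar>f x\<bar> \<le> F" and G: "\<And>x. \<bar>g x\<bar> \<le> G"
    and f2: "lip2 P f" and g2: "lip2 Q g"
  shows "lip2 (F * Q + 2 * A * B + P * G) (\<lambda>x. f x * g x)"
  unfolding lip2_def
proof (intro allI impI)
  fix x a b :: real assume a: "0 \<le> a" and b: "0 \<le> b"
  let ?T = "f (x + a + b) * g (x + a + b) - f (x + a) * g (x + a) - f (x + b) * g (x + b) + f x * g x"
  have "?T = f (x + a + b) * (g (x + a + b) - g (x + a) - g (x + b) + g x)
      + (f (x + b + a) - f (x + b)) * (g (x + b) - g x) + (f (x + a + b) - f (x + a)) * (g (x + a) - g x)
      + (f (x + a + b) - f (x + a) - f (x + b) + f x) * g x"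
    by (simp add: algebra_simps)
  moreover have "\<bar>f (x + a + b) * (g (x + a + b) - g (x + a) - g (x + b) + g x)\<bar> \<le> F * (Q * a * b)"
    by (intro abs_mult_le F lip2_increment[OF g2 a b])
  moreover have "\<bar>(f (x + b + a) - f (x + b)) * (g (x + b) - g x)\<bar> \<le> A * a * (B * b)"
    by (intro abs_mult_le lip_increment[OF f a] lip_increment[OF g b])
  moreover have "\<bar>(f (x + a + b) - f (x + a)) * (g (x + a) - g x)\<bar> \<le> A * b * (B * a)"
    by (intro abs_mult_le lip_increment[OF f b] lip_increment[OF g a])
  moreover have "\<bar>(f (x + a + b) - f (x + a) - f (x + b) + f x) * g x\<bar> \<le> P * a * b * G"
    by (intro abs_mult_le G lip2_increment[OF f2 a b])
  ultimately have "\<bar>?T\<bar> \<le> F * (Q * a * b) + A * a * (B * b) + A * b * (B * a) + P * a * b * G" by linarith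
  then show "\<bar>?T\<bar> \<le> (F * Q + 2 * A * B + P * G) * a * b" by (simp add: algebra_simps)
qed

text \<open>The difference is taken backwards because the velocity is nonnegative: information
  arrives from the left, so this is the upwind side.\<close>

definition bd :: "real \<Rightarrow> (real \<Rightarrow> real) \<Rightarrow> real \<Rightarrow> real" where
  "bd h u x = (u x - u (x - h)) / h"

lemma bd_bound:
  assumes "lip Y u" "0 < h"
  shows "\<bar>bd h u x\<bar> \<le> Y"
  using lip_increment[OF assms(1), of h "x - h"] assms(2) by (simp add: bd_def pos_divide_le_eq)

lemma bd_lip:
  assumes u: "lip2 P u" and h: "0 < h"
  shows "lip P (bd h u)"
  unfolding lip_def
proof (intro allI impI)
  fix x a :: real assume a: "0 \<le> a"
  have "bd h u (x + a) - bd h u x = (u (x - h + h + a) - u (x - h + h) - u (x - h + a) + u (x - h)) / h"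
    by (simp add: bd_def diff_divide_distrib[symmetric] algebra_simps)
  moreover have "\<bar>u (x - h + h + a) - u (x - h + h) - u (x - h + a) + u (x - h)\<bar> \<le> P * h * a"
    using lip2_increment[OF u _ a, of h "x - h"] h by simp
  ultimately show "\<bar>bd h u (x + a) - bd h u x\<bar> \<le> P * a" using h by (simp add: pos_divide_le_eq ac_simps)
qed

text \<open>As \<open>l * v\<close> lies in [0, 1], the increment of the transported function is a
  convex combination of increments of \<open>u\<close> at \<open>x\<close> and \<open>x - h\<close>,
  which cannot grow. Only the variation of \<open>v\<close> over the increment costs something,
  namely \<open>V * a\<close> times the drop of \<open>u\<close> over \<open>h\<close>.\<close>

lemma upwind_lip:
  assumes u: "lip Y u" and v: "lip V v" and lv: "\<And>x. 0 \<le> l * v x" "\<And>x. l * v x \<le> 1"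
    and l: "0 \<le> l" and h: "0 < h"
  shows "lip (Y + l * h * (V * Y)) (\<lambda>x. u x - l * v x * (u x - u (x - h)))"
  unfolding lip_def
proof (intro allI impI)
  fix x a :: real assume a: "0 \<le> a"
  let ?T = "\<lambda>x. u x - l * v x * (u x - u (x - h))"
  have e: "x + a - h = x - h + a" by simp
  have "?T (x + a) - ?T x = (1 - l * v (x + a)) * (u (x + a) - u x) + l * v (x + a) * (u (x - h + a) - u (x - h))
      - l * ((v (x + a) - v x) * (u (x - h + h) - u (x - h)))"
    unfolding e by (simp add: algebra_simps)
  moreover have "\<bar>(1 - l * v (x + a)) * (u (x + a) - u x)\<bar> \<le> (1 - l * v (x + a)) * (Y * a)"
    using lv[of "x + a"] by (intro abs_mult_le lip_increment[OF u a]) auto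
  moreover have "\<bar>l * v (x + a) * (u (x - h + a) - u (x - h))\<bar> \<le> l * v (x + a) * (Y * a)"
    using lv[of "x + a"] by (intro abs_mult_le[of "l * v (x + a)"] lip_increment[OF u a]) auto
  moreover have "\<bar>l * ((v (x + a) - v x) * (u (x - h + h) - u (x - h)))\<bar> \<le> l * ((V * a) * (Y * h))"
    using l h by (intro abs_mult_le lip_increment[OF u] lip_increment[OF v a]) auto
  ultimately have "\<bar>?T (x + a) - ?T x\<bar> \<le> (1 - l * v (x + a)) * (Y * a) + l * v (x + a) * (Y * a) + l * ((V * a) * (Y * h))"
    by linarith
  then show "\<bar>?T (x + a) - ?T x\<bar> \<le> (Y + l * h * (V * Y)) * a" by (simp add: algebra_simps)
qed

lemma upwind_lip2:
  assumes u: "lip Y u" and v: "lip V v" and lv: "\<And>x. 0 \<le> l * v x" "\<And>x. l * v x \<le> 1"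
    and l: "0 \<le> l" and h: "0 < h" and u2: "lip2 P u" and v2: "lip2 Q v"
  shows "lip2 (P + l * h * (2 * V * P + Q * Y)) (\<lambda>x. u x - l * v x * (u x - u (x - h)))"
  unfolding lip2_def
proof (intro allI impI)
  fix x a b :: real assume a: "0 \<le> a" and b: "0 \<le> b"
  let ?T = "\<lambda>x. u x - l * v x * (u x - u (x - h))"
  let ?D = "\<lambda>x. h * bd h u x"
  have D: "?D x = u x - u (x - h)" for x using h by (simp add: bd_def)
  have Dl: "\<bar>?D (x + d) - ?D x\<bar> \<le> h * (P * d)" if "0 \<le> d" for d
    unfolding right_diff_distrib[symmetric]
    using h that by (intro abs_mult_le lip_increment[OF bd_lip[OF u2 h]]) auto
  have e: "x + a + b - h = x - h + a + b" "x + a - h = x - h + a" "x + b - h = x - h + b" by simp_all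
  \<comment> \<open>Again a convex combination plus terms in differences of \<open>v\<close>.
    Writing the drop over \<open>h\<close> as \<open>h * bd h u\<close> makes each of these terms of
    size \<open>h\<close>: two of them pair a slope of \<open>v\<close> with an increment of
    \<open>bd h u\<close>, the last pairs a second difference of \<open>v\<close> with a slope of
    \<open>u\<close>.\<close>
  have "?T (x + a + b) - ?T (x + a) - ?T (x + b) + ?T x =
      (1 - l * v (x + a + b)) * (u (x + a + b) - u (x + a) - u (x + b) + u x)
      + l * v (x + a + b) * (u (x - h + a + b) - u (x - h + a) - u (x - h + b) + u (x - h))
      - l * ((v (x + b + a) - v (x + b)) * (?D (x + b) - ?D x))
      - l * ((v (x + a + b) - v (x + a)) * (?D (x + a) - ?D x))
      - l * ((v (x + a + b) - v (x + a) - v (x + b) + v x) * ?D x)"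
    unfolding D e by (simp add: algebra_simps)
  moreover have "\<bar>(1 - l * v (x + a + b)) * (u (x + a + b) - u (x + a) - u (x + b) + u x)\<bar>
      \<le> (1 - l * v (x + a + b)) * (P * a * b)"
    using lv[of "x + a + b"] by (intro abs_mult_le lip2_increment[OF u2 a b]) auto
  moreover have "\<bar>l * v (x + a + b) * (u (x - h + a + b) - u (x - h + a) - u (x - h + b) + u (x - h))\<bar>
      \<le> l * v (x + a + b) * (P * a * b)"
    using lv[of "x + a + b"] by (intro abs_mult_le[of "l * v (x + a + b)"] lip2_increment[OF u2 a b]) auto
  moreover have "\<bar>l * ((v (x + b + a) - v (x + b)) * (?D (x + b) - ?D x))\<bar> \<le> l * ((V * a) * (h * (P * b)))"
    using l b by (intro abs_mult_le Dl lip_increment[OF v a]) auto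
  moreover have "\<bar>l * ((v (x + a + b) - v (x + a)) * (?D (x + a) - ?D x))\<bar> \<le> l * ((V * b) * (h * (P * a)))"
    using l a by (intro abs_mult_le Dl lip_increment[OF v b]) auto
  moreover have "\<bar>l * ((v (x + a + b) - v (x + a) - v (x + b) + v x) * ?D x)\<bar> \<le> l * ((Q * a * b) * (h * Y))"
    using l h by (intro abs_mult_le lip2_increment[OF v2 a b] bd_bound[OF u h]) auto
  ultimately have "\<bar>?T (x + a + b) - ?T (x + a) - ?T (x + b) + ?T x\<bar> \<le>
      (1 - l * v (x + a + b)) * (P * a * b) + l * v (x + a + b) * (P * a * b)
      + l * ((V * a) * (h * (P * b))) + l * ((V * b) * (h * (P * a))) + l * ((Q * a * b) * (h * Y))"
    by linarith
  then show "\<bar>?T (x + a + b) - ?T (x + a) - ?T (x + b) + ?T x\<bar> \<le> (P + l * h * (2 * V * P + Q * Y)) * a * b"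
    by (simp add: algebra_simps)
qed

text \<open>Quotients of commensurable increments are compared by telescoping; continuity of \<open>u\<close> gives
  the general case.\<close>

lemma lip2_quotients_close:
  assumes u: "lip Y u" and u2: "lip2 P u" and a: "0 < a" and b: "0 < b"
  shows "\<bar>(u (x + a) - u x) / a - (u (x + b) - u x) / b\<bar> \<le> P * (a + b)"
proof -
  define D where "D = (\<lambda>a. (u (x + a) - u x) / a)"
  have P: "0 \<le> P" by (rule lip2_nonneg[OF u2])
  have mult: "\<bar>D (real n * d) - D d\<bar> \<le> P * (real n * d)" if d: "0 < d" and n: "0 < n" for n d
  proof -
    have "\<bar>(u (x + real n * d) - u x) - real n * (u (x + d) - u x)\<bar> \<le> real n * (P * (real n * d) * d)" for n
    proof (induction n)
      case (Suc n)
      have "\<bar>u (x + real n * d + d) - u (x + real n * d) - u (x + d) + u x\<bar> \<le> P * (real n * d) * d"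
        using d by (intro lip2_increment[OF u2]) auto
      moreover have "u (x + real (Suc n) * d) = u (x + real n * d + d)" by (simp add: algebra_simps)
      moreover have "real n * (P * (real n * d) * d) + P * (real n * d) * d \<le> real (Suc n) * (P * (real (Suc n) * d) * d)"
        using d P by (simp add: algebra_simps)
      ultimately show ?case using Suc.IH by (simp add: distrib_right)
    qed simp
    from this[of n] have "\<bar>(u (x + real n * d) - u x) - real n * (u (x + d) - u x)\<bar> / (real n * d) \<le> P * (real n * d)"
      using d n by (simp add: pos_divide_le_eq algebra_simps)
    moreover have "D (real n * d) - D d = ((u (x + real n * d) - u x) - real n * (u (x + d) - u x)) / (real n * d)"
      using d n unfolding D_def by (simp add: field_simps)
    ultimately show ?thesis using d n by (simp add: abs_divide)
  qed
  \<comment> \<open>Both \<open>a\<close> and \<open>?z n\<close> are multiples of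
    \<open>a / n\<close>, so each of their quotients can be compared with that of the common small
    step, and \<open>?z n\<close> tends to \<open>b\<close>.\<close>
  let ?k = "\<lambda>n. nat \<lfloor>b / a * real n\<rfloor>"
  let ?z = "\<lambda>n. real (?k n) * (a / real n)"
  have "(\<lambda>n. real (?k n) / real n * a) \<longlonglongrightarrow> b / a * a"
    using a b by (intro tendsto_intros floor_div_limit) auto
  then have z: "?z \<longlonglongrightarrow> b" using a by simp
  have uc: "isCont u y" for y using lip_continuous[OF u, of UNIV] by (simp add: continuous_on_eq_continuous_at)
  have Dz: "(\<lambda>n. D (?z n)) \<longlonglongrightarrow> D b"
    unfolding D_def using b by (intro tendsto_intros isCont_tendsto_compose[OF uc] z) auto
  have "\<bar>D a - D b\<bar> \<le> P * (a + b)"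
  proof (rule LIMSEQ_le)
    show "(\<lambda>n. \<bar>D a - D (?z n)\<bar>) \<longlonglongrightarrow> \<bar>D a - D b\<bar>" by (intro tendsto_intros Dz)
    show "(\<lambda>n. P * (a + ?z n)) \<longlonglongrightarrow> P * (a + b)" by (intro tendsto_intros z)
    have "eventually (\<lambda>n. 0 < ?z n) sequentially" using order_tendstoD(1)[OF z b] .
    then have "eventually (\<lambda>n. \<bar>D a - D (?z n)\<bar> \<le> P * (a + ?z n)) sequentially"
    proof eventually_elim
      case (elim n)
      have n: "0 < n" using elim by (cases n) auto
      have k: "0 < ?k n" using elim by (metis mult_zero_left neq0_conv of_nat_0 less_irrefl)
      have "\<bar>D (real n * (a / real n)) - D (a / real n)\<bar> \<le> P * (real n * (a / real n))"
        using n a by (intro mult) auto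
      moreover have "\<bar>D (?z n) - D (a / real n)\<bar> \<le> P * ?z n" using n a k by (intro mult) auto
      ultimately show ?case using n by (simp add: distrib_left)
    qed
    then show "\<exists>N. \<forall>n\<ge>N. \<bar>D a - D (?z n)\<bar> \<le> P * (a + ?z n)" by (simp add: eventually_sequentially)
  qed
  then show ?thesis unfolding D_def .
qed

text \<open>Forward quotients with steps tending to 0 are Cauchy by
  \<open>lip2_quotients_close\<close>, which gives a right derivative with an explicit rate. The
  rate is carried over to backward quotients, so that the derivative is two-sided.\<close>

lemma lip2_differentiable:
  assumes u: "lip Y u" and u2: "lip2 P u"
  shows "(u has_real_derivative deriv u x) (at x)"
    and "0 < h \<Longrightarrow> \<bar>bd h u x - deriv u x\<bar> \<le> 2 * P * h"
    and "lip P (deriv u)"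
proof -
  have P: "0 \<le> P" by (rule lip2_nonneg[OF u2])
  have ex: "\<exists>d. \<forall>a>0. \<bar>(u (x + a) - u x) / a - d\<bar> \<le> P * a" for x
  proof -
    define D where "D = (\<lambda>a. (u (x + a) - u x) / a)"
    have q: "\<bar>D a - D b\<bar> \<le> P * (a + b)" if "0 < a" "0 < b" for a b
      unfolding D_def by (rule lip2_quotients_close[OF u u2 that])
    have "Cauchy (\<lambda>n. D (inverse (real (Suc n))))"
    proof (rule metric_CauchyI)
      fix e :: real assume e: "0 < e"
      obtain N where N: "inverse (real (Suc N)) < e / (2 * (P + 1))"
        using reals_Archimedean[of "e / (2 * (P + 1))"] e P by auto
      show "\<exists>M. \<forall>m\<ge>M. \<forall>n\<ge>M. dist (D (inverse (real (Suc m)))) (D (inverse (real (Suc n)))) < e"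
      proof (intro exI[of _ N] allI impI)
        fix m n assume mn: "N \<le> m" "N \<le> n"
        let ?r = "\<lambda>n. inverse (real (Suc n))"
        have "?r m \<le> ?r N" "?r n \<le> ?r N" using mn by (auto intro!: le_imp_inverse_le)
        then have "?r m + ?r n \<le> 2 * ?r N" by linarith
        then have "P * (?r m + ?r n) \<le> (P + 1) * (2 * ?r N)" using P by (intro mult_mono) (auto simp del: of_nat_Suc)
        also have "\<dots> < (P + 1) * (2 * (e / (2 * (P + 1))))" using N P by (intro mult_strict_left_mono) auto
        also have "\<dots> = e" using P by (simp add: field_simps)
        finally show "dist (D (?r m)) (D (?r n)) < e" using q[of "?r m" "?r n"] by (simp add: dist_real_def)
      qed
    qed
    then obtain d where d: "(\<lambda>n. D (inverse (real (Suc n)))) \<longlonglongrightarrow> d"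
      using Cauchy_convergent convergent_def by blast
    have "\<bar>D a - d\<bar> \<le> P * a" if "0 < a" for a
    proof (rule LIMSEQ_le)
      show "(\<lambda>n. \<bar>D a - D (inverse (real (Suc n)))\<bar>) \<longlonglongrightarrow> \<bar>D a - d\<bar>" by (intro tendsto_intros d)
      have "(\<lambda>n. P * (a + inverse (real (Suc n)))) \<longlonglongrightarrow> P * (a + 0)"
        by (intro tendsto_intros LIMSEQ_inverse_real_of_nat)
      then show "(\<lambda>n. P * (a + inverse (real (Suc n)))) \<longlonglongrightarrow> P * a" by simp
      show "\<exists>N. \<forall>n\<ge>N. \<bar>D a - D (inverse (real (Suc n)))\<bar> \<le> P * (a + inverse (real (Suc n)))"
        using q that by auto
    qed
    then show ?thesis unfolding D_def by blast
  qed
  then obtain d where d: "\<And>x a. 0 < a \<Longrightarrow> \<bar>(u (x + a) - u x) / a - d x\<bar> \<le> P * a" by metis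
  \<comment> \<open>The backward quotient at \<open>x + h\<close> is the forward quotient at
    \<open>x\<close>, and \<open>bd h u\<close> is \<open>P\<close>-Lipschitz; hence left quotients
    obey the same kind of estimate.\<close>
  have b: "\<bar>bd h u x - d x\<bar> \<le> 2 * P * h" if h: "0 < h" for h x
  proof -
    have "bd h u (x + h) = (u (x + h) - u x) / h" by (simp add: bd_def)
    moreover have "\<bar>bd h u (x + h) - bd h u x\<bar> \<le> P * h"
      using h by (intro lip_increment[OF bd_lip[OF u2]]) auto
    ultimately show ?thesis using d[OF h, of x] by linarith
  qed
  have q: "\<bar>(u (x + a) - u x) / a - d x\<bar> \<le> 2 * P * \<bar>a\<bar>" if "a \<noteq> 0" for a x
  proof (cases "0 < a")
    case True
    then show ?thesis using d[of a x] P by simp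
  next
    case False
    then have "0 < - a" using that by simp
    moreover have "bd (- a) u x = (u (x + a) - u x) / a" 
      by (simp add: bd_def) (metis minus_diff_eq minus_divide_left)
    ultimately show ?thesis using b[of "- a" x] False by simp
  qed
  have der: "(u has_real_derivative d x) (at x)" for x
    unfolding DERIV_def
  proof (rule Lim_transform[OF tendsto_const])
    show "((\<lambda>a. (u (x + a) - u x) / a - d x) \<longlongrightarrow> 0) (at 0)"
    proof (rule Lim_null_comparison)
      show "\<forall>\<^sub>F a in at 0. norm ((u (x + a) - u x) / a - d x) \<le> 2 * P * \<bar>a\<bar>"
        using q[of _ x] by (auto simp: eventually_at_filter)
      show "((\<lambda>a. 2 * P * \<bar>a\<bar>) \<longlongrightarrow> 0) (at 0)"
        by (auto intro!: tendsto_eq_intros)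
    qed
  qed
  then have dd: "deriv u = d" using DERIV_imp_deriv by blast
  show "(u has_real_derivative deriv u x) (at x)" unfolding dd by (rule der)
  show "\<bar>bd h u x - deriv u x\<bar> \<le> 2 * P * h" if "0 < h" unfolding dd by (rule b[OF that])
  show "lip P (deriv u)" unfolding dd lip_def
  proof (intro allI impI)
    fix x s :: real assume s: "0 \<le> s"
    have "((\<lambda>y. u (y + s) - u y) has_real_derivative d (x + s) - d x) (at x)"
      by (intro DERIV_diff der DERIV_shift[THEN iffD1])
    then show "\<bar>d (x + s) - d x\<bar> \<le> P * s"
    proof (rule abs_deriv_le_from_increments)
      fix a :: real assume "0 < a"
      then show "\<bar>u (x + a + s) - u (x + a) - (u (x + s) - u x)\<bar> \<le> a * (P * s)"
        using lip2_increment[OF u2 _ s, of a x] by (simp add: algebra_simps)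
    qed
  qed
qed

text \<open>Interpolation between the sup norm and second differences through an auxiliary step
  \<open>\<eta>\<close>: each passage between a slope and a quotient with step \<open>\<eta>\<close>
  costs \<open>2 * P * \<eta>\<close>, and the two such quotients differ by at most
  \<open>2 * E / \<eta>\<close>. With \<open>\<eta>\<close> of order \<open>sqrt E\<close>, slopes
  converge whenever the functions do.\<close>

lemma bd_approximates_deriv:
  assumes u: "lip Y u" "lip2 P u" and w: "lip Y' w" "lip2 P w" and E: "\<And>x. \<bar>u x - w x\<bar> \<le> E"
    and h: "0 < h" and \<eta>: "0 < \<eta>"
  shows "\<bar>bd h u x - deriv w x\<bar> \<le> 2 * P * h + 4 * P * \<eta> + 2 * E / \<eta>"
proof -
  have "\<bar>bd \<eta> u x - bd \<eta> w x\<bar> = \<bar>(u x - w x) - (u (x - \<eta>) - w (x - \<eta>))\<bar> / \<eta>"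
    using \<eta> by (simp add: bd_def diff_divide_distrib[symmetric] abs_divide algebra_simps)
  also have "\<dots> \<le> 2 * E / \<eta>"
    using E[of x] E[of "x - \<eta>"] \<eta> by (intro divide_right_mono) auto
  finally show ?thesis
    using lip2_differentiable(2)[OF u h, of x] lip2_differentiable(2)[OF u \<eta>, of x]
      lip2_differentiable(2)[OF w \<eta>, of x] by linarith
qed

text \<open>\<open>(a + B * t) * exp (A * t)\<close> is a supersolution of
  \<open>y' = A * y + B\<close>. Unlike the exact solution it involves no division by
  \<open>A\<close>, so \<open>A = 0\<close> is not a special case.\<close>

lemma gronwall_step:
  fixes y a A B t \<tau> :: real
  assumes y: "y \<le> (a + B * t) * exp (A * t)" and nn: "0 \<le> A" "0 \<le> B" "0 \<le> t" "0 \<le> \<tau>" "0 \<le> a"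
  shows "y + \<tau> * (A * y + B) \<le> (a + B * (t + \<tau>)) * exp (A * (t + \<tau>))"
proof -
  have "y + \<tau> * (A * y + B) = y * (1 + A * \<tau>) + B * \<tau>" by (simp add: algebra_simps)
  also have "\<dots> \<le> (a + B * t) * exp (A * t) * exp (A * \<tau>) + B * \<tau> * exp (A * (t + \<tau>))"
  proof (rule add_mono)
    have "y * (1 + A * \<tau>) \<le> (a + B * t) * exp (A * t) * (1 + A * \<tau>)"
      using y nn by (intro mult_right_mono) auto
    also have "\<dots> \<le> (a + B * t) * exp (A * t) * exp (A * \<tau>)"
      using nn by (intro mult_left_mono exp_ge_add_one_self) auto
    finally show "y * (1 + A * \<tau>) \<le> (a + B * t) * exp (A * t) * exp (A * \<tau>)" .
    have "1 \<le> exp (A * (t + \<tau>))" using nn by simp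
    from mult_left_mono[OF this, of "B * \<tau>"] show "B * \<tau> \<le> B * \<tau> * exp (A * (t + \<tau>))" using nn by simp
  qed
  also have "\<dots> = (a + B * (t + \<tau>)) * exp (A * (t + \<tau>))" by (simp add: exp_add algebra_simps)
  finally show ?thesis .
qed

section \<open>The upwind step\<close>

context flux
begin

lemma admI:
  assumes "0 < m" "between m M u" "lip Y u" "\<And>x. u (x + 1) = u x"
  shows "adm m M Y u"
  using assms PerI[OF lip_continuous[OF assms(3)]] unfolding adm_def by blast

lemma adm_mono:
  assumes "adm m M Y u" "0 < m'" "m' \<le> m" "M \<le> M'" "Y \<le> Y'"
  shows "adm m' M' Y' u"
  using assms lip_mono[of Y u Y'] unfolding adm_def between_def by (meson order_trans)

text \<open>\<open>H u p\<close> is \<open>(u \<cdot> K u)'\<close> with the slope of \<open>u\<close> replaced by \<open>p\<close>.\<close>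

definition H :: "(real \<Rightarrow> real) \<Rightarrow> real \<Rightarrow> real \<Rightarrow> real" where
  "H u p x = K u x * p + u x * dK u x"

lemma H_bound:
  assumes u: "adm m M Y u" and p: "\<bar>p\<bar> \<le> Y"
  shows "\<bar>H u p x\<bar> \<le> vmax * Y + M * (c * M)"
proof -
  note uD = admD[OF u]
  have "\<bar>K u x * p\<bar> \<le> vmax * Y" using K_bounds[OF uD(1), of x] by (intro abs_mult_le p) auto
  moreover have "\<bar>u x * dK u x\<bar> \<le> M * (c * M)" using uD(9,10)[of x] by (intro abs_mult_le dK_bounds(3)[OF u]) auto
  ultimately show ?thesis unfolding H_def by linarith
qed

text \<open>In the splitting, the difference of the velocities is multiplied by the slope
  \<open>p\<close>, and the difference \<open>p - r\<close> by a velocity. Hence only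
  \<open>p\<close> must be bounded, and the constant \<open>Y'\<close> of \<open>w\<close> does not
  enter.\<close>

lemma H_diff:
  assumes u: "adm m M Y u" and w: "adm m M Y' w" and E: "\<And>x. \<bar>u x - w x\<bar> \<le> E" and p: "\<bar>p\<bar> \<le> Z"
  shows "\<bar>H u p x - H w r x\<bar> \<le> vmax * \<bar>p - r\<bar> + E * (L * Z + c * M + M * \<Gamma> M)"
proof -
  note uD = admD[OF u] and wD = admD[OF w]
  have "H u p x - H w r x = K w x * (p - r) + (K u x - K w x) * p + (u x - w x) * dK u x + w x * (dK u x - dK w x)"
    unfolding H_def by (simp add: algebra_simps)
  moreover have "\<bar>K w x * (p - r)\<bar> \<le> vmax * \<bar>p - r\<bar>"
    using K_bounds[OF wD(1), of x] by (intro abs_mult_le) auto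
  moreover have "\<bar>(K u x - K w x) * p\<bar> \<le> L * E * Z" by (intro abs_mult_le K_lipschitz[OF u w E] p)
  moreover have "\<bar>(u x - w x) * dK u x\<bar> \<le> E * (c * M)" by (intro abs_mult_le dK_bounds(3)[OF u] E)
  moreover have "\<bar>w x * (dK u x - dK w x)\<bar> \<le> M * (\<Gamma> M * E)"
    using wD(9,10)[of x] by (intro abs_mult_le dK_diff[OF u w E]) auto
  ultimately have "\<bar>H u p x - H w r x\<bar> \<le> vmax * \<bar>p - r\<bar> + L * E * Z + E * (c * M) + M * (\<Gamma> M * E)" by linarith
  then show ?thesis by (simp add: algebra_simps)
qed

lemma K_lip: "adm m M Y u \<Longrightarrow> lip (c * M) (K u)"
  unfolding lip_def using K_increment(3) by blast

lemma K_lip2: "adm m M Y u \<Longrightarrow> lip2 (\<gamma> M + C * Y) (K u)"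
  unfolding lip2_def using K_increment2 by blast

text \<open>The factor 2 holds the Courant number \<open>K u x / (2 * vmax)\<close> at or below one
  half. The other half of the weight of \<open>u x\<close> is reserved for the zero-order term in
  \<open>step_between\<close>.\<close>

definition tau :: "real \<Rightarrow> real" where "tau h = h / (2 * vmax)"

text \<open>Upwinding the non-conservative form \<open>u' = - K u \<cdot> u\<^sub>x - u \<cdot> (K u)\<^sub>x\<close> makes the maximum
  principle exact, because the zero-order term vanishes where \<open>u\<close> attains the bounds.\<close>

definition step :: "real \<Rightarrow> (real \<Rightarrow> real) \<Rightarrow> real \<Rightarrow> real" where
  "step h u x = u x - tau h * H u (bd h u x) x"

lemma tau_pos: "0 < h \<Longrightarrow> 0 < tau h"
  unfolding tau_def using vmax_pos by simp

lemma step_alt: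
  assumes "0 < h"
  shows "step h u x = (u x - 1 / (2 * vmax) * K u x * (u x - u (x - h))) - tau h * (u x * dK u x)"
  using assms vmax_pos unfolding step_def H_def bd_def tau_def by (simp add: field_simps)

lemma courant:
  assumes "u \<in> Per"
  shows "0 \<le> 1 / (2 * vmax) * K u x" "1 / (2 * vmax) * K u x \<le> 1 / 2" "1 / (2 * vmax) * K u x \<le> 1"
  using K_bounds[OF assms, of x] vmax_pos by (auto simp: field_simps)

lemma step_between:
  assumes u: "adm m M Y u" and h: "0 < h" and small: "tau h * (c * M) \<le> 1 / 2"
  shows "between m M (step h u)"
  unfolding between_def
proof
  fix x
  note uD = admD[OF u]
  define s where "s = 1 / (2 * vmax) * K u x"
  define z where "z = tau h * (u x * dK u x)"
  have s: "0 \<le> s" "s \<le> 1 / 2" unfolding s_def using courant[OF uD(1), of x] by auto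
  have st: "step h u x = (1 - s) * u x + s * u (x - h) - z"
    unfolding step_alt[OF h] s_def[symmetric] z_def[symmetric] by (simp add: algebra_simps)
  have t: "0 \<le> tau h" using tau_pos[OF h] by simp
  have "z \<le> tau h * (M * (c * (u x - m)))"
    unfolding z_def
  proof (rule mult_left_mono[OF _ t])
    have "u x * dK u x \<le> u x * (c * (u x - m))"
      using uD(10)[of x] by (intro mult_left_mono dK_bounds(1)[OF u]) auto
    also have "\<dots> \<le> M * (c * (u x - m))" using uD(8,9)[of x] const_nonneg by (intro mult_right_mono) auto
    finally show "u x * dK u x \<le> M * (c * (u x - m))" .
  qed
  also have "\<dots> = tau h * (c * M) * (u x - m)" by (simp add: algebra_simps)
  also have "\<dots> \<le> 1 / 2 * (u x - m)" using uD(8)[of x] by (intro mult_right_mono small) auto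
  finally have z1: "z \<le> 1 / 2 * (u x - m)" .
  have "- z \<le> tau h * (M * (c * (M - u x)))"
    unfolding z_def mult_minus_right[symmetric]
  proof (rule mult_left_mono[OF _ t])
    have "u x * - dK u x \<le> u x * (c * (M - u x))"
      using uD(10)[of x] dK_bounds(2)[OF u, of x] by (intro mult_left_mono) auto
    also have "\<dots> \<le> M * (c * (M - u x))" using uD(8,9)[of x] const_nonneg by (intro mult_right_mono) auto
    finally show "u x * - dK u x \<le> M * (c * (M - u x))" .
  qed
  also have "\<dots> = tau h * (c * M) * (M - u x)" by (simp add: algebra_simps)
  also have "\<dots> \<le> 1 / 2 * (M - u x)" using uD(9)[of x] by (intro mult_right_mono small) auto
  finally have z2: "- z \<le> 1 / 2 * (M - u x)" .
  \<comment> \<open>The weight \<open>1 - s\<close> of \<open>u x\<close> is at least one half. That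
    half absorbs \<open>z\<close>, by \<open>z1\<close> and \<open>z2\<close>; what remains has
    nonnegative weights.\<close>
  have "(1 - s - 1 / 2) * (u x - m) + s * (u (x - h) - m) \<ge> 0" "(1 - s - 1 / 2) * (M - u x) + s * (M - u (x - h)) \<ge> 0"
    using s uD(8)[of x] uD(9)[of x] uD(8)[of "x - h"] uD(9)[of "x - h"] by (auto intro!: add_nonneg_nonneg mult_nonneg_nonneg)
  moreover have "step h u x - m = ((1 - s - 1 / 2) * (u x - m) + s * (u (x - h) - m)) + (1 / 2 * (u x - m) - z)"
    "M - step h u x = ((1 - s - 1 / 2) * (M - u x) + s * (M - u (x - h))) + (1 / 2 * (M - u x) + z)"
    unfolding st by (simp_all add: field_simps)
  ultimately show "m \<le> step h u x \<and> step h u x \<le> M" using z1 z2 by linarith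
qed

text \<open>The growth rate is linear in \<open>Y\<close>: \<open>c * M\<close> comes from the
  transport, \<open>c * M\<close> and \<open>M * C\<close> from the product \<open>u * dK u\<close>.
  So the bound given by \<open>gronwall_step\<close> is finite at every time.\<close>

lemma step_lip:
  assumes u: "adm m M Y u" and h: "0 < h"
  shows "lip (Y + tau h * ((2 * (c * M) + M * C) * Y + M * \<gamma> M)) (step h u)"
proof -
  note uD = admD[OF u]
  have 1: "lip (Y + 1 / (2 * vmax) * h * (c * M * Y)) (\<lambda>x. u x - 1 / (2 * vmax) * K u x * (u x - u (x - h)))"
    using courant[OF uD(1)] vmax_pos h by (intro upwind_lip[OF uD(6) K_lip[OF u]]) auto
  have "lip (M * (\<gamma> M + C * Y) + Y * (c * M)) (\<lambda>x. u x * dK u x)"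
    using uD(9,10) by (intro lip_mult[OF uD(6) dK_lip[OF u] _ dK_bounds(3)[OF u]]) (auto simp: less_imp_le)
  then have 2: "lip (tau h * (M * (\<gamma> M + C * Y) + Y * (c * M))) (\<lambda>x. tau h * (u x * dK u x))"
    using tau_pos[OF h] by (intro lip_cmult) auto
  have "step h u = (\<lambda>x. (u x - 1 / (2 * vmax) * K u x * (u x - u (x - h))) - tau h * (u x * dK u x))"
    using step_alt[OF h] by blast
  moreover have "1 / (2 * vmax) * h = tau h" unfolding tau_def by simp
  ultimately have "lip (Y + tau h * (c * M * Y) + tau h * (M * (\<gamma> M + C * Y) + Y * (c * M))) (step h u)"
    using lip_diff[OF 1 2] by simp
  then show ?thesis by (simp add: algebra_simps)
qed

text \<open>Linearity is required in \<open>P\<close> only. The inhomogeneous part may be quadratic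
  in \<open>Y\<close> and contain \<open>W\<close>, since \<open>Y\<close> is already under control
  on a bounded time interval.\<close>

lemma step_lip2:
  assumes u: "adm m M Y u" and P: "lip2 P u" and h: "0 < h"
  shows "lip2 (P + tau h * ((3 * (c * M) + M * C) * P + (3 * Y * (\<gamma> M + C * Y) + M * W (M + Y)))) (step h u)"
proof -
  note uD = admD[OF u]
  have 1: "lip2 (P + 1 / (2 * vmax) * h * (2 * (c * M) * P + (\<gamma> M + C * Y) * Y))
      (\<lambda>x. u x - 1 / (2 * vmax) * K u x * (u x - u (x - h)))"
    using courant[OF uD(1)] vmax_pos h by (intro upwind_lip2[OF uD(6) K_lip[OF u] _ _ _ _ P K_lip2[OF u]]) auto
  have "lip2 (M * (W (M + Y) + C * P) + 2 * Y * (\<gamma> M + C * Y) + P * (c * M)) (\<lambda>x. u x * dK u x)"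
    using uD(9,10) by (intro lip2_mult[OF uD(6) dK_lip[OF u] _ dK_bounds(3)[OF u] P dK_lip2[OF u P]]) (auto simp: less_imp_le)
  then have 2: "lip2 (tau h * (M * (W (M + Y) + C * P) + 2 * Y * (\<gamma> M + C * Y) + P * (c * M))) (\<lambda>x. tau h * (u x * dK u x))"
    using tau_pos[OF h] by (intro lip2_cmult) auto
  have "step h u = (\<lambda>x. (u x - 1 / (2 * vmax) * K u x * (u x - u (x - h))) - tau h * (u x * dK u x))"
    using step_alt[OF h] by blast
  moreover have "1 / (2 * vmax) * h = tau h" unfolding tau_def by simp
  ultimately have "lip2 (P + tau h * (2 * (c * M) * P + (\<gamma> M + C * Y) * Y) +
      tau h * (M * (W (M + Y) + C * P) + 2 * Y * (\<gamma> M + C * Y) + P * (c * M))) (step h u)"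
    using lip2_diff[OF 1 2] by simp
  then show ?thesis by (simp add: algebra_simps)
qed

lemma step_periodic: "u \<in> Per \<Longrightarrow> step h u (x + 1) = step h u x"
  using Per_periodic[of u x] Per_periodic[of u "x - h"] K_periodic[of u x] dK_periodic[of u x]
  unfolding step_def H_def bd_def by (simp add: algebra_simps)

lemma step_adm:
  assumes u: "adm m M Y u" and h: "0 < h" and small: "tau h * (c * M) \<le> 1 / 2"
  shows "adm m M (Y + tau h * ((2 * (c * M) + M * C) * Y + M * \<gamma> M)) (step h u)"
  using admD[OF u] step_between[OF u h small] step_lip[OF u h] step_periodic
  by (intro admI) auto

text \<open>Transporting \<open>u - w\<close> with the velocity \<open>K w\<close> is a convex
  combination, and the rest compares \<open>H u\<close> with \<open>H w\<close> at the common slope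
  \<open>bd h u\<close>. Only the Lipschitz constant of \<open>u\<close> is used.\<close>

lemma step_stable:
  assumes u: "adm m M Y u" and w: "adm m M Y' w" and E: "\<And>x. \<bar>u x - w x\<bar> \<le> E" and h: "0 < h"
  shows "\<bar>step h u x - step h w x\<bar> \<le> E + tau h * ((L * Y + c * M + M * \<Gamma> M) * E)"
proof -
  note uD = admD[OF u] and wD = admD[OF w]
  define s where "s = 1 / (2 * vmax) * K w x"
  have s: "0 \<le> s" "s \<le> 1" unfolding s_def using courant[OF wD(1), of x] by auto
  have t: "0 \<le> tau h" using tau_pos[OF h] by simp
  have b: "\<bar>bd h u x\<bar> \<le> Y" by (rule bd_bound[OF uD(6) h])
  have "step h u x - step h w x = (1 - s) * (u x - w x) + s * (u (x - h) - w (x - h))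
      - tau h * (H u (bd h u x) x - H w (bd h u x) x)"
    unfolding step_def H_def s_def bd_def tau_def using h vmax_pos by (simp add: field_simps)
  moreover have "\<bar>(1 - s) * (u x - w x)\<bar> \<le> (1 - s) * E" "\<bar>s * (u (x - h) - w (x - h))\<bar> \<le> s * E"
    using s by (auto intro!: abs_mult_le E)
  moreover have "\<bar>tau h * (H u (bd h u x) x - H w (bd h u x) x)\<bar> \<le> tau h * (E * (L * Y + c * M + M * \<Gamma> M))"
    using t H_diff[OF u w E b, of x "bd h u x"] by (intro abs_mult_le) auto
  ultimately have "\<bar>step h u x - step h w x\<bar> \<le> (1 - s) * E + s * E + tau h * (E * (L * Y + c * M + M * \<Gamma> M))"
    by linarith
  then show ?thesis by (simp add: algebra_simps)
qed

text \<open>\<open>w\<close> follows the scheme only up to a defect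
  \<open>tau h * \<epsilon>\<close> per step, and its Lipschitz constant may vary with
  \<open>n\<close>. The lemma serves twice: for \<open>w\<close> a refined iterate taken at every
  second step, and for \<open>w\<close> an exact solution at the grid times.\<close>

lemma scheme_comparison:
  assumes h: "0 < h" and m: "0 < m"
    and u: "\<And>n. real n * tau h \<le> T \<Longrightarrow> adm m M Y (u n)"
    and w: "\<And>n. real n * tau h \<le> T \<Longrightarrow> \<exists>Y'. adm m M Y' (w n)"
    and us: "\<And>n. u (Suc n) = step h (u n)"
    and ws: "\<And>n x. real (Suc n) * tau h \<le> T \<Longrightarrow> \<bar>w (Suc n) x - step h (w n) x\<bar> \<le> tau h * \<epsilon>"
    and init: "u 0 = w 0" and \<epsilon>: "0 \<le> \<epsilon>"
    and n: "real n * tau h \<le> T"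
  shows "\<bar>u n x - w n x\<bar> \<le> \<epsilon> * T * exp ((L * Y + c * M + M * \<Gamma> M) * T)"
proof -
  define A where "A = L * Y + c * M + M * \<Gamma> M"
  have t: "0 < tau h" by (rule tau_pos[OF h])
  have T: "0 \<le> real n * tau h" using t by simp
  then have "adm m M Y (u 0)" using u[of 0] n by simp
  note D = admD[OF this]
  have A: "0 \<le> A" unfolding A_def using D \<Gamma>_nonneg[of M] const_nonneg by simp
  have main: "\<bar>u n x - w n x\<bar> \<le> (0 + \<epsilon> * (real n * tau h)) * exp (A * (real n * tau h))"
    if "real n * tau h \<le> T" for n x
    using that
  proof (induction n arbitrary: x)
    case 0
    then show ?case using init by simp
  next
    case (Suc n)
    have nT: "real n * tau h \<le> T" using Suc.prems t by (simp add: distrib_right)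
    define E where "E = (0 + \<epsilon> * (real n * tau h)) * exp (A * (real n * tau h))"
    have IH: "\<bar>u n x - w n x\<bar> \<le> E" for x unfolding E_def by (rule Suc.IH[OF nT])
    obtain Y' where Y': "adm m M Y' (w n)" using w[OF nT] by blast
    have "\<bar>u (Suc n) x - w (Suc n) x\<bar> \<le> E + tau h * (A * E + \<epsilon>)"
      using step_stable[OF u[OF nT] Y' IH h, of x] ws[OF Suc.prems, of x]
      unfolding us A_def[symmetric] distrib_left by linarith
    also have "\<dots> \<le> (0 + \<epsilon> * (real n * tau h + tau h)) * exp (A * (real n * tau h + tau h))"
      using A \<epsilon> t by (intro gronwall_step) (auto simp: E_def)
    also have "real n * tau h + tau h = real (Suc n) * tau h" by (simp add: algebra_simps)
    finally show ?case .
  qed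
  have "\<bar>u n x - w n x\<bar> \<le> (0 + \<epsilon> * (real n * tau h)) * exp (A * (real n * tau h))" by (rule main[OF n])
  also have "\<dots> \<le> (0 + \<epsilon> * T) * exp (A * T)"
    using n T A \<epsilon> by (intro mult_mono add_mono mult_left_mono) (auto intro!: mult_left_mono)
  finally show ?thesis unfolding A_def by simp
qed

text \<open>The coarse step uses one flux with weight \<open>tau h\<close>, the two half steps use
  two fluxes with weight \<open>tau h / 2\<close> each. All three fluxes agree up to
  \<open>O(h)\<close>, so the defect is \<open>tau h * O(h)\<close>.\<close>

lemma half_step_consistency:
  assumes w: "adm m M Y w" "lip2 P w" and w1: "adm m M Y (step (h / 2) w)" and h: "0 < h"
  defines "Z \<equiv> vmax * P + c * M * Y + (M * (\<gamma> M + C * Y) + Y * (c * M))"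
    and "g \<equiv> vmax * Y + M * (c * M)"
  shows "\<bar>step (h / 2) (step (h / 2) w) x - step h w x\<bar>
    \<le> tau h * (h * (vmax * (2 * (P + P) + Z / (2 * vmax)) + g / (2 * vmax) * (L * Y + c * M + M * \<Gamma> M)))"
proof -
  note wD = admD[OF w(1)]
  let ?w1 = "step (h / 2) w"
  have h2: "0 < h / 2" using h by simp
  have t: "0 \<le> tau h" "tau (h / 2) = tau h / 2" "tau h = h / (2 * vmax)"
    using tau_pos[OF h] by (auto simp: tau_def)
  have P: "0 \<le> P" by (rule lip2_nonneg[OF w(2)])
  define G where "G = (\<lambda>x. H w (bd (h / 2) w x) x)"
  have w1G: "?w1 x = w x - tau h / 2 * G x" for x unfolding step_def G_def t by simp
  have g: "\<bar>G x\<bar> \<le> g" for x unfolding G_def g_def by (rule H_bound[OF w(1) bd_bound[OF wD(6) h2]])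
  have g0: "0 \<le> g" using g[of 0] by linarith
  have "lip (vmax * P + c * M * Y) (\<lambda>x. K w x * bd (h / 2) w x)"
    using K_bounds[OF wD(1)] by (intro lip_mult[OF K_lip[OF w(1)] bd_lip[OF w(2) h2] _ bd_bound[OF wD(6) h2]]) auto
  moreover have "lip (M * (\<gamma> M + C * Y) + Y * (c * M)) (\<lambda>x. w x * dK w x)"
    using wD(9,10) by (intro lip_mult[OF wD(6) dK_lip[OF w(1)] _ dK_bounds(3)[OF w(1)]]) (auto simp: less_imp_le)
  moreover have "lip Z G"
  proof -
    have "\<bar>G (x + a) - G x\<bar> \<le> Z * a" if a: "0 \<le> a" for x a
    proof -
      have "G (x + a) - G x = (K w (x + a) * bd (h / 2) w (x + a) - K w x * bd (h / 2) w x)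
          + (w (x + a) * dK w (x + a) - w x * dK w x)" unfolding G_def H_def by simp
      then show ?thesis
        using lip_increment[OF calculation(1) a, of x] lip_increment[OF calculation(2) a, of x]
        unfolding Z_def distrib_right by linarith
    qed
    then show ?thesis unfolding lip_def by blast
  qed
  ultimately have lG: "lip Z G" by blast
  define E where "E = h * (g / (2 * vmax))"
  have E: "\<bar>?w1 x - w x\<bar> \<le> E" for x
  proof -
    have "\<bar>?w1 x - w x\<bar> = tau h / 2 * \<bar>G x\<bar>" unfolding w1G using t(1) by (simp add: abs_mult)
    also have "\<dots> \<le> tau h * g" using g[of x] t(1) g0 by (intro mult_mono) auto
    finally show ?thesis unfolding E_def t(3) by simp
  qed
  have bdd: "\<bar>bd h w x - bd (h / 2) w x\<bar> \<le> 2 * (P + P) * h" for x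
    using lip2_differentiable(2)[OF wD(6) w(2) h, of x] lip2_differentiable(2)[OF wD(6) w(2) h2, of x] P h
    by (simp add: algebra_simps)
  \<comment> \<open>Dividing the sup-norm bound \<open>E\<close> on \<open>?w1 - w\<close> by
    \<open>h\<close> would give only a bounded quantity. That \<open>G\<close> is Lipschitz, which
    rests on \<open>lip2 P w\<close>, gains the missing factor \<open>tau h\<close>.\<close>
  have "bd (h / 2) ?w1 x - bd (h / 2) w x = - (tau h / 2) * bd (h / 2) G x" for x
    unfolding bd_def w1G using h by (simp add: field_simps)
  then have bdw: "\<bar>bd (h / 2) ?w1 x - bd (h / 2) w x\<bar> \<le> tau h * Z" for x
    using abs_mult_le[of "- (tau h / 2)" "tau h" "bd (h / 2) G x" Z] bd_bound[OF lG h2, of x] t(1) by simp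
  have e1: "\<bar>H w (bd h w x) x - H w (bd (h / 2) w x) x\<bar> \<le> vmax * (2 * (P + P) * h)"
  proof -
    have "H w (bd h w x) x - H w (bd (h / 2) w x) x = K w x * (bd h w x - bd (h / 2) w x)"
      unfolding H_def by (simp add: algebra_simps)
    then show ?thesis using K_bounds[OF wD(1), of x] bdd[of x] by (auto intro!: abs_mult_le)
  qed
  have e2: "\<bar>H w (bd h w x) x - H ?w1 (bd (h / 2) ?w1 x) x\<bar>
      \<le> vmax * (2 * (P + P) * h + tau h * Z) + E * (L * Y + c * M + M * \<Gamma> M)"
  proof -
    have "\<bar>H w (bd h w x) x - H ?w1 (bd (h / 2) ?w1 x) x\<bar>
      \<le> vmax * \<bar>bd h w x - bd (h / 2) ?w1 x\<bar> + E * (L * Y + c * M + M * \<Gamma> M)"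
      using E by (intro H_diff[OF w(1) w1 _ bd_bound[OF wD(6) h]]) (simp add: abs_minus_commute)
    moreover have "vmax * \<bar>bd h w x - bd (h / 2) ?w1 x\<bar> \<le> vmax * (2 * (P + P) * h + tau h * Z)"
      using bdd[of x] bdw[of x] vmax_pos by (intro mult_left_mono) auto
    ultimately show ?thesis by linarith
  qed
  have "step (h / 2) ?w1 x - step h w x =
      tau h * (1 / 2 * (H w (bd h w x) x - H w (bd (h / 2) w x) x)
        + 1 / 2 * (H w (bd h w x) x - H ?w1 (bd (h / 2) ?w1 x) x))"
    unfolding step_def[of "h / 2" ?w1] w1G[of x] step_def[of h] G_def t(2) by (simp add: field_simps)
  also have "\<bar>\<dots>\<bar> \<le> tau h * (vmax * (2 * (P + P) * h + tau h * Z) + E * (L * Y + c * M + M * \<Gamma> M))"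
  proof (rule abs_mult_le)
    show "\<bar>tau h\<bar> \<le> tau h" using t(1) by simp
    have "0 \<le> vmax * (tau h * Z)" "0 \<le> E * (L * Y + c * M + M * \<Gamma> M)"
      using vmax_pos t(1) lip_nonneg[OF lG] g0 h wD const_nonneg \<Gamma>_nonneg[of M] by (auto simp: E_def)
    moreover have "\<bar>1 / 2 * p + 1 / 2 * q\<bar> \<le> B" if "\<bar>p\<bar> \<le> B" "\<bar>q\<bar> \<le> B" for p q B :: real
      using that by linarith
    ultimately show "\<bar>1 / 2 * (H w (bd h w x) x - H w (bd (h / 2) w x) x)
        + 1 / 2 * (H w (bd h w x) x - H ?w1 (bd (h / 2) ?w1 x) x)\<bar>
      \<le> vmax * (2 * (P + P) * h + tau h * Z) + E * (L * Y + c * M + M * \<Gamma> M)"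
      using e1 e2 unfolding distrib_left[of vmax "2 * (P + P) * h"] by simp
  qed
  also have "\<dots> = tau h * (h * (vmax * (2 * (P + P) + Z / (2 * vmax)) + g / (2 * vmax) * (L * Y + c * M + M * \<Gamma> M)))"
  proof -
    define z G where "z = Z / (2 * vmax)" and "G = g / (2 * vmax)"
    have "tau h * Z = h * z" by (simp add: t(3) z_def)
    then show ?thesis unfolding E_def z_def[symmetric] G_def[symmetric] by (simp add: algebra_simps)
  qed
  finally show ?thesis .
qed

end


section \<open>Convergence of the scheme\<close>

lemma geometric_increments_limit:
  fixes f :: "nat \<Rightarrow> real"
  assumes inc: "\<And>k. \<bar>f (Suc k) - f k\<bar> \<le> B * (1 / 2) ^ k"
  shows "f \<longlonglongrightarrow> lim f" and "\<bar>f k - lim f\<bar> \<le> 2 * B * (1 / 2) ^ k"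
proof -
  have B: "0 \<le> B" using inc[of 0] by simp
  \<comment> \<open>Subtracting the remaining geometric tail makes the induction close; the bound
    without it is not inductive.\<close>
  have d: "\<bar>f (k + j) - f k\<bar> \<le> 2 * B * (1 / 2) ^ k - 2 * B * (1 / 2) ^ (k + j)" for k j
  proof (induction j)
    case (Suc j)
    then show ?case using inc[of "k + j"] by simp
  qed simp
  have d': "\<bar>f (k + j) - f k\<bar> \<le> 2 * B * (1 / 2) ^ k" for k j
  proof -
    have "0 \<le> 2 * B * (1 / 2) ^ (k + j)" using B by simp
    then show ?thesis using d[of k j] by linarith
  qed
  have z: "(\<lambda>k. 2 * B * (1 / 2) ^ k) \<longlonglongrightarrow> 0"
    by (intro tendsto_mult_right_zero LIMSEQ_power_zero) simp
  have "Cauchy f"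
  proof (rule metric_CauchyI)
    fix e :: real assume "0 < e"
    then have "eventually (\<lambda>k. 2 * B * (1 / 2) ^ k < e / 2) sequentially"
      using z by (intro order_tendstoD(2)) auto
    then obtain N where N: "2 * B * (1 / 2) ^ N < e / 2" by (auto simp: eventually_sequentially)
    show "\<exists>M. \<forall>m\<ge>M. \<forall>n\<ge>M. dist (f m) (f n) < e"
    proof (intro exI[of _ N] allI impI)
      fix m n assume "N \<le> m" "N \<le> n"
      then show "dist (f m) (f n) < e"
        using d'[of N "m - N"] d'[of N "n - N"] N by (simp add: dist_real_def)
    qed
  qed
  then show l: "f \<longlonglongrightarrow> lim f" by (simp add: Cauchy_convergent_iff convergent_LIMSEQ_iff)
  show "\<bar>f k - lim f\<bar> \<le> 2 * B * (1 / 2) ^ k"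
  proof (rule LIMSEQ_le_const2)
    show "(\<lambda>j. \<bar>f k - f (j + k)\<bar>) \<longlonglongrightarrow> \<bar>f k - lim f\<bar>"
      by (intro tendsto_intros LIMSEQ_ignore_initial_segment l)
    show "\<exists>N. \<forall>n\<ge>N. \<bar>f k - f (n + k)\<bar> \<le> 2 * B * (1 / 2) ^ k"
      using d'[of k] by (auto simp: add.commute abs_minus_commute)
  qed
qed

text \<open>Equicontinuity in time, uniform in space, is required only on bounded time intervals;
  the neighbourhood of \<open>t\<close> is kept inside \<open>[0, t + 1]\<close>.\<close>

lemma jointly_continuousI:
  fixes f :: "real \<Rightarrow> real \<Rightarrow> real"
  assumes cx: "\<And>t. 0 \<le> t \<Longrightarrow> continuous_on UNIV (f t)"
    and ct: "\<And>T \<epsilon>. 0 \<le> T \<Longrightarrow> 0 < \<epsilon> \<Longrightarrow>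
      \<exists>\<delta>>0. \<forall>s t x. 0 \<le> s \<longrightarrow> s \<le> T \<longrightarrow> 0 \<le> t \<longrightarrow> t \<le> T \<longrightarrow> \<bar>s - t\<bar> < \<delta> \<longrightarrow> \<bar>f s x - f t x\<bar> < \<epsilon>"
  shows "continuous_on ({0..} \<times> UNIV) (\<lambda>(t, x). f t x)"
  unfolding continuous_on_iff
proof (intro ballI allI impI)
  fix p :: "real \<times> real" and e :: real assume p: "p \<in> {0..} \<times> UNIV" and e: "0 < e"
  obtain t x where tx: "p = (t, x)" "0 \<le> t" using p by auto
  have "0 \<le> t + 1" "0 < e / 2" using tx e by auto
  from ct[OF this] obtain d1 where d1: "d1 > 0"
    "\<And>s r y. 0 \<le> s \<Longrightarrow> s \<le> t + 1 \<Longrightarrow> 0 \<le> r \<Longrightarrow> r \<le> t + 1 \<Longrightarrow> \<bar>s - r\<bar> < d1 \<Longrightarrow> \<bar>f s y - f r y\<bar> < e / 2"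
    by blast
  obtain d2 where d2: "d2 > 0" "\<And>y. dist y x < d2 \<Longrightarrow> dist (f t y) (f t x) < e / 2"
    using cx[OF tx(2)] e unfolding continuous_on_iff by (metis UNIV_I half_gt_zero)
  show "\<exists>d>0. \<forall>q\<in>{0..} \<times> UNIV. dist q p < d \<longrightarrow> dist (case q of (t, x) \<Rightarrow> f t x) (case p of (t, x) \<Rightarrow> f t x) < e"
  proof (intro exI[of _ "min 1 (min d1 d2)"] conjI ballI impI)
    fix q :: "real \<times> real" assume q: "q \<in> {0..} \<times> UNIV" and dq: "dist q p < min 1 (min d1 d2)"
    obtain s y where sy: "q = (s, y)" "0 \<le> s" using q by auto
    have "dist s t < min 1 (min d1 d2)" "dist y x < min 1 (min d1 d2)"
      using dq dist_fst_le[of q p] dist_snd_le[of q p] unfolding sy tx by auto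
    then have "\<bar>f s y - f t y\<bar> < e / 2" "dist (f t y) (f t x) < e / 2"
      using d1(2)[of s t y] d2(2)[of y] sy tx by (auto simp: dist_real_def)
    then have "dist (f s y) (f t x) < e" unfolding dist_real_def by linarith
    then show "dist (case q of (t, x) \<Rightarrow> f t x) (case p of (t, x) \<Rightarrow> f t x) < e" unfolding sy tx by simp
  qed (use d1 d2 in auto)
qed

lemma periodic_frac:
  fixes u :: "real \<Rightarrow> 'a"
  assumes "\<And>x. u (x + 1) = u x"
  shows "u x = u (frac x)"
  using periodic_int[of u "frac x" "\<lfloor>x\<rfloor>", OF assms] by (simp add: frac_def)

lemma lip_from_deriv:
  assumes d: "\<And>x. (f has_real_derivative f' x) (at x)" and B: "\<And>x. \<bar>f' x\<bar> \<le> B"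
  shows "lip B f"
  unfolding lip_def
proof (intro allI impI)
  fix x a :: real assume "0 \<le> a"
  show "\<bar>f (x + a) - f x\<bar> \<le> B * a"
  proof (cases "a = 0")
    case False
    then have "x < x + a" using \<open>0 \<le> a\<close> by simp
    then obtain z where "f (x + a) - f x = (x + a - x) * f' z" using MVT2[of x "x + a" f f'] d by blast
    then have "\<bar>f (x + a) - f x\<bar> = a * \<bar>f' z\<bar>" using \<open>0 \<le> a\<close> by (simp add: abs_mult)
    also have "\<dots> \<le> a * B" using B \<open>0 \<le> a\<close> by (intro mult_left_mono)
    finally show ?thesis by (simp add: mult.commute)
  qed simp
qed

text \<open>A Lipschitz derivative on the line may be unbounded; periodicity reduces its bound to
  the compact interval [0, 1]. The second-difference bound is the mean value estimate applied to
  \<open>y \<mapsto> f (y + b) - f y\<close>.\<close>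

lemma W2inf_Per_lip:
  assumes W: "W2inf f" and P: "f \<in> Per"
  shows "\<exists>Y. lip Y f" and "\<exists>P. lip2 P f"
proof -
  have d: "(f has_real_derivative deriv f x) (at x)" for x
    using W unfolding W2inf_def C1_def by (simp add: DERIV_deriv_iff_real_differentiable)
  have ds: "((\<lambda>y. f (y + b)) has_real_derivative deriv f (x + b)) (at x)" for x b
    using d[of "x + b"] by (rule DERIV_shift[THEN iffD1])
  have dp: "deriv f (x + 1) = deriv f x" for x
    using DERIV_unique[OF ds[of 1 x]] d[of x] Per_periodic[OF P] by simp
  have "continuous_on {0..1} (deriv f)" using W unfolding W2inf_def C1_def
    by (meson continuous_on_subset subset_UNIV)
  then have "bounded (deriv f ` {0..1})" by (intro compact_imp_bounded compact_continuous_image) auto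
  then obtain Y where "\<forall>y \<in> deriv f ` {0..1}. norm y \<le> Y" unfolding bounded_iff by blast
  then have Y: "\<bar>deriv f x\<bar> \<le> Y" if "x \<in> {0..1}" for x using that by auto
  have "\<bar>deriv f x\<bar> \<le> Y" for x
    using periodic_frac[of "deriv f" x, OF dp] Y[of "frac x"] frac_lt_1[of x] by (simp add: less_imp_le)
  then show "\<exists>Y. lip Y f" using lip_from_deriv[OF d] by blast
  obtain Q where Q: "\<And>x y. \<bar>deriv f x - deriv f y\<bar> \<le> Q * \<bar>x - y\<bar>" using W unfolding W2inf_def by blast
  have "lip2 Q f" unfolding lip2_def
  proof (intro allI impI)
    fix x a b :: real assume ab: "0 \<le> a" "0 \<le> b"
    have "lip (Q * b) (\<lambda>y. f (y + b) - f y)"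
      using Q[of "_ + b"] ab by (intro lip_from_deriv[OF DERIV_diff[OF ds d]]) (metis abs_of_nonneg add_diff_cancel_left')
    from lip_increment[OF this ab(1), of x]
    show "\<bar>f (x + a + b) - f (x + a) - f (x + b) + f x\<bar> \<le> Q * a * b" by (simp add: algebra_simps)
  qed
  then show "\<exists>P. lip2 P f" by blast
qed

section \<open>The iterates on dyadic step sizes and their uniform bounds\<close>

locale scheme = flux +
  fixes \<rho>0 :: "real \<Rightarrow> real" and m M Y0 P0 :: real
  assumes init_adm: "adm m M Y0 \<rho>0" and init_lip2: "lip2 P0 \<rho>0"
begin

text \<open>The prefactor yields \<open>ts k = (1 / 2) ^ k / (2 * (c * M + 1))\<close>, so the
  smallness condition of \<open>step_between\<close> holds for every \<open>k\<close>. Halving makes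
  the time grids nested and the refinement errors summable.\<close>

definition hs :: "nat \<Rightarrow> real" where "hs k = vmax / (c * M + 1) * (1 / 2) ^ k"

abbreviation ts :: "nat \<Rightarrow> real" where "ts k \<equiv> tau (hs k)"

definition U :: "nat \<Rightarrow> nat \<Rightarrow> real \<Rightarrow> real" where "U k n = (step (hs k) ^^ n) \<rho>0"

lemma cM: "0 \<le> c * M"
  using admD(4)[OF init_adm] const_nonneg by simp

lemma hs_pos: "0 < hs k" and ts_pos: "0 < ts k"
proof -
  show "0 < hs k" using cM vmax_pos unfolding hs_def by simp
  then show "0 < ts k" by (rule tau_pos)
qed

lemma ts_eq: "ts k = 1 / (2 * (c * M + 1)) * (1 / 2) ^ k"
  unfolding tau_def hs_def using vmax_pos by simp

lemma ts_small: "ts k * (c * M) \<le> 1 / 2"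
proof -
  have "ts k * (c * M) \<le> 1 / (2 * (c * M + 1)) * 1 * (c * M)"
    unfolding ts_eq using cM by (intro mult_right_mono mult_left_mono power_le_one) auto
  also have "\<dots> \<le> 1 / 2" using cM by (simp add: field_simps)
  finally show ?thesis .
qed

lemma hs_Suc: "hs (Suc k) = hs k / 2"
  unfolding hs_def by simp

lemma ts_Suc: "ts (Suc k) = ts k / 2"
  unfolding hs_Suc tau_def by simp

lemma hs_tendsto: "hs \<longlonglongrightarrow> 0"
  unfolding hs_def[abs_def] by (intro tendsto_mult_right_zero LIMSEQ_power_zero) simp

lemma ts_tendsto: "ts \<longlonglongrightarrow> 0"
  unfolding ts_eq by (intro tendsto_mult_right_zero LIMSEQ_power_zero) simp

lemma U_0: "U k 0 = \<rho>0" and U_Suc: "U k (Suc n) = step (hs k) (U k n)"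
  unfolding U_def by simp_all

text \<open>The majorant of \<open>gronwall_step\<close> for the rates of \<open>step_lip\<close>,
  started at \<open>Y0\<close>.\<close>

definition YT :: "real \<Rightarrow> real" where
  "YT t = (Y0 + M * \<gamma> M * t) * exp ((2 * (c * M) + M * C) * t)"

text \<open>The corresponding majorant for \<open>step_lip2\<close>, with the Lipschitz constant
  frozen at its final value \<open>YT T\<close>; the rates are then constant on [0, T].\<close>

definition PT :: "real \<Rightarrow> real" where
  "PT T = (P0 + (3 * YT T * (\<gamma> M + C * YT T) + M * W (M + YT T)) * T) * exp ((3 * (c * M) + M * C) * T)"

lemma init_nonneg: "0 < m" "0 < M" "0 \<le> Y0" "0 \<le> P0" "0 \<le> \<gamma> M" "0 \<le> M * \<gamma> M" "0 \<le> M * C" "0 \<le> \<Gamma> M"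
  using admD(2,4,7)[OF init_adm] lip2_nonneg[OF init_lip2] const_nonneg \<gamma>_nonneg[of M] \<Gamma>_nonneg[of M] by auto

lemma U_adm:
  assumes "real n * ts k \<le> T"
  shows "adm m M (YT T) (U k n)"
proof -
  have t: "0 < ts k" by (rule ts_pos)
  have T: "0 \<le> T" using assms t by (meson mult_nonneg_nonneg of_nat_0_le_iff less_imp_le order_trans)
  have "adm m M (YT (real n * ts k)) (U k n)" for n
  proof (induction n)
    case 0
    then show ?case using init_adm by (simp add: U_0 YT_def)
  next
    case (Suc n)
    let ?t = "real n * ts k"
    have "YT ?t + ts k * ((2 * (c * M) + M * C) * YT ?t + M * \<gamma> M) \<le> YT (?t + ts k)"
      using init_nonneg cM t unfolding YT_def by (intro gronwall_step) auto
    moreover have "?t + ts k = real (Suc n) * ts k" by (simp add: algebra_simps)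
    ultimately show ?case
      using adm_mono[OF step_adm[OF Suc.IH hs_pos ts_small]] init_nonneg(1) unfolding U_Suc by simp
  qed
  moreover have "YT (real n * ts k) \<le> YT T"
    unfolding YT_def using assms init_nonneg cM t T
    by (intro mult_mono add_mono) (auto intro!: mult_left_mono mult_nonneg_nonneg add_nonneg_nonneg)
  ultimately show ?thesis using adm_mono init_nonneg(1) by blast
qed

lemma U_lip2:
  assumes "real n * ts k \<le> T"
  shows "lip2 (PT T) (U k n)"
proof -
  have t: "0 < ts k" by (rule ts_pos)
  have T: "0 \<le> T" using assms t by (meson mult_nonneg_nonneg of_nat_0_le_iff less_imp_le order_trans)
  have Y: "0 \<le> YT T" unfolding YT_def using init_nonneg T by simp
  define A B where "A = 3 * (c * M) + M * C" and "B = 3 * YT T * (\<gamma> M + C * YT T) + M * W (M + YT T)"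
  have A: "0 \<le> A" and B: "0 \<le> B"
    unfolding A_def B_def using cM init_nonneg Y const_nonneg W_nonneg[of "M + YT T"] by auto
  have "lip2 ((P0 + B * (real n * ts k)) * exp (A * (real n * ts k))) (U k n)" if "real n * ts k \<le> T" for n
    using that
  proof (induction n)
    case 0
    then show ?case using init_lip2 by (simp add: U_0)
  next
    case (Suc n)
    let ?t = "real n * ts k"
    let ?P = "\<lambda>t. (P0 + B * t) * exp (A * t)"
    have nT: "?t \<le> T" using Suc.prems t by (simp add: algebra_simps)
    have "?P ?t + ts k * (A * ?P ?t + B) \<le> ?P (?t + ts k)"
      using init_nonneg A B t by (intro gronwall_step) auto
    moreover have "?t + ts k = real (Suc n) * ts k" by (simp add: algebra_simps)
    ultimately show ?case
      using lip2_mono[OF step_lip2[OF U_adm[OF nT] Suc.IH[OF nT] hs_pos]]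
      unfolding U_Suc A_def[symmetric] B_def[symmetric] by simp
  qed
  moreover have "(P0 + B * (real n * ts k)) * exp (A * (real n * ts k)) \<le> (P0 + B * T) * exp (A * T)"
    using assms init_nonneg t A B T
    by (intro mult_mono add_mono) (auto intro!: mult_left_mono mult_nonneg_nonneg add_nonneg_nonneg)
  ultimately show ?thesis using assms lip2_mono unfolding PT_def A_def[symmetric] B_def[symmetric] by blast
qed

text \<open>The bound of \<open>H_bound\<close> for the flux derivative along the iterates, hence a
  Lipschitz constant in time. \<open>AT\<close> below is the factor of the sup-norm distance in
  \<open>H_diff\<close>, which is also the Gronwall rate of stability.\<close>

definition gT :: "real \<Rightarrow> real" where "gT T = vmax * YT T + M * (c * M)"
definition AT :: "real \<Rightarrow> real" where "AT T = L * YT T + c * M + M * \<Gamma> M"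

lemma T_const_nonneg:
  assumes "0 \<le> T"
  shows "0 \<le> YT T" "0 \<le> PT T" "0 \<le> gT T" "0 \<le> AT T"
proof -
  have z: "real 0 * ts 0 \<le> T" using assms by simp
  show Y: "0 \<le> YT T" using admD(7)[OF U_adm[OF z]] .
  show "0 \<le> PT T" using lip2_nonneg[OF U_lip2[OF z]] .
  show "0 \<le> gT T" "0 \<le> AT T" unfolding gT_def AT_def using Y vmax_pos cM init_nonneg const_nonneg by auto
qed

lemma U_time:
  assumes "real (n + i) * ts k \<le> T"
  shows "\<bar>U k (n + i) x - U k n x\<bar> \<le> real i * (ts k * gT T)"
proof (rule increments_abs_le_bounded[of i "\<lambda>n. U k n x" n])
  fix l assume "l < i"
  then have "real (n + l) * ts k \<le> real (n + i) * ts k" using ts_pos[of k] by (intro mult_right_mono) auto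
  then have lT: "real (n + l) * ts k \<le> T" using assms by simp
  note a = U_adm[OF lT]
  have "\<bar>H (U k (n + l)) (bd (hs k) (U k (n + l)) x) x\<bar> \<le> gT T"
    unfolding gT_def by (rule H_bound[OF a bd_bound[OF admD(6)[OF a] hs_pos]])
  then have "\<bar>ts k * H (U k (n + l)) (bd (hs k) (U k (n + l)) x) x\<bar> \<le> ts k * gT T"
    using ts_pos[of k] by (intro abs_mult_le) auto
  then show "\<bar>U k (n + l + 1) x - U k (n + l) x\<bar> \<le> ts k * gT T"
    by (simp add: U_Suc step_def)
qed

text \<open>Two fine steps are one coarse step with a defect of order \<open>ts k * hs k\<close>.
  The even-numbered fine iterates can therefore play the part of \<open>w\<close> in
  \<open>scheme_comparison\<close>, and the accumulated error is of order
  \<open>hs k\<close>.\<close>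

lemma U_refine:
  assumes T: "0 \<le> T"
  shows "\<exists>B. \<forall>k n x. real n * ts k \<le> T \<longrightarrow> \<bar>U k n x - U (Suc k) (2 * n) x\<bar> \<le> B * (1 / 2) ^ k"
proof -
  define Z where "Z = vmax * PT T + c * M * YT T + (M * (\<gamma> M + C * YT T) + YT T * (c * M))"
  define Q where "Q = vmax * (2 * (PT T + PT T) + Z / (2 * vmax)) + gT T / (2 * vmax) * (L * YT T + c * M + M * \<Gamma> M)"
  have Z: "0 \<le> Z" unfolding Z_def
    using T_const_nonneg[OF T] vmax_pos cM init_nonneg const_nonneg by simp
  then have Q: "0 \<le> Q" unfolding Q_def
    using T_const_nonneg[OF T] vmax_pos cM init_nonneg const_nonneg by simp
  have "\<bar>U k n x - U (Suc k) (2 * n) x\<bar> \<le> hs k * Q * T * exp (AT T * T)" if n: "real n * ts k \<le> T" for k n x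
    unfolding AT_def
  proof (rule scheme_comparison[of "hs k" m T M "YT T" "U k" "\<lambda>n. U (Suc k) (2 * n)"])
    have tt: "real (2 * n) * ts (Suc k) = real n * ts k" for n unfolding ts_Suc by simp
    show "0 < hs k" by (rule hs_pos)
    show "0 < m" by (rule init_nonneg)
    show "adm m M (YT T) (U k n)" if "real n * ts k \<le> T" for n by (rule U_adm[OF that])
    show "\<exists>Y'. adm m M Y' (U (Suc k) (2 * n))" if "real n * ts k \<le> T" for n
      using U_adm[of "2 * n" "Suc k" T] that unfolding tt by blast
    show "U k (Suc n) = step (hs k) (U k n)" for n by (rule U_Suc)
    show "U k 0 = U (Suc k) (2 * 0)" by (simp add: U_0)
    show "0 \<le> hs k * Q" using Q hs_pos[of k] by simp
    show "real n * ts k \<le> T" by (rule n)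
    fix n x assume n: "real (Suc n) * ts k \<le> T"
    let ?w = "U (Suc k) (2 * n)"
    have "real (2 * n) * ts (Suc k) \<le> real (2 * n + 1) * ts (Suc k)"
      "real (2 * n + 1) * ts (Suc k) \<le> real (2 * n + 2) * ts (Suc k)"
      using ts_pos[of "Suc k"] by (auto intro!: mult_right_mono)
    moreover have "real (2 * n + 2) * ts (Suc k) \<le> T" using n tt[of "Suc n"] by simp
    ultimately have b: "real (2 * n) * ts (Suc k) \<le> T" "real (2 * n + 1) * ts (Suc k) \<le> T" by linarith+
    have s: "step (hs k / 2) ?w = U (Suc k) (2 * n + 1)" by (simp add: U_Suc hs_Suc)
    have "U (Suc k) (2 * Suc n) = step (hs k / 2) (step (hs k / 2) ?w)" by (simp add: U_Suc hs_Suc)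
    then show "\<bar>U (Suc k) (2 * Suc n) x - step (hs k) ?w x\<bar> \<le> ts k * (hs k * Q)"
      using half_step_consistency[OF U_adm[OF b(1)] U_lip2[OF b(1)] U_adm[OF b(2), folded s] hs_pos[of k], of x]
      unfolding Q_def Z_def gT_def by simp
  qed
  then have "\<forall>k n x. real n * ts k \<le> T \<longrightarrow>
      \<bar>U k n x - U (Suc k) (2 * n) x\<bar> \<le> (vmax / (c * M + 1) * Q * T * exp (AT T * T)) * (1 / 2) ^ k"
    unfolding hs_def by (simp add: ac_simps)
  then show ?thesis by blast
qed

section \<open>The limit of the iterates\<close>

definition nf :: "nat \<Rightarrow> real \<Rightarrow> nat" where "nf k t = nat \<lfloor>t / ts k\<rfloor>"

definition R :: "nat \<Rightarrow> real \<Rightarrow> real \<Rightarrow> real" where "R k t = U k (nf k t)"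

definition rho :: "real \<Rightarrow> real \<Rightarrow> real" where "rho t x = lim (\<lambda>k. R k t x)"

lemma nf_bounds:
  assumes "0 \<le> t"
  shows "real (nf k t) * ts k \<le> t" "t < real (nf k t) * ts k + ts k"
proof -
  have t: "0 < ts k" by (rule ts_pos)
  have "0 \<le> t / ts k" using assms t by simp
  then have "real (nf k t) \<le> t / ts k" "t / ts k < real (nf k t) + 1"
    unfolding nf_def by (auto simp: of_nat_nat)
  then show "real (nf k t) * ts k \<le> t" "t < real (nf k t) * ts k + ts k"
    using t by (auto simp: pos_le_divide_eq pos_divide_less_eq algebra_simps)
qed

lemma nf_grid: "nf k (real n * ts k) = n"
  using ts_pos[of k] unfolding nf_def by simp

lemma nf_Suc:
  assumes "0 \<le> t"
  shows "nf (Suc k) t = 2 * nf k t \<or> nf (Suc k) t = 2 * nf k t + 1"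
proof -
  have "t / ts (Suc k) = 2 * (t / ts k)" unfolding ts_Suc by simp
  moreover have "0 \<le> t / ts k" using assms ts_pos[of k] by simp
  ultimately show ?thesis unfolding nf_def by linarith
qed

lemma R_conv:
  assumes T: "0 \<le> T"
  shows "\<exists>B\<ge>0. \<forall>k t x. 0 \<le> t \<longrightarrow> t \<le> T \<longrightarrow> \<bar>R k t x - rho t x\<bar> \<le> B * (1 / 2) ^ k"
    and "0 \<le> t \<Longrightarrow> (\<lambda>k. R k t x) \<longlonglongrightarrow> rho t x"
proof -
  have inc: "\<exists>B. \<forall>k t x. 0 \<le> t \<longrightarrow> t \<le> T \<longrightarrow> \<bar>R (Suc k) t x - R k t x\<bar> \<le> B * (1 / 2) ^ k" if T: "0 \<le> T" for T
  proof -
    obtain B where B: "\<And>k n x. real n * ts k \<le> T \<Longrightarrow> \<bar>U k n x - U (Suc k) (2 * n) x\<bar> \<le> B * (1 / 2) ^ k"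
      using U_refine[OF T] by blast
    have "\<bar>R (Suc k) t x - R k t x\<bar> \<le> (B + 1 / (2 * (c * M + 1)) * gT T) * (1 / 2) ^ k"
      if t: "0 \<le> t" "t \<le> T" for k t x
    proof -
      let ?n = "nf k t" and ?n' = "nf (Suc k) t"
      have n: "real ?n * ts k \<le> T" "real ?n' * ts (Suc k) \<le> T"
        using nf_bounds[OF t(1), of k] nf_bounds[OF t(1), of "Suc k"] t by auto
      have "\<bar>U (Suc k) ?n' x - U (Suc k) (2 * ?n) x\<bar> \<le> ts k * gT T"
      proof (cases "?n' = 2 * ?n")
        case True
        then show ?thesis using ts_pos[of k] T_const_nonneg[OF T] by simp
      next
        case False
        \<comment> \<open>Halving the time step doubles the index up to rounding. The one extra fine
          step moves the iterate by at most \<open>ts (Suc k) * gT T\<close>, which is again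
          geometric in \<open>k\<close>.\<close>
        then have e: "?n' = 2 * ?n + 1" using nf_Suc[OF t(1)] by blast
        have "\<bar>U (Suc k) (2 * ?n + 1) x - U (Suc k) (2 * ?n) x\<bar> \<le> real 1 * (ts (Suc k) * gT T)"
          using n(2) unfolding e by (intro U_time) 
        also have "\<dots> \<le> ts k * gT T"
          using ts_pos[of k] T_const_nonneg[OF T] by (auto simp: ts_Suc intro!: mult_right_mono)
        finally show ?thesis unfolding e .
      qed
      then have "\<bar>R (Suc k) t x - R k t x\<bar> \<le> B * (1 / 2) ^ k + ts k * gT T"
        using B[OF n(1), of x] unfolding R_def by linarith
      then show ?thesis unfolding ts_eq by (simp add: algebra_simps)
    qed
    then show ?thesis by blast
  qed
  obtain B where B: "\<And>k t x. 0 \<le> t \<Longrightarrow> t \<le> T \<Longrightarrow> \<bar>R (Suc k) t x - R k t x\<bar> \<le> B * (1 / 2) ^ k"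
    using inc[OF T] by blast
  have "0 \<le> B" using B[of 0 0 0] T by (simp add: abs_le_iff)
  moreover have "\<bar>R k t x - rho t x\<bar> \<le> 2 * B * (1 / 2) ^ k" if "0 \<le> t" "t \<le> T" for k t x
    unfolding rho_def using B[OF that] by (rule geometric_increments_limit(2))
  ultimately show "\<exists>B\<ge>0. \<forall>k t x. 0 \<le> t \<longrightarrow> t \<le> T \<longrightarrow> \<bar>R k t x - rho t x\<bar> \<le> B * (1 / 2) ^ k"
    by (intro exI[of _ "2 * B"]) auto
  show "(\<lambda>k. R k t x) \<longlonglongrightarrow> rho t x" if t: "0 \<le> t"
  proof -
    obtain B where B: "\<And>k x. \<bar>R (Suc k) t x - R k t x\<bar> \<le> B * (1 / 2) ^ k"
      using inc[OF t] t by blast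
    show ?thesis unfolding rho_def by (rule geometric_increments_limit(1)[OF B])
  qed
qed

lemma R_lim: "0 \<le> t \<Longrightarrow> (\<lambda>k. R k t x) \<longlonglongrightarrow> rho t x"
  using R_conv(2)[of 0] by simp

lemma R_adm: "0 \<le> t \<Longrightarrow> t \<le> T \<Longrightarrow> adm m M (YT T) (R k t)"
  unfolding R_def using nf_bounds(1)[of t k] by (intro U_adm) simp

lemma R_lip2: "0 \<le> t \<Longrightarrow> t \<le> T \<Longrightarrow> lip2 (PT T) (R k t)"
  unfolding R_def using nf_bounds(1)[of t k] by (intro U_lip2) simp

lemma rho_adm:
  assumes t: "0 \<le> t" "t \<le> T"
  shows "adm m M (YT T) (rho t)"
proof (rule admI)
  note l = R_lim[OF t(1)] and a = admD[OF R_adm[OF t]]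
  show "0 < m" by (rule init_nonneg)
  show "between m M (rho t)" unfolding between_def
    using LIMSEQ_le_const[OF l] LIMSEQ_le_const2[OF l] a(8,9) by blast
  show "lip (YT T) (rho t)" unfolding lip_def
  proof (intro allI impI)
    fix x b :: real assume b: "0 \<le> b"
    show "\<bar>rho t (x + b) - rho t x\<bar> \<le> YT T * b"
    proof (rule LIMSEQ_le_const2)
      show "(\<lambda>k. \<bar>R k t (x + b) - R k t x\<bar>) \<longlonglongrightarrow> \<bar>rho t (x + b) - rho t x\<bar>" by (intro tendsto_intros l)
    qed (use lip_increment[OF a(6) b] in blast)
  qed
  show "rho t (x + 1) = rho t x" for x using admD(11)[OF R_adm[OF t]] unfolding rho_def by simp
qed

lemma rho_lip2:
  assumes t: "0 \<le> t" "t \<le> T"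
  shows "lip2 (PT T) (rho t)"
  unfolding lip2_def
proof (intro allI impI)
  note l = R_lim[OF t(1)]
  fix x a b :: real assume ab: "0 \<le> a" "0 \<le> b"
  show "\<bar>rho t (x + a + b) - rho t (x + a) - rho t (x + b) + rho t x\<bar> \<le> PT T * a * b"
  proof (rule LIMSEQ_le_const2)
    show "(\<lambda>k. \<bar>R k t (x + a + b) - R k t (x + a) - R k t (x + b) + R k t x\<bar>)
        \<longlonglongrightarrow> \<bar>rho t (x + a + b) - rho t (x + a) - rho t (x + b) + rho t x\<bar>"
      by (intro tendsto_rabs tendsto_add tendsto_diff l)
  qed (use lip2_increment[OF R_lip2[OF t] ab] in blast)
qed

lemma nf_tendsto:
  assumes "0 \<le> t"
  shows "(\<lambda>k. real (nf k t) * ts k) \<longlonglongrightarrow> t"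
proof (rule real_tendsto_sandwich)
  show "\<forall>\<^sub>F k in sequentially. t - ts k \<le> real (nf k t) * ts k" using nf_bounds(2)[OF assms]
    by (auto intro!: always_eventually less_imp_le simp: algebra_simps)
  show "\<forall>\<^sub>F k in sequentially. real (nf k t) * ts k \<le> t" using nf_bounds(1)[OF assms]
    by (auto intro!: always_eventually)
  show "(\<lambda>k. t - ts k) \<longlonglongrightarrow> t" using tendsto_diff[OF tendsto_const ts_tendsto, of t] by simp
qed simp

lemma nf_mono: "s \<le> t \<Longrightarrow> nf k s \<le> nf k t"
  unfolding nf_def using ts_pos[of k] by (intro nat_mono floor_mono divide_right_mono) auto

lemma rho_time:
  assumes st: "0 \<le> s" "s \<le> t" "t \<le> T"
  shows "\<bar>rho t x - rho s x\<bar> \<le> (t - s) * gT T"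
proof (rule LIMSEQ_le)
  have t: "0 \<le> t" using st by simp
  show "(\<lambda>k. \<bar>R k t x - R k s x\<bar>) \<longlonglongrightarrow> \<bar>rho t x - rho s x\<bar>"
    by (intro tendsto_intros R_lim t st)
  show "(\<lambda>k. (real (nf k t) * ts k - real (nf k s) * ts k) * gT T) \<longlonglongrightarrow> (t - s) * gT T"
    by (intro tendsto_intros nf_tendsto t st)
  show "\<exists>N. \<forall>k\<ge>N. \<bar>R k t x - R k s x\<bar> \<le> (real (nf k t) * ts k - real (nf k s) * ts k) * gT T"
  proof (intro exI[of _ 0] allI impI)
    fix k :: nat
    define i where "i = nf k t - nf k s"
    have i: "nf k t = nf k s + i" using nf_mono[OF st(2), of k] unfolding i_def by simp
    have "\<bar>U k (nf k s + i) x - U k (nf k s) x\<bar> \<le> real i * (ts k * gT T)"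
      using nf_bounds(1)[OF t, of k] st by (intro U_time) (simp add: i)
    then show "\<bar>R k t x - R k s x\<bar> \<le> (real (nf k t) * ts k - real (nf k s) * ts k) * gT T"
      unfolding R_def i by (simp add: algebra_simps)
  qed
qed

lemma rho_time':
  assumes "0 \<le> s" "s \<le> T" "0 \<le> t" "t \<le> T"
  shows "\<bar>rho s x - rho t x\<bar> \<le> gT T * \<bar>s - t\<bar>"
  using rho_time[of s t T x] rho_time[of t s T x] assms
  by (cases "s \<le> t") (auto simp: abs_minus_commute mult.commute)

section \<open>The slope and flux of the limit, and the equation\<close>

definition rx :: "real \<Rightarrow> real \<Rightarrow> real" where "rx t = deriv (rho t)"

definition Hd :: "real \<Rightarrow> real \<Rightarrow> real" where "Hd t x = H (rho t) (rx t x) x"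

lemma rx_deriv: "0 \<le> t \<Longrightarrow> (rho t has_real_derivative rx t x) (at x)"
  unfolding rx_def using admD(6)[OF rho_adm[of t t]] rho_lip2[of t t] by (intro lip2_differentiable(1)) auto

lemma rx_lip: "0 \<le> t \<Longrightarrow> t \<le> T \<Longrightarrow> lip (PT T) (rx t)"
  unfolding rx_def using admD(6)[OF rho_adm] rho_lip2 by (intro lip2_differentiable(3)) auto

lemma rx_bound:
  assumes "0 \<le> t" "t \<le> T"
  shows "\<bar>rx t x\<bar> \<le> YT T"
  using lip_increment[OF admD(6)[OF rho_adm[OF assms]], of _ x]
  by (intro abs_deriv_le_from_increments[OF rx_deriv[OF assms(1)]]) (auto simp: mult.commute)

text \<open>In time the sup norm is Lipschitz with constant \<open>gT T\<close>, and second
  differences are bounded by \<open>PT T\<close>. Interpolating between the two makes the slope, and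
  with it the flux, continuous in time uniformly in space, with a modulus of square-root
  type.\<close>

lemma rho_modulus:
  assumes T: "0 \<le> T" and \<epsilon>: "0 < \<epsilon>"
  shows "\<exists>\<delta>>0. \<forall>s t x. 0 \<le> s \<longrightarrow> s \<le> T \<longrightarrow> 0 \<le> t \<longrightarrow> t \<le> T \<longrightarrow> \<bar>s - t\<bar> < \<delta> \<longrightarrow>
    \<bar>rho s x - rho t x\<bar> < \<epsilon> \<and> \<bar>rx s x - rx t x\<bar> < \<epsilon> \<and> \<bar>Hd s x - Hd t x\<bar> < \<epsilon>"
proof -
  \<comment> \<open>This is \<open>bd_approximates_deriv\<close> with
    \<open>h = \<eta> = sqrt \<delta>\<close> and \<open>E = gT T * \<delta>\<close>: 2 + 4 from
    that lemma and 2 more for replacing the quotient by the slope itself give 8.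
    \<open>\<Psi>\<close> adds the three bounds, so that a single \<open>\<delta>\<close> serves for
    all of them.\<close>
  define \<Phi> where "\<Phi> = (\<lambda>\<delta>. (8 * PT T + 2 * gT T) * sqrt \<delta>)"
  define \<Psi> where "\<Psi> = (\<lambda>\<delta>. gT T * \<delta> + \<Phi> \<delta> + (vmax * \<Phi> \<delta> + gT T * \<delta> * AT T))"
  note nn = T_const_nonneg[OF T]
  have "(\<Psi> \<longlongrightarrow> \<Psi> 0) (at_right 0)"
    unfolding \<Psi>_def \<Phi>_def by (intro tendsto_intros)
  moreover have "\<Psi> 0 = 0" unfolding \<Psi>_def \<Phi>_def by simp
  ultimately have "eventually (\<lambda>\<delta>. \<Psi> \<delta> < \<epsilon>) (at_right 0)" using \<epsilon> order_tendstoD(2) by metis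
  then have "eventually (\<lambda>\<delta>. \<Psi> \<delta> < \<epsilon> \<and> 0 < \<delta>) (at_right 0)"
    using eventually_at_right_less[of "0::real"] by eventually_elim auto
  then obtain \<delta> where \<delta>: "\<Psi> \<delta> < \<epsilon>" "0 < \<delta>" using eventually_happens'[OF trivial_limit_at_right_real] by blast
  have \<Phi>: "0 \<le> \<Phi> \<delta>" unfolding \<Phi>_def using nn \<delta> by simp
  show ?thesis
  proof (intro exI[of _ \<delta>] conjI allI impI \<delta>(2))
    fix s t x assume s: "0 \<le> s" "s \<le> T" and t: "0 \<le> t" "t \<le> T" and st: "\<bar>s - t\<bar> < \<delta>"
    have E: "\<bar>rho s x - rho t x\<bar> \<le> gT T * \<delta>" for x
    proof -
      have "gT T * \<bar>s - t\<bar> \<le> gT T * \<delta>" using st nn by (intro mult_left_mono) auto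
      then show ?thesis using rho_time'[OF s t, of x] by linarith
    qed
    have q: "0 < sqrt \<delta>" using \<delta> by simp
    note ls = admD(6)[OF rho_adm[OF s]] and lt = admD(6)[OF rho_adm[OF t]]
    have "\<bar>rx s x - rx t x\<bar> \<le> \<Phi> \<delta>"
    proof -
      have "gT T * \<delta> / sqrt \<delta> = gT T * sqrt \<delta>" using real_div_sqrt[of \<delta>] \<delta>(2) by (metis less_imp_le times_divide_eq_right)
      then have "\<bar>bd (sqrt \<delta>) (rho s) x - rx t x\<bar> \<le> 2 * PT T * sqrt \<delta> + 4 * PT T * sqrt \<delta> + 2 * (gT T * sqrt \<delta>)"
        using bd_approximates_deriv[OF ls rho_lip2[OF s] lt rho_lip2[OF t] E q q, of x] unfolding rx_def by simp
      moreover have "\<bar>bd (sqrt \<delta>) (rho s) x - rx s x\<bar> \<le> 2 * PT T * sqrt \<delta>"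
        unfolding rx_def by (rule lip2_differentiable(2)[OF ls rho_lip2[OF s] q])
      ultimately show ?thesis unfolding \<Phi>_def distrib_right by linarith
    qed
    moreover from this have "vmax * \<bar>rx s x - rx t x\<bar> \<le> vmax * \<Phi> \<delta>" using vmax_pos by (intro mult_left_mono) auto
    then have "\<bar>Hd s x - Hd t x\<bar> \<le> vmax * \<Phi> \<delta> + gT T * \<delta> * AT T"
      using H_diff[OF rho_adm[OF s] rho_adm[OF t] E rx_bound[OF s], of x x "rx t x"]
      unfolding Hd_def AT_def by linarith
    moreover have "0 \<le> vmax * \<Phi> \<delta> + gT T * \<delta> * AT T" "0 \<le> gT T * \<delta>" using \<Phi> nn vmax_pos \<delta> by auto
    ultimately show "\<bar>rho s x - rho t x\<bar> < \<epsilon>" "\<bar>rx s x - rx t x\<bar> < \<epsilon>" "\<bar>Hd s x - Hd t x\<bar> < \<epsilon>"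
      using E[of x] \<delta>(1) \<Phi> unfolding \<Psi>_def by linarith+
  qed
qed

lemma Hd_continuous_space:
  assumes "0 \<le> t"
  shows "continuous_on UNIV (Hd t)"
proof -
  note a = rho_adm[OF assms order_refl]
  show ?thesis unfolding Hd_def[abs_def] H_def
    by (intro continuous_intros lip_continuous[OF K_lip[OF a]] lip_continuous[OF dK_lip[OF a]]
        lip_continuous[OF admD(6)[OF a]] lip_continuous[OF rx_lip[OF assms order_refl]])
qed

text \<open>The iterates are within \<open>B * (1 / 2) ^ k\<close> of the limit, so the auxiliary
  step \<open>sqrt ((1 / 2) ^ k)\<close> makes the slopes converge as well. The error
  \<open>r k\<close> is uniform over all grid times up to \<open>T\<close>.\<close>

lemma flux_conv:
  assumes T: "0 \<le> T"
  shows "\<exists>r. r \<longlonglongrightarrow> 0 \<and> (\<forall>k j x. real j * ts k \<le> T \<longrightarrow>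
    \<bar>H (U k j) (bd (hs k) (U k j) x) x - Hd (real j * ts k) x\<bar> \<le> r k)"
proof -
  obtain B where B: "0 \<le> B" "\<And>k t x. 0 \<le> t \<Longrightarrow> t \<le> T \<Longrightarrow> \<bar>R k t x - rho t x\<bar> \<le> B * (1 / 2) ^ k"
    using R_conv(1)[OF T] by blast
  define r where "r = (\<lambda>k. vmax * (2 * PT T * hs k + (4 * PT T + 2 * B) * sqrt ((1 / 2) ^ k)) + B * (1 / 2) ^ k * AT T)"
  have p: "(\<lambda>k. (1 / 2 :: real) ^ k) \<longlonglongrightarrow> 0" by (rule LIMSEQ_power_zero) simp
  have "r \<longlonglongrightarrow> vmax * (2 * PT T * 0 + (4 * PT T + 2 * B) * sqrt 0) + B * 0 * AT T"
    unfolding r_def by (intro tendsto_intros hs_tendsto p)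
  then have "r \<longlonglongrightarrow> 0" by simp
  moreover have "\<bar>H (U k j) (bd (hs k) (U k j) x) x - Hd (real j * ts k) x\<bar> \<le> r k" if j: "real j * ts k \<le> T" for k j x
  proof -
    let ?t = "real j * ts k" and ?q = "sqrt ((1 / 2) ^ k)"
    have t: "0 \<le> ?t" using ts_pos[of k] by simp
    have E: "\<bar>U k j x - rho ?t x\<bar> \<le> B * (1 / 2) ^ k" for x
      using B(2)[OF t j, of k x] unfolding R_def nf_grid .
    note ua = U_adm[OF j] and ra = rho_adm[OF t j]
    have q: "0 < ?q" by simp
    have "B * (1 / 2) ^ k / ?q = B * ?q" by (metis real_div_sqrt times_divide_eq_right zero_le_divide_1_iff zero_le_numeral zero_le_power)
    then have "\<bar>bd (hs k) (U k j) x - rx ?t x\<bar> \<le> 2 * PT T * hs k + 4 * PT T * ?q + 2 * (B * ?q)"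
      using bd_approximates_deriv[OF admD(6)[OF ua] U_lip2[OF j] admD(6)[OF ra] rho_lip2[OF t j] E hs_pos q, of k x]
      unfolding rx_def by simp
    then have "\<bar>bd (hs k) (U k j) x - rx ?t x\<bar> \<le> 2 * PT T * hs k + (4 * PT T + 2 * B) * ?q"
      unfolding distrib_right by simp
    then have "vmax * \<bar>bd (hs k) (U k j) x - rx ?t x\<bar> \<le> vmax * (2 * PT T * hs k + (4 * PT T + 2 * B) * ?q)"
      using vmax_pos by (intro mult_left_mono) auto
    then show ?thesis
      using H_diff[OF ua ra E bd_bound[OF admD(6)[OF ua] hs_pos[of k], of x], of x "rx ?t x"]
      unfolding Hd_def r_def AT_def by linarith
  qed
  ultimately show ?thesis by blast
qed

text \<open>A mean value estimate obtained by summing the steps of the scheme, with no integral. The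
  margin \<open>d\<close> is there because the grid time belonging to \<open>s1\<close> may lie
  below \<open>s1\<close> by almost \<open>ts k\<close>.\<close>

lemma rho_increment:
  assumes s: "0 \<le> s1" "s1 \<le> s2" and d: "0 < d"
    and near: "\<And>r. 0 \<le> r \<Longrightarrow> s1 - d \<le> r \<Longrightarrow> r \<le> s2 \<Longrightarrow> \<bar>Hd r x - v\<bar> \<le> e"
  shows "\<bar>(rho s2 x - rho s1 x) + (s2 - s1) * v\<bar> \<le> (s2 - s1) * e"
proof -
  have s2: "0 \<le> s2" using s by simp
  obtain r where r: "r \<longlonglongrightarrow> 0" "\<And>k j x. real j * ts k \<le> s2 \<Longrightarrow>
    \<bar>H (U k j) (bd (hs k) (U k j) x) x - Hd (real j * ts k) x\<bar> \<le> r k"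
    using flux_conv[OF s2] by blast
  let ?z = "\<lambda>k. real (nf k s2) * ts k - real (nf k s1) * ts k"
  have z: "?z \<longlonglongrightarrow> s2 - s1" by (intro tendsto_intros nf_tendsto s s2)
  have "\<bar>(rho s2 x - rho s1 x) + (s2 - s1) * v\<bar> \<le> (s2 - s1) * (0 + e)"
  proof (rule LIMSEQ_le)
    show "(\<lambda>k. \<bar>(R k s2 x - R k s1 x) + ?z k * v\<bar>) \<longlonglongrightarrow> \<bar>(rho s2 x - rho s1 x) + (s2 - s1) * v\<bar>"
      by (intro tendsto_rabs tendsto_add[OF tendsto_diff tendsto_mult[OF z tendsto_const]] R_lim s s2)
    show "(\<lambda>k. ?z k * (r k + e)) \<longlonglongrightarrow> (s2 - s1) * (0 + e)"
      by (intro tendsto_mult z tendsto_add r tendsto_const)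
    have "eventually (\<lambda>k. ts k < d) sequentially" using order_tendstoD(2)[OF ts_tendsto d] .
    then have "eventually (\<lambda>k. \<bar>(R k s2 x - R k s1 x) + ?z k * v\<bar> \<le> ?z k * (r k + e)) sequentially"
    proof eventually_elim
      case (elim k)
      let ?n = "nf k s1"
      define i where "i = nf k s2 - ?n"
      have i: "nf k s2 = ?n + i" using nf_mono[OF s(2), of k] unfolding i_def by simp
      have zk: "?z k = real i * ts k" unfolding i by (simp add: algebra_simps)
      \<comment> \<open>Adding \<open>v\<close> times the elapsed time makes each increment of
        \<open>f\<close> equal to \<open>- ts k\<close> times the deviation of the discrete flux
        from \<open>v\<close>.\<close>
      define f where "f = (\<lambda>n. U k n x + real n * (ts k * v))"
      have "\<bar>f (?n + i) - f ?n\<bar> \<le> real i * (ts k * (r k + e))"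
      proof (rule increments_abs_le_bounded)
        fix l assume "l < i"
        let ?j = "?n + l"
        have "real ?j * ts k \<le> real (nf k s2) * ts k" "real ?n * ts k \<le> real ?j * ts k"
          using \<open>l < i\<close> ts_pos[of k] by (auto simp: i intro!: mult_right_mono)
        then have j: "real ?j * ts k \<le> s2" "s1 - d \<le> real ?j * ts k"
          using nf_bounds(1)[OF s2, of k] nf_bounds(2)[OF s(1), of k] elim by linarith+
        have "\<bar>Hd (real ?j * ts k) x - v\<bar> \<le> e" using j ts_pos[of k] by (intro near) auto
        then have "\<bar>H (U k ?j) (bd (hs k) (U k ?j) x) x - v\<bar> \<le> r k + e"
          using r(2)[OF j(1), of x] by linarith
        then have "\<bar>ts k * (H (U k ?j) (bd (hs k) (U k ?j) x) x - v)\<bar> \<le> ts k * (r k + e)"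
          using ts_pos[of k] by (intro abs_mult_le) auto
        moreover have "f (?j + 1) - f ?j = - (ts k * (H (U k ?j) (bd (hs k) (U k ?j) x) x - v))"
          unfolding f_def by (simp add: U_Suc step_def algebra_simps)
        ultimately show "\<bar>f (?j + 1) - f ?j\<bar> \<le> ts k * (r k + e)" by simp
      qed
      moreover have "f (?n + i) - f ?n = (R k s2 x - R k s1 x) + ?z k * v"
        unfolding f_def R_def zk i by (simp add: algebra_simps)
      ultimately show ?case unfolding zk by (simp add: mult.assoc)
    qed
    then show "\<exists>N. \<forall>k\<ge>N. \<bar>(R k s2 x - R k s1 x) + ?z k * v\<bar> \<le> ?z k * (r k + e)"
      by (simp add: eventually_sequentially)
  qed
  then show ?thesis by simp
qed

lemma rho_time_deriv:
  assumes t: "0 \<le> t"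
  shows "((\<lambda>s. rho s x) has_real_derivative - Hd t x) (at t within {0..})"
  unfolding has_field_derivative_iff
proof (rule Lim_withinI)
  fix e :: real assume e: "0 < e"
  have "0 \<le> t + 1" using t by simp
  from rho_modulus[OF this e] obtain \<delta> where \<delta>: "\<delta> > 0"
    "\<And>s. 0 \<le> s \<Longrightarrow> s \<le> t + 1 \<Longrightarrow> \<bar>s - t\<bar> < \<delta> \<Longrightarrow> \<bar>Hd s x - Hd t x\<bar> < e"
    using t by force
  \<comment> \<open>The bound 1 keeps \<open>y\<close> below \<open>t + 1\<close>. Taking
    \<open>\<delta> / 2\<close> leaves room for the margin \<open>\<delta> / 2\<close> of
    \<open>rho_increment\<close> within distance \<open>\<delta>\<close> of \<open>t\<close>;
    \<open>min\<close> and \<open>max\<close> treat both sides of \<open>t\<close> at once.\<close>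
  show "\<exists>d>0. \<forall>y\<in>{0..}. 0 < dist y t \<and> dist y t < d \<longrightarrow> dist ((rho y x - rho t x) / (y - t)) (- Hd t x) \<le> e"
  proof (intro exI[of _ "min 1 (\<delta> / 2)"] conjI ballI impI)
    fix y assume y: "y \<in> {0..}" and d: "0 < dist y t \<and> dist y t < min 1 (\<delta> / 2)"
    have near: "\<bar>Hd r x - Hd t x\<bar> \<le> e" if "0 \<le> r" "min y t - \<delta> / 2 \<le> r" "r \<le> max y t" for r
    proof -
      have "\<bar>r - t\<bar> < \<delta>" "r \<le> t + 1" using that d \<delta>(1) by (auto simp: dist_real_def min_def max_def split: if_splits)
      then show ?thesis using \<delta>(2)[of r] that by simp
    qed
    have "\<bar>rho (max y t) x - rho (min y t) x + (max y t - min y t) * Hd t x\<bar> \<le> (max y t - min y t) * e"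
      using y t \<delta>(1) near by (intro rho_increment[of _ _ "\<delta> / 2"]) auto
    then have "\<bar>rho y x - rho t x + (y - t) * Hd t x\<bar> \<le> \<bar>y - t\<bar> * e"
      by (cases "y \<le> t") (auto simp: max_def min_def abs_le_iff algebra_simps)
    moreover have "y - t \<noteq> 0" using d by auto
    moreover have "(rho y x - rho t x) / (y - t) - - Hd t x = (rho y x - rho t x + (y - t) * Hd t x) / (y - t)"
      using calculation(2) by (simp add: field_simps)
    ultimately show "dist ((rho y x - rho t x) / (y - t)) (- Hd t x) \<le> e"
      by (simp add: dist_real_def abs_divide pos_divide_le_eq mult.commute)
  qed (use \<delta> in auto)
qed

lemma deriv_flux:
  assumes "(u has_real_derivative p) (at x)" "u \<in> Per"
  shows "deriv (\<lambda>y. u y * K u y) x = H u p x"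
  using DERIV_imp_deriv[OF DERIV_mult[OF assms(1) K_has_deriv[OF assms(2)]]] unfolding H_def
  by (simp add: mult.commute)

lemma rho_0: "rho 0 = \<rho>0"
  unfolding rho_def R_def nf_def by (simp add: U_0)

theorem rho_solution: "is_solution K \<rho>0 rho"
  unfolding is_solution_def
proof (intro conjI allI impI)
  show "rho 0 = \<rho>0" by (rule rho_0)
  show Per: "rho t \<in> Per" if "0 \<le> t" for t using admD(1)[OF rho_adm[OF that order_refl]] .
  show "W2inf (rho t)" if t: "0 \<le> t" for t
    unfolding W2inf_def C1_def
  proof (intro conjI allI)
    show "rho t differentiable at x" for x
      using rx_deriv[OF t] real_differentiable_def by blast
    show "continuous_on UNIV (deriv (rho t))" using lip_continuous[OF rx_lip[OF t order_refl]] unfolding rx_def .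
    show "\<exists>M. \<forall>x y. \<bar>deriv (rho t) x - deriv (rho t) y\<bar> \<le> M * \<bar>x - y\<bar>"
      using lipD[OF rx_lip[OF t order_refl]] unfolding rx_def by blast
  qed
  show "((\<lambda>s. rho s x) has_real_derivative - deriv (\<lambda>y. rho t y * K (rho t) y) x) (at t within {0..})"
    if t: "0 \<le> t" for t x
    unfolding deriv_flux[OF rx_deriv[OF t] Per[OF t]] using rho_time_deriv[OF t] unfolding Hd_def .
  show "C1_half rho"
    unfolding C1_half_def
  proof (rule exI[of _ "\<lambda>t x. - Hd t x"], rule exI[of _ rx], intro conjI allI impI)
    show "((\<lambda>s. rho s x) has_real_derivative - Hd t x) (at t within {0..})" if "0 \<le> t" for t x
      by (rule rho_time_deriv[OF that])
    show "((\<lambda>y. rho t y) has_real_derivative rx t x) (at x)" if "0 \<le> t" for t x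
      by (rule rx_deriv[OF that])
    show "continuous_on ({0..} \<times> UNIV) (\<lambda>(t, x). rho t x)"
      using rho_modulus by (intro jointly_continuousI lip_continuous[OF admD(6)[OF rho_adm[OF _ order_refl]]]) meson+
    show "continuous_on ({0..} \<times> UNIV) (\<lambda>(t, x). rx t x)"
      using rho_modulus by (intro jointly_continuousI lip_continuous[OF rx_lip[OF _ order_refl]]) meson+
    have "continuous_on ({0..} \<times> UNIV) (\<lambda>(t, x). Hd t x)"
      using rho_modulus by (intro jointly_continuousI Hd_continuous_space) meson+
    then show "continuous_on ({0..} \<times> UNIV) (\<lambda>(t, x). - Hd t x)"
      using continuous_on_minus[of "{0..} \<times> UNIV" "\<lambda>(t, x). Hd t x"] by (simp add: case_prod_unfold)
  qed
qed

end


section \<open>Uniqueness\<close>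

context scheme
begin

text \<open>Second differences of \<open>\<sigma>\<close> are not controlled uniformly in time.
  Consistency is instead drawn from uniform continuity of its two derivatives on a compact set: the
  defect per step is \<open>ts k\<close> times an arbitrarily small number, which
  \<open>scheme_comparison\<close> accepts.\<close>

theorem rho_unique:
  assumes sol: "is_solution K \<rho>0 \<sigma>" and T: "0 \<le> T"
  shows "\<sigma> T x = rho T x"
proof -
  have "C1_half \<sigma>" using sol unfolding is_solution_def by blast
  then obtain \<sigma>t \<sigma>x where
    dt: "\<And>t x. 0 \<le> t \<Longrightarrow> ((\<lambda>s. \<sigma> s x) has_real_derivative \<sigma>t t x) (at t within {0..})"
    and dx: "\<And>t x. 0 \<le> t \<Longrightarrow> (\<sigma> t has_real_derivative \<sigma>x t x) (at x)"
    and c0: "continuous_on ({0..} \<times> UNIV) (\<lambda>(t, x). \<sigma> t x)"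
    and ct: "continuous_on ({0..} \<times> UNIV) (\<lambda>(t, x). \<sigma>t t x)"
    and cx: "continuous_on ({0..} \<times> UNIV) (\<lambda>(t, x). \<sigma>x t x)"
    unfolding C1_half_def by blast
  have W: "W2inf (\<sigma> t)" "\<sigma> t \<in> Per" if "0 \<le> t" for t
    using sol that unfolding is_solution_def by blast+
  have init: "\<sigma> 0 = \<rho>0" using sol unfolding is_solution_def by blast
  have eq: "\<sigma>t t x = - H (\<sigma> t) (\<sigma>x t x) x" if t: "0 \<le> t" for t x
  proof (rule has_field_derivative_unique[OF dt[OF t]])
    have "((\<lambda>s. \<sigma> s x) has_real_derivative - deriv (\<lambda>y. \<sigma> t y * K (\<sigma> t) y) x) (at t within {0..})"
      using sol t unfolding is_solution_def by blast
    then show "((\<lambda>s. \<sigma> s x) has_real_derivative - H (\<sigma> t) (\<sigma>x t x) x) (at t within {0..})"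
      unfolding deriv_flux[OF dx[OF t] W(2)[OF t]] .
    \<comment> \<open>The derivative within \<open>{0..}\<close> is unique also at
      \<open>t = 0\<close>, because the right-hand neighbourhoods alone form a nontrivial
      filter.\<close>
    have "at_right t \<le> at t within {0..}" using t by (intro at_le) auto
    then show "at t within {0..} \<noteq> bot" by (metis bot.extremum_uniqueI trivial_limit_at_right_real)
  qed
  have K0: "compact ({0..T} \<times> {0..1::real})" by (intro compact_Times) auto
  have ne: "{0..T} \<times> {0..1::real} \<noteq> {}" using T by auto
  have c0': "continuous_on ({0..T} \<times> {0..1}) (\<lambda>(t, x). \<sigma> t x)"
    by (rule continuous_on_subset[OF c0]) auto
  from continuous_attains_inf[OF K0 ne c0'] obtain t1 x1 where
    p1: "0 \<le> t1" "\<And>s y. 0 \<le> s \<Longrightarrow> s \<le> T \<Longrightarrow> 0 \<le> y \<Longrightarrow> y \<le> 1 \<Longrightarrow> \<sigma> t1 x1 \<le> \<sigma> s y" by fastforce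
  from continuous_attains_sup[OF K0 ne c0'] obtain t2 x2 where
    p2: "\<And>s y. 0 \<le> s \<Longrightarrow> s \<le> T \<Longrightarrow> 0 \<le> y \<Longrightarrow> y \<le> 1 \<Longrightarrow> \<sigma> s y \<le> \<sigma> t2 x2" by fastforce
  \<comment> \<open>The maximum principle is not known for \<open>\<sigma>\<close>, so the range is
    widened to contain the values of both \<open>\<sigma>\<close> and the iterates. The iterates
    keep their constant \<open>YT T\<close>.\<close>
  define m' M' where "m' = min m (\<sigma> t1 x1)" and "M' = max M (\<sigma> t2 x2)"
  have m': "0 < m'" unfolding m'_def using init_nonneg W(2)[OF p1(1)] unfolding Per_def by auto
  have adm\<sigma>: "\<exists>Y'. adm m' M' Y' (\<sigma> s)" if s: "0 \<le> s" "s \<le> T" for s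
  proof -
    obtain Y' where Y': "lip Y' (\<sigma> s)" using W2inf_Per_lip(1)[OF W[OF s(1)]] by blast
    note per = Per_periodic[OF W(2)[OF s(1)]]
    have "\<sigma> t1 x1 \<le> \<sigma> s y \<and> \<sigma> s y \<le> \<sigma> t2 x2" for y
      using periodic_frac[of "\<sigma> s" y, OF per] p1(2)[OF s, of "frac y"] p2[OF s, of "frac y"] frac_lt_1[of y]
      by (simp add: less_imp_le)
    then have "between m' M' (\<sigma> s)" unfolding between_def m'_def M'_def by (auto simp: min_le_iff_disj le_max_iff_disj)
    then show ?thesis using admI[OF m' _ Y' per] by blast
  qed
  define A where "A = L * YT T + c * M' + M' * \<Gamma> M'"
  have est: "\<bar>rho T x - \<sigma> T x\<bar> \<le> (1 + vmax) * \<epsilon> * T * exp (A * T)" if \<epsilon>: "0 < \<epsilon>" for \<epsilon>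
  proof -
    \<comment> \<open>The backward difference at a point of [0, 1] reaches left to
      \<open>y - hs k\<close>, which is above -1 once \<open>hs k < 1\<close>.\<close>
    have K1: "compact ({0..T} \<times> {-1..1::real})" by (intro compact_Times) auto
    have "uniformly_continuous_on ({0..T} \<times> {-1..1}) (\<lambda>(t, x). \<sigma>t t x)"
      by (intro compact_uniformly_continuous K1 continuous_on_subset[OF ct]) auto
    then obtain d1 where d1: "d1 > 0" "\<And>p q. p \<in> {0..T} \<times> {-1..1} \<Longrightarrow> q \<in> {0..T} \<times> {-1..1} \<Longrightarrow> dist p q < d1 \<Longrightarrow>
        dist (case p of (t, x) \<Rightarrow> \<sigma>t t x) (case q of (t, x) \<Rightarrow> \<sigma>t t x) < \<epsilon>"
      using \<epsilon> unfolding uniformly_continuous_on_def by (metis dist_commute)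
    have "uniformly_continuous_on ({0..T} \<times> {-1..1}) (\<lambda>(t, x). \<sigma>x t x)"
      by (intro compact_uniformly_continuous K1 continuous_on_subset[OF cx]) auto
    then obtain d2 where d2: "d2 > 0" "\<And>p q. p \<in> {0..T} \<times> {-1..1} \<Longrightarrow> q \<in> {0..T} \<times> {-1..1} \<Longrightarrow> dist p q < d2 \<Longrightarrow>
        dist (case p of (t, x) \<Rightarrow> \<sigma>x t x) (case q of (t, x) \<Rightarrow> \<sigma>x t x) < \<epsilon>"
      using \<epsilon> unfolding uniformly_continuous_on_def by (metis dist_commute)
    show ?thesis
    proof (rule LIMSEQ_le_const2)
      have "continuous (at T within {0..}) (\<lambda>s. \<sigma> s x)" using dt[OF T] by (rule DERIV_continuous)
      then have "(\<lambda>k. \<sigma> (real (nf k T) * ts k) x) \<longlonglongrightarrow> \<sigma> T x"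
        using nf_tendsto[OF T] ts_pos by (intro continuous_within_tendsto_compose'[of T "{0..}" "\<lambda>s. \<sigma> s x"]) (auto simp: less_imp_le)
      then show "(\<lambda>k. \<bar>R k T x - \<sigma> (real (nf k T) * ts k) x\<bar>) \<longlonglongrightarrow> \<bar>rho T x - \<sigma> T x\<bar>"
        by (intro tendsto_intros R_lim T)
      have "eventually (\<lambda>k. ts k < d1 \<and> hs k < d2 \<and> hs k < 1) sequentially"
        using order_tendstoD(2)[OF ts_tendsto d1(1)] order_tendstoD(2)[OF hs_tendsto d2(1)]
          order_tendstoD(2)[OF hs_tendsto, of 1] by (simp add: eventually_conj)
      then have "eventually (\<lambda>k. \<bar>R k T x - \<sigma> (real (nf k T) * ts k) x\<bar> \<le> (1 + vmax) * \<epsilon> * T * exp (A * T)) sequentially"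
      proof eventually_elim
        case (elim k)
        let ?h = "hs k" and ?t = "ts k"
        have h: "0 < ?h" and t: "0 < ?t" by (rule hs_pos ts_pos)+
        have cons0: "\<bar>\<sigma> (real (Suc n) * ?t) y - step ?h (\<sigma> (real n * ?t)) y\<bar> \<le> ?t * ((1 + vmax) * \<epsilon>)"
          if n: "real (Suc n) * ?t \<le> T" and y: "0 \<le> y" "y \<le> 1" for n y
        proof -
          define s where "s = real n * ?t"
          have s: "0 \<le> s" "s + ?t \<le> T" "real (Suc n) * ?t = s + ?t" using n t by (auto simp: s_def algebra_simps)
          \<comment> \<open>Mean values in time and in space turn the two difference quotients into
            derivatives at nearby points. Since the equation holds exactly at \<open>(s, y)\<close>,
            the defect consists only of the oscillations of \<open>\<sigma>t\<close> and
            \<open>\<sigma>x\<close>.\<close>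
          have "\<exists>z\<in>{s<..<s + ?t}. \<sigma> (s + ?t) y - \<sigma> s y = (\<lambda>d. \<sigma>t z y * d) (s + ?t - s)"
          proof (rule mvt_simple[of _ _ "\<lambda>s. \<sigma> s y"])
            fix r assume "s \<le> r" "r \<le> s + ?t"
            then have "((\<lambda>s. \<sigma> s y) has_real_derivative \<sigma>t r y) (at r within {s..s + ?t})"
              using s by (intro has_field_derivative_subset[OF dt]) auto
            then show "((\<lambda>s. \<sigma> s y) has_derivative (\<lambda>d. \<sigma>t r y * d)) (at r within {s..s + ?t})"
              by (simp add: has_field_derivative_def)
          qed (use t in simp)
          then obtain z where z: "s < z" "z < s + ?t" "\<sigma> (s + ?t) y - \<sigma> s y = ?t * \<sigma>t z y"
            by (auto simp: mult.commute)
          obtain \<xi> where \<xi>: "y - ?h < \<xi>" "\<xi> < y" "\<sigma> s y - \<sigma> s (y - ?h) = (y - (y - ?h)) * \<sigma>x s \<xi>"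
            using MVT2[of "y - ?h" y "\<sigma> s" "\<sigma>x s"] dx[OF s(1)] h by auto
          have b: "bd ?h (\<sigma> s) y = \<sigma>x s \<xi>" using \<xi>(3) h by (simp add: bd_def)
          have e1: "\<bar>\<sigma>t z y - \<sigma>t s y\<bar> < \<epsilon>"
            using d1(2)[of "(z, y)" "(s, y)"] z s y elim by (simp add: dist_Pair_Pair dist_real_def)
          have e2: "\<bar>bd ?h (\<sigma> s) y - \<sigma>x s y\<bar> < \<epsilon>"
            using d2(2)[of "(s, \<xi>)" "(s, y)"] \<xi> s t y elim unfolding b by (simp add: dist_Pair_Pair dist_real_def)
          have "\<bar>K (\<sigma> s) y * (bd ?h (\<sigma> s) y - \<sigma>x s y)\<bar> \<le> vmax * \<epsilon>"
            using K_bounds[OF W(2)[OF s(1)], of y] e2 by (intro abs_mult_le) auto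
          then have "\<bar>(\<sigma>t z y - \<sigma>t s y) + K (\<sigma> s) y * (bd ?h (\<sigma> s) y - \<sigma>x s y)\<bar> \<le> (1 + vmax) * \<epsilon>"
            using e1 unfolding distrib_right by linarith
          then have "\<bar>?t * ((\<sigma>t z y - \<sigma>t s y) + K (\<sigma> s) y * (bd ?h (\<sigma> s) y - \<sigma>x s y))\<bar> \<le> ?t * ((1 + vmax) * \<epsilon>)"
            using t by (intro abs_mult_le) auto
          moreover have "\<sigma> (s + ?t) y - step ?h (\<sigma> s) y =
              ?t * ((\<sigma>t z y - \<sigma>t s y) + K (\<sigma> s) y * (bd ?h (\<sigma> s) y - \<sigma>x s y))"
            using z(3) unfolding step_def eq[OF s(1)] H_def by (simp add: algebra_simps)
          ultimately show ?thesis unfolding s(3) s_def[symmetric] by simp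
        qed
        have cons: "\<bar>\<sigma> (real (Suc n) * ?t) y - step ?h (\<sigma> (real n * ?t)) y\<bar> \<le> ?t * ((1 + vmax) * \<epsilon>)"
          if n: "real (Suc n) * ?t \<le> T" for n y
        proof -
          have pos: "0 \<le> real (Suc n) * ?t" "0 \<le> real n * ?t" using t by auto
          have "\<sigma> (real (Suc n) * ?t) y = \<sigma> (real (Suc n) * ?t) (frac y)"
            by (rule periodic_frac[of "\<sigma> (real (Suc n) * ?t)", OF Per_periodic[OF W(2)[OF pos(1)]]])
          moreover have "step ?h (\<sigma> (real n * ?t)) y = step ?h (\<sigma> (real n * ?t)) (frac y)"
            by (rule periodic_frac[of "step ?h (\<sigma> (real n * ?t))", OF step_periodic[OF W(2)[OF pos(2)]]])
          ultimately show ?thesis using cons0[OF n, of "frac y"] frac_lt_1[of y] by (simp add: less_imp_le)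
        qed
        have "\<bar>U k (nf k T) x - \<sigma> (real (nf k T) * ?t) x\<bar> \<le> (1 + vmax) * \<epsilon> * T * exp (A * T)"
          unfolding A_def
        proof (rule scheme_comparison[OF h m', of T M' "YT T" "U k" "\<lambda>n. \<sigma> (real n * ?t)"])
          show "adm m' M' (YT T) (U k n)" if "real n * ?t \<le> T" for n
            using m' by (intro adm_mono[OF U_adm[OF that]]) (auto simp: m'_def M'_def)
          show "\<exists>Y'. adm m' M' Y' (\<sigma> (real n * ?t))" if "real n * ?t \<le> T" for n
            using adm\<sigma> that t by simp
          show "U k (Suc n) = step ?h (U k n)" for n by (rule U_Suc)
          show "U k 0 = \<sigma> (real 0 * ?t)" by (simp add: U_0 init)
          show "0 \<le> (1 + vmax) * \<epsilon>" using vmax_pos \<epsilon> by simp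
          show "real (nf k T) * ?t \<le> T" by (rule nf_bounds(1)[OF T])
        qed (rule cons)
        then show ?case unfolding R_def .
      qed
      then show "\<exists>N. \<forall>k\<ge>N. \<bar>R k T x - \<sigma> (real (nf k T) * ts k) x\<bar> \<le> (1 + vmax) * \<epsilon> * T * exp (A * T)"
        by (simp add: eventually_sequentially)
    qed
  qed
  define Q where "Q = (1 + vmax) * T * exp (A * T)"
  have Q: "0 \<le> Q" unfolding Q_def using vmax_pos T by simp
  have "\<bar>rho T x - \<sigma> T x\<bar> \<le> 0 + e" if e: "0 < e" for e
  proof -
    have "\<bar>rho T x - \<sigma> T x\<bar> \<le> (1 + vmax) * (e / (Q + 1)) * T * exp (A * T)" using e Q by (intro est) simp
    also have "\<dots> = e * (Q / (Q + 1))" unfolding Q_def by simp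
    also have "\<dots> \<le> e * 1" using e Q by (intro mult_left_mono) auto
    finally show ?thesis by simp
  qed
  then have "\<bar>rho T x - \<sigma> T x\<bar> \<le> 0" by (rule field_le_epsilon)
  then show ?thesis by simp
qed

end

theorem theorem2p3:
  fixes K :: "(real \<Rightarrow> real) \<Rightarrow> (real \<Rightarrow> real)"
    and vmax :: real and a :: "real \<Rightarrow> real"
    and KN :: "nat \<Rightarrow> (nat \<Rightarrow> real) \<Rightarrow> real"
    and \<rho>0 :: "real \<Rightarrow> real"
  assumes K_maps: "\<And>\<rho>. \<rho> \<in> Per \<Longrightarrow> C1 (K \<rho>) \<and> K \<rho> \<in> Per"
    and K_cont: "\<And>\<rho> \<epsilon>. \<rho> \<in> Per \<Longrightarrow> \<epsilon> > 0 \<Longrightarrow>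
                   \<exists>\<delta>>0. \<forall>\<sigma>\<in>Per. supn (\<lambda>x. \<rho> x - \<sigma> x) < \<delta> \<longrightarrow>
                          supn (\<lambda>x. K \<rho> x - K \<sigma> x) < \<epsilon>"
    and vmax_pos: "vmax > 0"
    and K_bounds: "\<And>\<rho> x. \<rho> \<in> Per \<Longrightarrow> 0 \<le> K \<rho> x \<and> K \<rho> x \<le> vmax"
    and a_mono: "mono_on {0..} a" and a_nonneg: "\<And>x. x \<ge> 0 \<Longrightarrow> a x \<ge> 0"
    and est1: "\<And>\<rho> \<sigma>. \<rho> \<in> Per \<Longrightarrow> \<sigma> \<in> Per \<Longrightarrow>
        integral {0..1} (\<lambda>x. \<bar>\<rho> x - \<sigma> x\<bar> * \<bar>K \<rho> x - K \<sigma> x\<bar>)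
          \<le> a (supn \<rho> + supn \<sigma>) * integral {0..1} (\<lambda>x. (\<rho> x - \<sigma> x)\<^sup>2)"
    and est2: "\<And>\<rho> \<sigma>. \<rho> \<in> Per \<Longrightarrow> \<sigma> \<in> Per \<Longrightarrow>
        integral {0..1} (\<lambda>x. \<bar>\<rho> x - \<sigma> x\<bar> * \<bar>deriv (\<lambda>y. K \<rho> y - K \<sigma> y) x\<bar>)
          \<le> a (supn \<rho> + supn \<sigma>) * integral {0..1} (\<lambda>x. (\<rho> x - \<sigma> x)\<^sup>2)"
    and approx: "smoothly_approximates KN K vmax"
    and init: "W2inf \<rho>0" "\<rho>0 \<in> Per"
  shows "\<exists>\<rho>. is_solution K \<rho>0 \<rho> \<and>
           (\<forall>\<sigma>. is_solution K \<rho>0 \<sigma> \<longrightarrow> (\<forall>t\<ge>0. \<forall>x. \<sigma> t x = \<rho> t x)) \<and>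
           (\<forall>t\<ge>0. \<forall>x. (INF y\<in>{0..1}. \<rho>0 y) \<le> \<rho> t x \<and> \<rho> t x \<le> (SUP y\<in>{0..1}. \<rho>0 y))"
proof -
  from approx obtain L c C S \<gamma> \<Gamma> W where "flux K vmax KN L c C S \<gamma> \<Gamma> W"
    unfolding smoothly_approximates_def flux_def
    using K_maps K_cont vmax_pos K_bounds by blast
  then interpret F: flux K vmax KN L c C S \<gamma> \<Gamma> W .
  obtain Y0 P0 where Y0: "lip Y0 \<rho>0" and P0: "lip2 P0 \<rho>0" using W2inf_Per_lip[OF init] by blast
  \<comment> \<open>With these values the bounds \<open>m\<close> and \<open>M\<close> of the scheme
    are the extrema of the initial profile, so the range estimate of the conclusion is contained in
    \<open>rho_adm\<close>.\<close>
  define m M where "m = (INF y\<in>{0..1}. \<rho>0 y)" and "M = (SUP y\<in>{0..1}. \<rho>0 y)"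
  have cont: "continuous_on {0..1} \<rho>0" by (rule lip_continuous[OF Y0])
  have ne: "{0..1::real} \<noteq> {}" by simp
  obtain x0 where x0: "x0 \<in> {0..1}" "\<And>y. y \<in> {0..1} \<Longrightarrow> \<rho>0 x0 \<le> \<rho>0 y"
    using continuous_attains_inf[OF compact_Icc ne cont] by blast
  \<comment> \<open>The infimum is attained, hence positive; pointwise positivity of
    \<open>\<rho>0\<close> alone would give only \<open>0 \<le> m\<close>.\<close>
  have "m = \<rho>0 x0" unfolding m_def using x0 by (intro cInf_eq_minimum) auto
  then have m: "0 < m" "\<And>y. y \<in> {0..1} \<Longrightarrow> m \<le> \<rho>0 y" using x0 init(2) unfolding Per_def by auto
  obtain x1 where x1: "x1 \<in> {0..1}" "\<And>y. y \<in> {0..1} \<Longrightarrow> \<rho>0 y \<le> \<rho>0 x1"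
    using continuous_attains_sup[OF compact_Icc ne cont] by blast
  have "M = \<rho>0 x1" unfolding M_def using x1 by (intro cSup_eq_maximum) auto
  then have M: "\<And>y. y \<in> {0..1} \<Longrightarrow> \<rho>0 y \<le> M" using x1 by auto
  note per = Per_periodic[OF init(2)]
  have "between m M \<rho>0" unfolding between_def
  proof
    fix x :: real
    have "frac x \<in> {0..1}" using frac_lt_1[of x] by (simp add: less_imp_le)
    then show "m \<le> \<rho>0 x \<and> \<rho>0 x \<le> M" using m(2) M periodic_frac[of \<rho>0 x, OF per] by metis
  qed
  then interpret S: scheme K vmax KN L c C S \<gamma> \<Gamma> W \<rho>0 m M Y0 P0
    using F.admI[OF m(1) _ Y0 per] P0 by unfold_locales auto
  show ?thesis
    unfolding m_def[symmetric] M_def[symmetric]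
    using S.rho_solution S.rho_unique F.admD(8,9)[OF S.rho_adm[OF _ order_refl]]
    by (intro exI[of _ S.rho]) blast
qed

end
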